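(* Let $\mathcal H\subseteq\operatorname{Lip}_{b,\mathsf d}(L,B)$, let $U=U_0+\sum_{i=1}^KU_i$ satisfy condition (SGLD) with constants $\tilde L_U$ and $m_U$, and let $\xi\in\mathbb S_1(\mathsf X,\mathsf d)$ be the initial distribution. Fix $\gamma\in\bigl(0,\tilde L_U^{-1}(K+1)^{-1}\bigr)$ and set $b_n=2\lceil\log(n)/\log(1/\Delta_1)\rceil$ with $\Delta_1=\sqrt{1-\gamma m_U}$. If $\mathcal H$ is parametric, that is, $|\mathcal H_\varepsilon|\le C_\rho\varepsilon^{-\rho}$ for all $\varepsilon\in(0,1)$ and some constants $C_\rho,\rho>0$, then, for a suitable choice of $\varepsilon=\varepsilon_n>0$, with probability at least $1-1/n$, $$V_\infty^{(\mathsf{SGLD})}(\widehat h_{n,\varepsilon})-\inf_{h\in\mathcal H}V_\infty^{(\mathsf{SGLD})}(h)\lesssim n^{-1/2}\log^{5/2}(n),$$ where $\lesssim$ stands for inequality up to a constant depending on $\rho$ and on the other constants of the problem (namely $C_\rho,L,B,\xi,m_U,\gamma$ and the constants $D,R,\varsigma$ defined in the context) but not on $n$. Moreover, if additionally the constant function $\overline\pi(f)$ belongs to $\mathcal H$, then $\inf_{h\in\mathcal H}V_\infty^{(\mathsf{SGLD})}(h)=0$ and this bound holds for the asymptotic variance $V_\infty^{(\mathsf{SGLD})}(\widehat h_{n,\varepsilon})$ itself.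
   Context: Condition (SGLD) on $U(\theta)=U_0(\theta)+\sum_{i=1}^KU_i(\theta)$, $\theta\in\mathbb R^d$: 1) for each $i\in\{0,\dots,K\}$, $U_i$ is continuously differentiable with $\tilde L_U$-Lipschitz gradient; 2) for each $i\in\{0,\dots,K\}$, $U_i$ is convex; 3) there is $m_U>0$ with $U(\theta')\ge U(\theta)+\langle\nabla U(\theta),\theta'-\theta\rangle+(m_U/2)\|\theta'-\theta\|^2$ for all $\theta,\theta'\in\mathbb R^d$. For a batch size $M\in\{1,\dots,K\}$, $\mathsf S_M$ is the set of subsets $S\subset\{1,\dots,K\}$ with $|S|=M$, and $\Upsilon_M$ is the uniform distribution on $\mathsf S_M$. SGLD recursion: $\theta_{k+1}=\theta_k-\gamma G(\theta_k,S_{k+1})+\sqrt{2\gamma}\,\xi_{k+1}$, $G(\theta,S)=\nabla U_0(\theta)+KM^{-1}\sum_{i\in S}\nabla U_i(\theta)$, with $S_{k+1}\sim\Upsilon_M$ independent of the past and $(\xi_k)_{k\ge 1}$ i.i.d. standard Gaussian in $\mathbb R^d$. Let $(\tilde S_k)_{k\ge0}$ be another sequence of independent uniform batches, $\tilde S_k$ independent of the filtration generated by $(\theta_\ell,S_\ell)_{\ell\le k}$, and $X_k=(\theta_k,\tilde S_k)\in\mathsf X=\mathbb R^d\times\mathsf S_M$, $X_0\sim\xi$. The metric on $\mathsf X$ is $\mathsf d((\vartheta,S),(\vartheta',S'))=\|\vartheta-\vartheta'\|+\mathbf 1_{\{S\ne S'\}}$. For $\gamma\in(0,\tilde L_U^{-1}(K+1)^{-1})$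 the chain $(X_k)$ has a unique invariant probability measure $\overline\pi=\pi_\gamma^{(\mathsf{SGLD})}\otimes\Upsilon_M$, with $\pi_\gamma^{(\mathsf{SGLD})}$ the invariant measure of $(\theta_k)$. $\mathbb S_1(\mathsf X,\mathsf d)$: probability measures $\mu$ on $\mathsf X$ with $\int\mathsf d(x,y)\mu(dy)<\infty$ for all $x$. $W_1^{\mathsf d}$: Wasserstein distance of order 1. $\operatorname{Lip}_{b,\mathsf d}(L,B)$: real functions $h$ on $\mathsf X$ with $|h(x)-h(y)|\le L\,\mathsf d(x,y)$ and $\sup|h|\le B$. $\mathcal H=\{f-g:g\in\mathcal G\}$ where $f$ is a fixed function (of $\theta$, viewed as a function on $\mathsf X$) and $\mathcal G$ is a set of functions on $\mathsf X$ with $\overline\pi(g)=0$; $\mathcal H$ is totally bounded in $L^2(\overline\pi)$. For $h\in\mathcal H$, with expectation for the chain started from $\overline\pi$, $$V_\infty^{(\mathsf{SGLD})}(h)=\sum_{\ell\in\mathbb Z}\mathsf E_{\overline\pi}\bigl[(h(X_0)-\overline\pi(f))(h(X_{|\ell|})-\overline\pi(f))\bigr].$$ Spectral variance based on $X_0,\dots,X_{n-1}$: $V_n(h)=\sum_{|\ell|<b_n}w_n(\ell)\rho_n^{(h)}(\ell)$, where for $\ell\ge0$, $\rho_n^{(h)}(\ell)=\rho_n^{(h)}(-\ell)=n^{-1}\sum_{k=0}^{n-\ell-1}(h(X_k)-\pi_n(h))(h(X_{k+\ell})-\pi_n(h))$, $\pi_n(h)=n^{-1}\sum_{k=0}^{n-1}h(X_k)$,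 $w_n(\ell)=w(\ell/b_n)$, $w$ symmetric, non-negative, supported on $[-1,1]$, $\sup_{y\in[0,1]}|w(y)|\le1$, $w(y)=1$ on $[-1/2,1/2]$. $\mathcal H_\varepsilon\subset\mathcal H$ is a minimal (smallest cardinality) $\varepsilon$-net of $\mathcal H$ in $L^2(\overline\pi)$, $|\mathcal H_\varepsilon|$ its cardinality, and $\widehat h_{n,\varepsilon}\in\operatorname{argmin}_{h\in\mathcal H_\varepsilon}V_n(h)$. The sample size is $n\ge2$. Constants: $D=\sup_{h\in\mathcal H}\operatorname{Var}_{\overline\pi}(h)$; $\varsigma=2LB\int W_1^{\mathsf d}(\delta_x,\overline\pi)\overline\pi(dx)$; $R=\frac{2B}{1-\Delta_1^{1/2}}\bigl(2L\{W_1^{\mathsf d}(\xi,\overline\pi)\}^{1/2}\{\int W_1^{\mathsf d}(\delta_x,\overline\pi)\overline\pi(dx)\}^{1/2}+\{2LB\,W_1^{\mathsf d}(\xi,\overline\pi)\}^{1/2}\bigr)$. *)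

theory Defs
  imports "HOL-Probability.Probability"
begin

definition grad :: "('a::euclidean_space \<Rightarrow> real) \<Rightarrow> 'a \<Rightarrow> 'a" where
  "grad f \<theta> = (THE v. GDERIV f \<theta> :> v)"

definition potential :: "nat \<Rightarrow> (nat \<Rightarrow> 'a::euclidean_space \<Rightarrow> real) \<Rightarrow> 'a \<Rightarrow> real" where
  "potential K U \<theta> = U 0 \<theta> + (\<Sum>i=1..K. U i \<theta>)"

definition sgld_condition ::
  "nat \<Rightarrow> (nat \<Rightarrow> 'a::euclidean_space \<Rightarrow> real) \<Rightarrow> real \<Rightarrow> real \<Rightarrow> bool" where
  "sgld_condition K U Lt mU \<longleftrightarrow>
     (\<forall>i\<in>{0..K}. (\<forall>\<theta>. U i differentiable (at \<theta>)) \<and> continuous_on UNIV (grad (U i))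
        \<and> Lt-lipschitz_on UNIV (grad (U i))) \<and>
     (\<forall>i\<in>{0..K}. convex_on UNIV (U i)) \<and>
     mU > 0 \<and>
     (\<forall>\<theta> \<theta>'. potential K U \<theta>' \<ge> potential K U \<theta>
        + grad (potential K U) \<theta> \<bullet> (\<theta>' - \<theta>) + mU / 2 * (norm (\<theta>' - \<theta>))\<^sup>2)"

definition batches :: "nat \<Rightarrow> nat \<Rightarrow> nat set set" where
  "batches K M = {S. S \<subseteq> {1..K} \<and> card S = M}"

definition batch_law :: "nat \<Rightarrow> nat \<Rightarrow> nat set measure" where
  "batch_law K M = uniform_count_measure (batches K M)"

text \<open>Functions on the state space are total functions on the type \<open>'a \<times> nat set\<close>; only their values on
  \<open>space (state_space K M)\<close>, that is on \<open>UNIV \<times> batches K M\<close>, matter below.\<close>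

definition state_space :: "nat \<Rightarrow> nat \<Rightarrow> ('a::euclidean_space \<times> nat set) measure" where
  "state_space K M = borel \<Otimes>\<^sub>M count_space (batches K M)"

definition state_dist :: "'a::euclidean_space \<times> nat set \<Rightarrow> 'a \<times> nat set \<Rightarrow> real" where
  "state_dist x y = norm (fst x - fst y) + (if snd x \<noteq> snd y then 1 else 0)"

definition S1 :: "nat \<Rightarrow> nat \<Rightarrow> ('a::euclidean_space \<times> nat set) measure set" where
  "S1 K M = {\<mu>. prob_space \<mu> \<and> sets \<mu> = sets (state_space K M) \<and>
     (\<forall>x\<in>space (state_space K M). (\<integral>\<^sup>+ y. ennreal (state_dist x y) \<partial>\<mu>) < \<infinity>)}"

definition couplings :: "nat \<Rightarrow> nat \<Rightarrow> ('a::euclidean_space \<times> nat set) measure \<Rightarrow>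
    ('a \<times> nat set) measure \<Rightarrow> (('a \<times> nat set) \<times> ('a \<times> nat set)) measure set" where
  "couplings K M \<mu> \<nu> = {\<Gamma>. sets \<Gamma> = sets (state_space K M \<Otimes>\<^sub>M state_space K M) \<and>
     distr \<Gamma> (state_space K M) fst = \<mu> \<and> distr \<Gamma> (state_space K M) snd = \<nu>}"

definition W1 :: "nat \<Rightarrow> nat \<Rightarrow> ('a::euclidean_space \<times> nat set) measure \<Rightarrow>
    ('a \<times> nat set) measure \<Rightarrow> ennreal" where
  "W1 K M \<mu> \<nu> = (INF \<Gamma>\<in>couplings K M \<mu> \<nu>. \<integral>\<^sup>+ p. ennreal (state_dist (fst p) (snd p)) \<partial>\<Gamma>)"

definition Lip_b :: "nat \<Rightarrow> nat \<Rightarrow> real \<Rightarrow> real \<Rightarrow> ('a::euclidean_space \<times> nat set \<Rightarrow> real) set" where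
  "Lip_b K M L B = {h.
     (\<forall>x\<in>space (state_space K M). \<forall>y\<in>space (state_space K M). \<bar>h x - h y\<bar> \<le> L * state_dist x y) \<and>
     (\<forall>x\<in>space (state_space K M). \<bar>h x\<bar> \<le> B)}"

definition std_gaussian :: "'a::euclidean_space measure" where
  "std_gaussian = density lborel (\<lambda>x. ennreal (\<Prod>b\<in>Basis. std_normal_density (x \<bullet> b)))"

definition stoch_grad ::
  "nat \<Rightarrow> nat \<Rightarrow> (nat \<Rightarrow> 'a::euclidean_space \<Rightarrow> real) \<Rightarrow> 'a \<Rightarrow> nat set \<Rightarrow> 'a" where
  "stoch_grad K M U \<theta> S = grad (U 0) \<theta> + (real K / real M) *\<^sub>R (\<Sum>i\<in>S. grad (U i) \<theta>)"

definition sgld_step ::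
  "nat \<Rightarrow> nat \<Rightarrow> (nat \<Rightarrow> 'a::euclidean_space \<Rightarrow> real) \<Rightarrow> real \<Rightarrow> 'a \<Rightarrow> nat set \<Rightarrow> 'a \<Rightarrow> 'a" where
  "sgld_step K M U \<gamma> \<theta> S z = \<theta> - \<gamma> *\<^sub>R stoch_grad K M U \<theta> S + sqrt (2 * \<gamma>) *\<^sub>R z"

text \<open>One innovation is a triple: the batch entering the recursion, the Gaussian noise, and the
  auxiliary batch that becomes the second component of the next state. These are independent.\<close>

definition innovation_law :: "nat \<Rightarrow> nat \<Rightarrow> (nat set \<times> 'a::euclidean_space \<times> nat set) measure" where
  "innovation_law K M = batch_law K M \<Otimes>\<^sub>M (std_gaussian \<Otimes>\<^sub>M batch_law K M)"

text \<open>Joint law of the initial state, distributed as \<open>\<nu>\<close>, and of the i.i.d. innovations.\<close>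

definition driving_law :: "nat \<Rightarrow> nat \<Rightarrow> ('a::euclidean_space \<times> nat set) measure \<Rightarrow>
    (('a \<times> nat set) \<times> (nat \<Rightarrow> nat set \<times> 'a \<times> nat set)) measure" where
  "driving_law K M \<nu> = \<nu> \<Otimes>\<^sub>M (\<Pi>\<^sub>M k\<in>(UNIV::nat set). innovation_law K M)"

text \<open>The random variables \<open>\<theta> k\<close>, \<open>S k\<close>, \<open>Z k\<close>, \<open>T k\<close> on \<open>P\<close> play the roles of
  \<open>\<theta>\<^sub>k\<close>, \<open>S\<^sub>k\<close>, \<open>\<xi>\<^sub>k\<close> and of the auxiliary batch at time \<open>k\<close>; the chain is \<open>(\<theta> k, T k)\<close>.
  The initial pair \<open>(\<theta> 0, T 0)\<close> has law \<open>\<nu>\<close>, and \<open>S 0\<close>, \<open>Z 0\<close> are not used.\<close>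

definition sgld_chain :: "nat \<Rightarrow> nat \<Rightarrow> (nat \<Rightarrow> 'a::euclidean_space \<Rightarrow> real) \<Rightarrow> real \<Rightarrow>
    ('a \<times> nat set) measure \<Rightarrow> 'w measure \<Rightarrow> (nat \<Rightarrow> 'w \<Rightarrow> 'a) \<Rightarrow> (nat \<Rightarrow> 'w \<Rightarrow> nat set) \<Rightarrow>
    (nat \<Rightarrow> 'w \<Rightarrow> 'a) \<Rightarrow> (nat \<Rightarrow> 'w \<Rightarrow> nat set) \<Rightarrow> bool" where
  "sgld_chain K M U \<gamma> \<nu> P \<theta> S Z T \<longleftrightarrow>
     prob_space P \<and>
     (let D = (\<lambda>\<omega>. ((\<theta> 0 \<omega>, T 0 \<omega>), \<lambda>k. (S (Suc k) \<omega>, Z (Suc k) \<omega>, T (Suc k) \<omega>)))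
      in D \<in> P \<rightarrow>\<^sub>M driving_law K M \<nu> \<and>
         distr P (driving_law K M \<nu>) D = driving_law K M \<nu>) \<and>
     (\<forall>k. \<forall>\<omega>\<in>space P.
        \<theta> (Suc k) \<omega> = sgld_step K M U \<gamma> (\<theta> k \<omega>) (S (Suc k) \<omega>) (Z (Suc k) \<omega>))"

text \<open>The same chain as a deterministic function of the initial state and the innovations, used to
  write expectations for the chain started from a given law.\<close>

primrec sgld_path :: "nat \<Rightarrow> nat \<Rightarrow> (nat \<Rightarrow> 'a::euclidean_space \<Rightarrow> real) \<Rightarrow> real \<Rightarrow>
    'a \<times> nat set \<Rightarrow> (nat \<Rightarrow> nat set \<times> 'a \<times> nat set) \<Rightarrow> nat \<Rightarrow> 'a \<times> nat set" where
  "sgld_path K M U \<gamma> x e 0 = x"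
| "sgld_path K M U \<gamma> x e (Suc k) =
     (case e k of (S, z, T) \<Rightarrow> (sgld_step K M U \<gamma> (fst (sgld_path K M U \<gamma> x e k)) S z, T))"

definition sgld_invariant :: "nat \<Rightarrow> nat \<Rightarrow> (nat \<Rightarrow> 'a::euclidean_space \<Rightarrow> real) \<Rightarrow> real \<Rightarrow>
    'a measure \<Rightarrow> bool" where
  "sgld_invariant K M U \<gamma> \<pi> \<longleftrightarrow> prob_space \<pi> \<and> sets \<pi> = sets borel \<and>
     distr (\<pi> \<Otimes>\<^sub>M (batch_law K M \<Otimes>\<^sub>M std_gaussian)) borel
       (\<lambda>(\<theta>, S, z). sgld_step K M U \<gamma> \<theta> S z) = \<pi>"

text \<open>The argument \<open>c\<close> is the centring constant.\<close>

definition asymp_var :: "nat \<Rightarrow> nat \<Rightarrow> (nat \<Rightarrow> 'a::euclidean_space \<Rightarrow> real) \<Rightarrow> real \<Rightarrow>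
    ('a \<times> nat set) measure \<Rightarrow> real \<Rightarrow> ('a \<times> nat set \<Rightarrow> real) \<Rightarrow> real" where
  "asymp_var K M U \<gamma> \<mu> c h =
     infsum (\<lambda>l::int. \<integral>(x, e). (h (sgld_path K M U \<gamma> x e 0) - c) *
                              (h (sgld_path K M U \<gamma> x e (nat \<bar>l\<bar>)) - c) \<partial>(driving_law K M \<mu>)) UNIV"

definition emp_mean :: "nat \<Rightarrow> ('x \<Rightarrow> real) \<Rightarrow> (nat \<Rightarrow> 'x) \<Rightarrow> real" where
  "emp_mean n h X = (\<Sum>k<n. h (X k)) / real n"

text \<open>The range of summation is empty when \<open>l \<ge> n\<close>.\<close>

definition emp_autocov :: "nat \<Rightarrow> ('x \<Rightarrow> real) \<Rightarrow> (nat \<Rightarrow> 'x) \<Rightarrow> nat \<Rightarrow> real" where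
  "emp_autocov n h X l =
     (\<Sum>k<n - l. (h (X k) - emp_mean n h X) * (h (X (k + l)) - emp_mean n h X)) / real n"

definition spectral_var ::
  "(real \<Rightarrow> real) \<Rightarrow> nat \<Rightarrow> nat \<Rightarrow> (nat \<Rightarrow> 'x) \<Rightarrow> ('x \<Rightarrow> real) \<Rightarrow> real" where
  "spectral_var w b n X h =
     (\<Sum>l\<in>{l::int. \<bar>l\<bar> < int b}. w (real_of_int l / real b) * emp_autocov n h X (nat \<bar>l\<bar>))"

definition lag_window :: "(real \<Rightarrow> real) \<Rightarrow> bool" where
  "lag_window w \<longleftrightarrow> (\<forall>y. w (- y) = w y) \<and> (\<forall>y. 0 \<le> w y) \<and> (\<forall>y. \<bar>y\<bar> > 1 \<longrightarrow> w y = 0) \<and>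
     (\<forall>y\<in>{0..1}. \<bar>w y\<bar> \<le> 1) \<and> (\<forall>y\<in>{-1/2..1/2}. w y = 1)"

definition contraction_rate :: "real \<Rightarrow> real \<Rightarrow> real" where
  "contraction_rate \<gamma> mU = sqrt (1 - \<gamma> * mU)"

definition bandwidth :: "real \<Rightarrow> nat \<Rightarrow> nat" where
  "bandwidth \<Delta> n = 2 * nat \<lceil>ln (real n) / ln (1 / \<Delta>)\<rceil>"

definition L2_dist :: "'x measure \<Rightarrow> ('x \<Rightarrow> real) \<Rightarrow> ('x \<Rightarrow> real) \<Rightarrow> real" where
  "L2_dist \<mu> g h = sqrt (\<integral>x. (g x - h x)\<^sup>2 \<partial>\<mu>)"

definition L2_net :: "'x measure \<Rightarrow> ('x \<Rightarrow> real) set \<Rightarrow> real \<Rightarrow> ('x \<Rightarrow> real) set \<Rightarrow> bool" where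
  "L2_net \<mu> H \<epsilon> N \<longleftrightarrow> N \<subseteq> H \<and> finite N \<and> (\<forall>h\<in>H. \<exists>g\<in>N. L2_dist \<mu> h g \<le> \<epsilon>)"

definition L2_totally_bounded :: "'x measure \<Rightarrow> ('x \<Rightarrow> real) set \<Rightarrow> bool" where
  "L2_totally_bounded \<mu> H \<longleftrightarrow> (\<forall>\<epsilon>>0. \<exists>N. L2_net \<mu> H \<epsilon> N)"

definition minimal_L2_net :: "'x measure \<Rightarrow> ('x \<Rightarrow> real) set \<Rightarrow> real \<Rightarrow> ('x \<Rightarrow> real) set \<Rightarrow> bool" where
  "minimal_L2_net \<mu> H \<epsilon> N \<longleftrightarrow> L2_net \<mu> H \<epsilon> N \<and> (\<forall>N'. L2_net \<mu> H \<epsilon> N' \<longrightarrow> card N \<le> card N')"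

definition parametric_class :: "'x measure \<Rightarrow> ('x \<Rightarrow> real) set \<Rightarrow> real \<Rightarrow> real \<Rightarrow> bool" where
  "parametric_class \<mu> H C \<rho> \<longleftrightarrow> (\<forall>\<epsilon>. 0 < \<epsilon> \<and> \<epsilon> < 1 \<longrightarrow>
     (\<forall>N. minimal_L2_net \<mu> H \<epsilon> N \<longrightarrow> real (card N) \<le> C * \<epsilon> powr (- \<rho>)))"

definition const_D :: "'x measure \<Rightarrow> ('x \<Rightarrow> real) set \<Rightarrow> real" where
  "const_D \<mu> H = (SUP h\<in>H. \<integral>x. (h x - (\<integral>y. h y \<partial>\<mu>))\<^sup>2 \<partial>\<mu>)"

text \<open>The extended reals below are finite for the initial laws and invariant laws considered, so
  that \<^const>\<open>enn2real\<close> does not collapse them to \<open>0\<close>.\<close>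

definition mean_W1 :: "nat \<Rightarrow> nat \<Rightarrow> ('a::euclidean_space \<times> nat set) measure \<Rightarrow> real" where
  "mean_W1 K M \<mu> = enn2real (\<integral>\<^sup>+ x. W1 K M (return (state_space K M) x) \<mu> \<partial>\<mu>)"

definition const_sigma ::
  "nat \<Rightarrow> nat \<Rightarrow> real \<Rightarrow> real \<Rightarrow> ('a::euclidean_space \<times> nat set) measure \<Rightarrow> real" where
  "const_sigma K M L B \<mu> = 2 * L * B * mean_W1 K M \<mu>"

definition const_R :: "nat \<Rightarrow> nat \<Rightarrow> real \<Rightarrow> real \<Rightarrow> real \<Rightarrow>
    ('a::euclidean_space \<times> nat set) measure \<Rightarrow> ('a \<times> nat set) measure \<Rightarrow> real" where
  "const_R K M L B \<Delta> \<xi> \<mu> =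
     2 * B / (1 - sqrt \<Delta>) *
       (2 * L * sqrt (enn2real (W1 K M \<xi> \<mu>)) * sqrt (mean_W1 K M \<mu>)
        + sqrt (2 * L * B * enn2real (W1 K M \<xi> \<mu>)))"

end

theory Submission
  imports Defs
begin

text \<open>
  One SGLD step with a common batch and common Gaussian noise contracts distances by
  \<open>\<Delta> = sqrt (1 - \<gamma> mU)\<close> on average: each stochastic gradient is cocoercive (Baillon--Haddad), and the
  average over the batch of the gain is governed by the strong convexity of the full potential.  Hence
  autocovariances of centred Lipschitz functions decay like \<open>\<Delta> ^ l\<close>, and the lags beyond half the
  bandwidth contribute \<open>O(1 / n)\<close> to the asymptotic variance.

  For the concentration, the chain at time \<open>k\<close> is compared with the chain restarted from a fixed
  point \<open>x0\<close> at time \<open>k - b\<close>, where \<open>b\<close> is the bandwidth, with the same innovations.  The total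
  restart error does not depend on the function under consideration and is small by Markov's
  inequality, while the restarted values depend on finitely many innovations, so that they split into
  \<open>O(ln n)\<close> families of independent bounded variables to which Hoeffding's inequality applies.  A union
  bound over lags and over a net of polynomial cardinality at scale \<open>1 / n\<close> gives a uniform
  deviation of order \<open>ln n ^ 2 / sqrt n\<close>, slightly better than required.
\<close>

subsection \<open>Random iterated maps driven by independent innovations\<close>

text \<open>With a fixed batch a step is only nonexpansive; the factor \<Delta> is gained on average
  over the batch. Coupled paths thus come close in expectation and not pathwise, so restart errors
  can be controlled only with a failure probability. Collecting them in one event keeps that
  probability outside the union bound.

  The other obstacle is the form of the constant: it may see the invariant law \<mu> only through
  \<open>const_D\<close>, \<open>const_R\<close> and \<open>const_sigma\<close>. Moments are
  therefore explicit parameters of the locales. The point \<open>x0\<close> is chosen by averaging: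
  its mean distance to \<mu> exceeds the \<mu>-average of W1(\<delta>_x, \<mu>) by at most 1. That
  average and W1(\<xi>, \<mu>) are read off from \<open>const_sigma\<close> and
  \<open>const_R\<close> by dividing by L and B. If L * B = 0 this fails, but then the functions are
  constant on the state space and all asymptotic variances vanish.

  Order of the deviation: windows of length O(ln n) and a union of polynomial size force ln n / sqrt
  n per lag, and the O(ln n) lags multiply this to ln n ^ 2 / sqrt n.\<close>

definition shift :: "nat \<Rightarrow> (nat \<Rightarrow> 'e) \<Rightarrow> nat \<Rightarrow> 'e" where
  "shift j e = (\<lambda>i. e (i + j))"

lemma shift_Suc_case_nat: "shift (Suc j) (case_nat s e) = shift j e"
  by (simp add: shift_def)

lemma shift_0 [simp]: "shift 0 e = e"
  by (simp add: shift_def)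

context sequence_space
begin

lemma coordinate_measurable:
  assumes "g \<in> N \<rightarrow>\<^sub>M S"
  shows "(\<lambda>\<omega>. g \<omega> i) \<in> N \<rightarrow>\<^sub>M M"
  using measurable_compose[OF assms measurable_component_singleton[of i UNIV "\<lambda>_. M"]] by simp

lemma shift_measurable [measurable (raw)]:
  assumes "g \<in> N \<rightarrow>\<^sub>M S"
  shows "(\<lambda>\<omega>. shift j (g \<omega>)) \<in> N \<rightarrow>\<^sub>M S"
  unfolding shift_def
  by (rule measurable_PiM_single') (use coordinate_measurable[OF assms] in \<open>auto dest: measurable_space\<close>)

lemma case_nat_measurable [measurable (raw)]:
  assumes "f \<in> N \<rightarrow>\<^sub>M M" "g \<in> N \<rightarrow>\<^sub>M S"
  shows "(\<lambda>\<omega>. case_nat (f \<omega>) (g \<omega>)) \<in> N \<rightarrow>\<^sub>M S"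
proof (rule measurable_PiM_single')
  show "(\<lambda>\<omega>. case_nat (f \<omega>) (g \<omega>)) \<in> space N \<rightarrow> (\<Pi>\<^sub>E i\<in>UNIV. space M)"
    using measurable_space[OF assms(1)] measurable_space[OF coordinate_measurable[OF assms(2)]]
    by (auto split: nat.split)
next
  fix i :: nat
  show "(\<lambda>\<omega>. case_nat (f \<omega>) (g \<omega>) i) \<in> N \<rightarrow>\<^sub>M M"
    using assms(1) coordinate_measurable[OF assms(2)] by (cases i) auto
qed

lemma shift_space: "e \<in> space S \<Longrightarrow> shift j e \<in> space S"
  using measurable_space[OF shift_measurable[of "\<lambda>e. e" S j]] by simp

text \<open>Prepending an independent draw to an i.i.d. sequence does not change its law
  (\<open>PiM_iter\<close>). As an integral identity this is conditioning on the first innovation,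
  the step on which the inductions along paths rest.\<close>

lemma nn_integral_case_nat:
  assumes [measurable]: "G \<in> borel_measurable S"
  shows "(\<integral>\<^sup>+e. G e \<partial>S) = (\<integral>\<^sup>+s. \<integral>\<^sup>+e. G (case_nat s e) \<partial>S \<partial>M)"
proof -
  have m: "(\<lambda>(s, \<omega>). case_nat s \<omega>) \<in> M \<Otimes>\<^sub>M S \<rightarrow>\<^sub>M S"
    unfolding split_beta' by (intro case_nat_measurable measurable_fst measurable_snd)
  have "(\<integral>\<^sup>+e. G e \<partial>S) = (\<integral>\<^sup>+e. G e \<partial>distr (M \<Otimes>\<^sub>M S) S (\<lambda>(s, \<omega>). case_nat s \<omega>))"
    by (simp only: PiM_iter)
  also have "\<dots> = (\<integral>\<^sup>+z. G (case z of (s, \<omega>) \<Rightarrow> case_nat s \<omega>) \<partial>(M \<Otimes>\<^sub>M S))"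
    by (rule nn_integral_distr[OF m]) simp
  also have "\<dots> = (\<integral>\<^sup>+s. \<integral>\<^sup>+e. G (case_nat s e) \<partial>S \<partial>M)"
    using P.nn_integral_fst[OF measurable_compose[OF m assms]] by simp
  finally show ?thesis .
qed

end

text \<open>Two copies receive the same innovation \<open>s\<close>, and contraction is asked in
  mean over \<open>s\<close> only, since a step with an unlucky batch need not contract. The value
  \<open>d x x\<close> is left open, hence the summand \<open>d x0 x0\<close> in
  \<open>path_drift\<close>.\<close>

locale contracting_maps = Q: prob_space Q for Q :: "'e measure" +
  fixes X :: "'x measure" and F :: "'x \<Rightarrow> 'e \<Rightarrow> 'x" and d :: "'x \<Rightarrow> 'x \<Rightarrow> real" and \<Delta> :: real
  assumes F_measurable: "(\<lambda>(x, s). F x s) \<in> X \<Otimes>\<^sub>M Q \<rightarrow>\<^sub>M X"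
    and d_measurable: "(\<lambda>(x, y). d x y) \<in> borel_measurable (X \<Otimes>\<^sub>M X)"
    and d_nonneg: "0 \<le> d x y"
    and d_sym: "d x y = d y x"
    and d_triangle: "d x z \<le> d x y + d y z"
    and contraction: "x \<in> space X \<Longrightarrow> y \<in> space X \<Longrightarrow>
        (\<integral>\<^sup>+s. ennreal (d (F x s) (F y s)) \<partial>Q) \<le> ennreal \<Delta> * ennreal (d x y)"
    and rate: "0 < \<Delta>" "\<Delta> < 1"
begin

sublocale sequence_space Q ..

primrec path :: "'x \<Rightarrow> (nat \<Rightarrow> 'e) \<Rightarrow> nat \<Rightarrow> 'x" where
  "path x e 0 = x"
| "path x e (Suc k) = F (path x e k) (e k)"

lemma measurable_F [measurable (raw)]:
  assumes "f \<in> N \<rightarrow>\<^sub>M X" "g \<in> N \<rightarrow>\<^sub>M Q"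
  shows "(\<lambda>\<omega>. F (f \<omega>) (g \<omega>)) \<in> N \<rightarrow>\<^sub>M X"
  using measurable_compose[OF measurable_Pair[OF assms] F_measurable] by simp

lemma measurable_d [measurable (raw)]:
  assumes "f \<in> N \<rightarrow>\<^sub>M X" "g \<in> N \<rightarrow>\<^sub>M X"
  shows "(\<lambda>\<omega>. d (f \<omega>) (g \<omega>)) \<in> borel_measurable N"
  using measurable_compose[OF measurable_Pair[OF assms] d_measurable] by simp

lemma path_measurable:
  assumes "f \<in> N \<rightarrow>\<^sub>M X" "\<And>i. i < k \<Longrightarrow> (\<lambda>\<omega>. g \<omega> i) \<in> N \<rightarrow>\<^sub>M Q"
  shows "(\<lambda>\<omega>. path (f \<omega>) (g \<omega>) k) \<in> N \<rightarrow>\<^sub>M X"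
  using assms(2)
proof (induction k)
  case 0
  then show ?case using assms(1) by simp
next
  case (Suc k)
  then show ?case by (simp add: measurable_F)
qed

lemma path_measurable' [measurable (raw)]:
  assumes "f \<in> N \<rightarrow>\<^sub>M X" "g \<in> N \<rightarrow>\<^sub>M S"
  shows "(\<lambda>\<omega>. path (f \<omega>) (g \<omega>) k) \<in> N \<rightarrow>\<^sub>M X"
  using assms by (intro path_measurable coordinate_measurable)

lemma path_space: "x \<in> space X \<Longrightarrow> e \<in> space S \<Longrightarrow> path x e k \<in> space X"
  using measurable_space[OF path_measurable'[of "\<lambda>_. x" S "\<lambda>e. e" k]] by simp

lemma F_space: "x \<in> space X \<Longrightarrow> s \<in> space Q \<Longrightarrow> F x s \<in> space X"
  using measurable_space[OF measurable_F[of "\<lambda>_. x" Q "\<lambda>s. s"]] by simp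

text \<open>\<open>path\<close> recurses on the last innovation; here the first one is peeled off
  instead, which is the shape that \<open>nn_integral_case_nat\<close> produces.\<close>

lemma path_case_nat: "path x (case_nat s e) (Suc k) = path (F x s) e k"
  by (induction k) auto

lemma path_add: "path x e (j + k) = path (path x e j) (shift j e) k"
  by (induction k) (auto simp: shift_def add.commute)

lemma path_cong: "(\<And>i. i < k \<Longrightarrow> e i = e' i) \<Longrightarrow> path x e k = path x e' k"
  by (induction k) auto

text \<open>The Markov property in integral form. The position at time \<open>j\<close> reads only
  the innovations before \<open>j\<close>, so the remaining ones may be replaced by a fresh
  independent sequence; \<open>G\<close> sees the whole remainder and can thus describe any
  continuation of the path.\<close>

lemma nn_integral_path_shift:
  assumes G [measurable]: "(\<lambda>(x, e). G x e) \<in> borel_measurable (X \<Otimes>\<^sub>M S)" and "x \<in> space X"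
  shows "(\<integral>\<^sup>+e. G (path x e j) (shift j e) \<partial>S) = (\<integral>\<^sup>+e. \<integral>\<^sup>+e'. G (path x e j) e' \<partial>S \<partial>S)"
  using assms(2)
proof (induction j arbitrary: x)
  case 0
  then show ?case by (simp add: P.emeasure_space_1)
next
  case (Suc j)
  note [measurable] = Suc.prems
  have 1: "(\<lambda>e. G (path x e (Suc j)) (shift (Suc j) e)) \<in> borel_measurable S"
    by measurable
  have 2: "(\<lambda>e. \<integral>\<^sup>+e'. G (path x e (Suc j)) e' \<partial>S) \<in> borel_measurable S"
    by measurable
  have "(\<integral>\<^sup>+e. G (path x e (Suc j)) (shift (Suc j) e) \<partial>S)
      = (\<integral>\<^sup>+s. \<integral>\<^sup>+e. G (path (F x s) e j) (shift j e) \<partial>S \<partial>Q)"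
    using nn_integral_case_nat[OF 1] by (simp only: path_case_nat shift_Suc_case_nat)
  also have "\<dots> = (\<integral>\<^sup>+s. \<integral>\<^sup>+e. \<integral>\<^sup>+e'. G (path (F x s) e j) e' \<partial>S \<partial>S \<partial>Q)"
    using Suc.prems by (intro nn_integral_cong Suc.IH F_space)
  also have "\<dots> = (\<integral>\<^sup>+e. \<integral>\<^sup>+e'. G (path x e (Suc j)) e' \<partial>S \<partial>S)"
    using nn_integral_case_nat[OF 2] by (simp only: path_case_nat)
  finally show ?case .
qed

lemma path_contraction:
  assumes "x \<in> space X" "y \<in> space X"
  shows "(\<integral>\<^sup>+e. ennreal (d (path x e k) (path y e k)) \<partial>S) \<le> ennreal (\<Delta> ^ k) * ennreal (d x y)"
  using assms
proof (induction k arbitrary: x y)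
  case 0
  then show ?case by (simp add: P.emeasure_space_1)
next
  case (Suc k)
  note [measurable] = Suc.prems
  have 1: "(\<lambda>e. ennreal (d (path x e (Suc k)) (path y e (Suc k)))) \<in> borel_measurable S"
    by measurable
  have "(\<integral>\<^sup>+e. ennreal (d (path x e (Suc k)) (path y e (Suc k))) \<partial>S)
      = (\<integral>\<^sup>+s. \<integral>\<^sup>+e. ennreal (d (path (F x s) e k) (path (F y s) e k)) \<partial>S \<partial>Q)"
    using nn_integral_case_nat[OF 1] by (simp only: path_case_nat)
  also have "\<dots> \<le> (\<integral>\<^sup>+s. ennreal (\<Delta> ^ k) * ennreal (d (F x s) (F y s)) \<partial>Q)"
    using Suc.prems by (intro nn_integral_mono Suc.IH F_space)
  also have "\<dots> = ennreal (\<Delta> ^ k) * (\<integral>\<^sup>+s. ennreal (d (F x s) (F y s)) \<partial>Q)"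
    by (rule nn_integral_cmult) measurable
  also have "\<dots> \<le> ennreal (\<Delta> ^ k) * (ennreal \<Delta> * ennreal (d x y))"
    using Suc.prems by (intro mult_left_mono contraction) auto
  also have "\<dots> = ennreal (\<Delta> ^ Suc k) * ennreal (d x y)"
    using rate by (simp add: ennreal_mult mult.assoc mult.left_commute)
  finally show ?case .
qed

end

subsection \<open>Hoeffding's inequality for overlapping windows\<close>

context sequence_space
begin

lemma distr_shift: "distr S S (shift j) = S"
  using distr_PiM_reindex[of UNIV "\<lambda>_. M" "\<lambda>i. i + j" UNIV] M.prob_space_axioms
  by (simp add: shift_def[abs_def] inj_on_def restrict_def)

lemma distr_coordinate: "distr S M (\<lambda>e. e i) = M"
  using distr_PiM_component[of UNIV "\<lambda>_. M" i] M.prob_space_axioms by simp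

lemma integral_shift:
  fixes W :: "(nat \<Rightarrow> 'a) \<Rightarrow> real"
  assumes "W \<in> borel_measurable S"
  shows "P.expectation (\<lambda>e. W (shift j e)) = P.expectation W"
proof -
  have "P.expectation W = integral\<^sup>L (distr S S (shift j)) W"
    by (simp only: distr_shift)
  also have "\<dots> = P.expectation (\<lambda>e. W (shift j e))"
    using assms shift_measurable[of "\<lambda>e. e" S j] by (intro integral_distr) simp_all
  finally show ?thesis by simp
qed

lemma indep_coordinates: "P.indep_vars (\<lambda>_. M) (\<lambda>i e. e i) UNIV"
proof (subst P.indep_vars_iff_distr_eq_PiM')
  show "distr S S (\<lambda>x. \<lambda>i\<in>UNIV. x i) = (\<Pi>\<^sub>M i\<in>UNIV. distr S M (\<lambda>e. e i))"
    by (simp add: distr_coordinate distr_id2 restrict_def)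
qed auto

text \<open>Distinct starting times in one residue class differ by at least \<open>q\<close>, so the
  windows \<open>{j..<j + q}\<close> are disjoint and functions of them are independent.\<close>

lemma indep_blocks:
  fixes W :: "(nat \<Rightarrow> 'a) \<Rightarrow> real"
  assumes W: "W \<in> borel_measurable S"
    and dep: "\<And>e e'. (\<And>i. i < q \<Longrightarrow> e i = e' i) \<Longrightarrow> W e = W e'"
  shows "P.indep_vars (\<lambda>_. borel) (\<lambda>j e. W (shift j e)) {j. j < N \<and> j mod q = r}"
    (is "P.indep_vars _ _ ?J")
proof -
  obtain z where z: "z \<in> space M"
    using M.not_empty by auto
  \<comment> \<open>\<open>W\<close> takes infinite sequences. Padding a window with the constant
    \<open>z\<close> writes \<open>W (shift j e)\<close> as a measurable function of the
    \<open>q\<close> coordinates in the window alone.\<close>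
  define G where "G j u = W (\<lambda>i. if i < q then u (i + j) else z)" for j and u :: "nat \<Rightarrow> 'a"
  have disj: "disjoint_family_on (\<lambda>j. {j..<j + q}) ?J"
  proof (unfold disjoint_family_on_def, intro ballI impI)
    fix j j' assume j: "j \<in> ?J" "j' \<in> ?J" "j \<noteq> j'"
    have aux: "{a..<a + q} \<inter> {a'..<a' + q} = {}" if "a mod q = a' mod q" "a < a'" for a a' :: nat
    proof -
      have "q dvd a' - a"
        using that by (metis mod_eq_dvd_iff_nat less_imp_le)
      then have "q \<le> a' - a"
        using that by (intro dvd_imp_le) auto
      then show ?thesis by auto
    qed
    show "{j..<j + q} \<inter> {j'..<j' + q} = {}"
      using j aux[of j j'] aux[of j' j] by (cases "j < j'") auto
  qed
  have "P.indep_vars (\<lambda>j. PiM {j..<j + q} (\<lambda>_. M)) (\<lambda>j e. restrict (\<lambda>i. e i) {j..<j + q}) ?J"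
    by (rule P.indep_vars_restrict[OF indep_coordinates _ disj]) auto
  then have "P.indep_vars (\<lambda>_. borel) (\<lambda>j e. G j (restrict (\<lambda>i. e i) {j..<j + q})) ?J"
  proof (rule P.indep_vars_compose2)
    fix j
    have "(\<lambda>u i. if i < q then u (i + j) else z) \<in> PiM {j..<j + q} (\<lambda>_. M) \<rightarrow>\<^sub>M S"
    proof (rule measurable_PiM_single')
      fix i :: nat
      show "(\<lambda>u. if i < q then u (i + j) else z) \<in> PiM {j..<j + q} (\<lambda>_. M) \<rightarrow>\<^sub>M M"
        using z by (cases "i < q") auto
    qed (use z in \<open>auto simp: space_PiM PiE_def Pi_def\<close>)
    from measurable_compose[OF this W]
    show "G j \<in> PiM {j..<j + q} (\<lambda>_. M) \<rightarrow>\<^sub>M borel"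
      unfolding G_def by simp
  qed
  also have "(\<lambda>j e. G j (restrict (\<lambda>i. e i) {j..<j + q})) = (\<lambda>j e. W (shift j e))"
    unfolding G_def by (intro ext dep) (auto simp: shift_def)
  finally show ?thesis .
qed

text \<open>A class has at most \<open>n / q\<close> members, with values in an interval of length
  \<open>2 * b\<close>. At deviation \<open>t * n / q\<close> Hoeffding's exponent is
  \<open>2 * (t * n / q)^2 / (card J * (2 * b)^2)\<close>, which is therefore at least
  \<open>t^2 * n / (2 * q * b^2)\<close>.\<close>

lemma hoeffding_residue:
  fixes W :: "(nat \<Rightarrow> 'a) \<Rightarrow> real" and b t :: real and n q N :: nat
  assumes W: "W \<in> borel_measurable S"
    and dep: "\<And>e e'. (\<And>i. i < q \<Longrightarrow> e i = e' i) \<Longrightarrow> W e = W e'"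
    and bound: "\<And>e. e \<in> space S \<Longrightarrow> \<bar>W e\<bar> \<le> b"
    and q: "0 < q" and N: "N + q \<le> n" and b: "0 < b" and t: "0 < t"
  shows "P.prob {e \<in> space S. \<bar>(\<Sum>j | j < N \<and> j mod q = r. W (shift j e) - P.expectation W)\<bar> \<ge> t * n / q}
      \<le> 2 * exp (- (t\<^sup>2 * n / (2 * real q * b\<^sup>2)))"
proof (cases "{j. j < N \<and> j mod q = r} = {}")
  case True
  \<comment> \<open>An empty class has sum 0, below the positive threshold; it is set apart because
    the division by \<open>card J\<close> needs a member.\<close>
  have "\<not> t * real n / real q \<le> 0"
    using t q N by (simp add: not_le)
  then show ?thesis
    unfolding True sum.empty abs_zero by simp
next
  case False
  define J where "J = {j. j < N \<and> j mod q = r}"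
  have J: "finite J" "J \<noteq> {}"
    using False by (auto simp: J_def)
  have card: "real (card J) * q \<le> n"
  proof -
    \<comment> \<open>Within a class an index is determined by its quotient by \<open>q\<close>. The
      \<open>+ 1\<close> from counting quotients up to \<open>(N - 1) div q\<close> costs at most
      \<open>q\<close>, for which \<open>N + q \<le> n\<close> leaves room.\<close>
    have "card J \<le> card {..(N - 1) div q}"
    proof (rule card_inj_on_le)
      show "inj_on (\<lambda>j. j div q) J"
        unfolding J_def inj_on_def by (metis (mono_tags, lifting) div_mult_mod_eq mem_Collect_eq)
      show "(\<lambda>j. j div q) ` J \<subseteq> {..(N - 1) div q}"
        unfolding J_def by (auto intro!: div_le_mono)
    qed simp
    then have "card J * q \<le> ((N - 1) div q + 1) * q"
      by (intro mult_right_mono) auto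
    also have "\<dots> \<le> n"
      using N div_times_less_eq_dividend[of "N - 1" q] unfolding add_mult_distrib by linarith
    finally show ?thesis
      by (metis of_nat_le_iff of_nat_mult)
  qed
  have card_pos: "0 < card J"
    using J by (simp add: card_gt_0_iff)
  interpret H: Hoeffding_ineq S J "\<lambda>j e. W (shift j e)" "\<lambda>_. - b" "\<lambda>_. b"
    "\<Sum>i\<in>J. P.expectation (\<lambda>e. W (shift i e))"
  proof unfold_locales
    show "finite J" by fact
    show "P.indep_vars (\<lambda>_. borel) (\<lambda>j e. W (shift j e)) J"
      unfolding J_def by (rule indep_blocks[OF W dep])
    show "AE e in S. W (shift i e) \<in> {- b..b}" for i
      using bound[OF shift_space] by (intro AE_I2) (auto simp: abs_le_iff minus_le_iff)
  qed
  have sum: "(\<Sum>i\<in>J. (b - - b)\<^sup>2) = real (card J) * (4 * b\<^sup>2)"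
    by (simp add: power2_eq_square)
  have eq: "(\<Sum>j\<in>J. W (shift j e) - P.expectation W)
      = (\<Sum>i\<in>J. W (shift i e)) - (\<Sum>i\<in>J. P.expectation (\<lambda>e. W (shift i e)))" for e
    by (simp add: sum_subtractf integral_shift[OF W])
  have "P.prob {e \<in> space S. \<bar>(\<Sum>j\<in>J. W (shift j e) - P.expectation W)\<bar> \<ge> t * n / q}
      \<le> 2 * exp (-2 * (t * n / q)\<^sup>2 / (real (card J) * (4 * b\<^sup>2)))"
    unfolding eq sum[symmetric] using t q N b card_pos
    by (intro H.Hoeffding_ineq_abs_ge) (auto simp: sum)
  also have "\<dots> \<le> 2 * exp (- (t\<^sup>2 * n / (2 * real q * b\<^sup>2)))"
  proof -
    have "t\<^sup>2 * n / (2 * real q * b\<^sup>2) = (t\<^sup>2 * n / (2 * real q * b\<^sup>2)) * 1" by simp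
    also have "\<dots> \<le> (t\<^sup>2 * n / (2 * real q * b\<^sup>2)) * (n / (card J * q))"
      using card card_pos q by (intro mult_left_mono) auto
    also have "\<dots> = 2 * (t * n / q)\<^sup>2 / (real (card J) * (4 * b\<^sup>2))"
      using q card_pos b by (simp add: power2_eq_square field_simps)
    finally show ?thesis by simp
  qed
  finally show ?thesis
    unfolding J_def .
qed

lemma sum_lessThan_mod:
  fixes f :: "nat \<Rightarrow> real"
  assumes "0 < q"
  shows "(\<Sum>j<N. f j) = (\<Sum>r<q. \<Sum>j | j < N \<and> j mod q = r. f j)"
proof -
  have "{j \<in> {..<N}. j mod q = r} = {j. j < N \<and> j mod q = r}" for r
    by auto
  then show ?thesis
    using sum.group[of "{..<N}" "{..<q}" "\<lambda>j. j mod q" f] assms by (simp add: image_subset_iff)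
qed

text \<open>The windows read by the summands of one residue class modulo \<open>q\<close> are disjoint, so that
  Hoeffding's inequality applies to each of the \<open>q\<close> classes.\<close>

lemma block_hoeffding:
  fixes W :: "(nat \<Rightarrow> 'a) \<Rightarrow> real" and b t :: real and n q N :: nat
  assumes W: "W \<in> borel_measurable S"
    and dep: "\<And>e e'. (\<And>i. i < q \<Longrightarrow> e i = e' i) \<Longrightarrow> W e = W e'"
    and bound: "\<And>e. e \<in> space S \<Longrightarrow> \<bar>W e\<bar> \<le> b"
    and q: "0 < q" and N: "N + q \<le> n" and b: "0 < b" and t: "0 < t"
  shows "P.prob {e \<in> space S. \<bar>\<Sum>j<N. W (shift j e) - P.expectation W\<bar> \<ge> t * n}
      \<le> 2 * real q * exp (- (t\<^sup>2 * n / (2 * real q * b\<^sup>2)))"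
proof -
  define Y where "Y r e = (\<Sum>j | j < N \<and> j mod q = r. W (shift j e) - P.expectation W)" for r e
  have Ym: "Y r \<in> borel_measurable S" for r
    unfolding Y_def using measurable_compose[OF shift_measurable[of "\<lambda>e. e" S] W] by simp
  \<comment> \<open>Pigeonhole: if all \<open>q\<close> class sums stayed below
    \<open>t * n / q\<close>, their total would stay below \<open>t * n\<close>.\<close>
  have sub: "{e \<in> space S. \<bar>\<Sum>j<N. W (shift j e) - P.expectation W\<bar> \<ge> t * n}
      \<subseteq> (\<Union>r<q. {e \<in> space S. \<bar>Y r e\<bar> \<ge> t * n / q})"
  proof (intro subsetI, rule ccontr)
    fix e assume e: "e \<in> {e \<in> space S. \<bar>\<Sum>j<N. W (shift j e) - P.expectation W\<bar> \<ge> t * n}"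
      "e \<notin> (\<Union>r<q. {e \<in> space S. \<bar>Y r e\<bar> \<ge> t * n / q})"
    have "\<bar>\<Sum>j<N. W (shift j e) - P.expectation W\<bar> = \<bar>\<Sum>r<q. Y r e\<bar>"
      unfolding Y_def by (subst sum_lessThan_mod[OF q]) simp
    also have "\<dots> \<le> (\<Sum>r<q. \<bar>Y r e\<bar>)"
      by (rule sum_abs)
    also have "\<dots> < (\<Sum>r<q. t * n / q)"
      using e q by (intro sum_strict_mono) (auto simp: not_le)
    also have "\<dots> = t * n"
      using q by simp
    finally show False
      using e by simp
  qed
  have "P.prob {e \<in> space S. \<bar>\<Sum>j<N. W (shift j e) - P.expectation W\<bar> \<ge> t * n}
      \<le> P.prob (\<Union>r<q. {e \<in> space S. \<bar>Y r e\<bar> \<ge> t * n / q})"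
    using Ym by (intro P.finite_measure_mono sub sets.finite_UN) auto
  also have "\<dots> \<le> (\<Sum>r<q. P.prob {e \<in> space S. \<bar>Y r e\<bar> \<ge> t * n / q})"
    using Ym by (intro P.finite_measure_subadditive_finite) auto
  also have "\<dots> \<le> (\<Sum>r<q. 2 * exp (- (t\<^sup>2 * n / (2 * real q * b\<^sup>2))))"
    unfolding Y_def by (intro sum_mono hoeffding_residue assms)
  finally show ?thesis by simp
qed

end

subsection \<open>Sums of even, geometrically decaying families\<close>

text \<open>\<open>asymp_var\<close> is an unordered sum over the integers, while the estimates use
  series over the natural numbers. Absolute summability allows splitting into the lags
  \<open>l \<ge> 0\<close> and \<open>l < 0\<close>; lag 0 has no mirror image and is subtracted
  once.\<close>

lemma infsum_even_int:
  fixes f :: "nat \<Rightarrow> real"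
  assumes "summable (\<lambda>l. norm (f l))"
  shows "infsum (\<lambda>l::int. f (nat \<bar>l\<bar>)) UNIV = 2 * suminf f - f 0"
proof -
  have f: "(f has_sum suminf f) UNIV"
    by (rule norm_summable_imp_has_sum[OF assms summable_sums[OF summable_norm_cancel[OF assms]]])
  have "((\<lambda>l::int. f (nat \<bar>l\<bar>)) has_sum suminf f) {0..}"
  proof (subst has_sum_reindex_bij_betw[symmetric, of int UNIV])
    show "bij_betw int UNIV {0..}"
      by (rule bij_betwI[of _ _ _ nat]) auto
  qed (use f in simp)
  moreover have "(f has_sum (suminf f - f 0)) {0<..}"
  proof -
    have "(f has_sum (suminf f - f 0)) (UNIV - {0})"
      by (rule has_sum_Diff[OF f has_sum_finiteI]) auto
    moreover have "UNIV - {0} = {0::nat<..}" by auto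
    ultimately show ?thesis by simp
  qed
  then have "((\<lambda>l::int. f (nat \<bar>l\<bar>)) has_sum (suminf f - f 0)) {..<0}"
  proof (subst has_sum_reindex_bij_betw[symmetric, of "\<lambda>i. - int i" "{0<..}"])
    show "bij_betw (\<lambda>i. - int i) {0<..} {..<0}"
      by (rule bij_betwI[of _ _ _ "\<lambda>l. nat (- l)"]) auto
  qed simp
  ultimately have "((\<lambda>l::int. f (nat \<bar>l\<bar>)) has_sum (suminf f + (suminf f - f 0))) ({0..} \<union> {..<0})"
    by (intro has_sum_Un_disjoint) auto
  moreover have "{0..} \<union> {..<0} = (UNIV :: int set)" by auto
  ultimately show ?thesis
    by (simp add: infsumI)
qed

lemma sum_even_int:
  fixes f :: "nat \<Rightarrow> real"
  assumes "0 < b"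
  shows "(\<Sum>l\<in>{l::int. \<bar>l\<bar> < int b}. f (nat \<bar>l\<bar>)) = 2 * (\<Sum>l<b. f l) - f 0"
proof -
  have split: "{l::int. \<bar>l\<bar> < int b} = int ` {..<b} \<union> (\<lambda>i. - int i) ` {1..<b}"
  proof (intro equalityI subsetI)
    fix l :: int assume l: "l \<in> {l. \<bar>l\<bar> < int b}"
    show "l \<in> int ` {..<b} \<union> (\<lambda>i. - int i) ` {1..<b}"
    proof (cases "0 \<le> l")
      case True
      then have "l = int (nat l)" "nat l \<in> {..<b}"
        using l by auto
      then show ?thesis by blast
    next
      case False
      then have "l = - int (nat (- l))" "nat (- l) \<in> {1..<b}"
        using l by auto
      then show ?thesis by blast
    qed
  qed auto
  have "(\<Sum>l\<in>{l::int. \<bar>l\<bar> < int b}. f (nat \<bar>l\<bar>))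
      = (\<Sum>l\<in>int ` {..<b}. f (nat \<bar>l\<bar>)) + (\<Sum>l\<in>(\<lambda>i. - int i) ` {1..<b}. f (nat \<bar>l\<bar>))"
    unfolding split by (intro sum.union_disjoint) auto
  also have "\<dots> = (\<Sum>l<b. f l) + (\<Sum>l=1..<b. f l)"
    by (simp add: sum.reindex inj_on_def)
  also have "(\<Sum>l<b. f l) = f 0 + (\<Sum>l=1..<b. f l)"
    using assms by (simp add: lessThan_atLeast0 sum.atLeast_Suc_lessThan)
  finally show ?thesis
    using assms by (simp add: lessThan_atLeast0 sum.atLeast_Suc_lessThan)
qed

text \<open>Below, \<open>2 * suminf f - f 0\<close> stands for the sum of \<open>f \<bar>l\<bar>\<close> over all integers \<open>l\<close>.\<close>

locale geometric_decay =
  fixes f :: "nat \<Rightarrow> real" and C \<Delta> :: real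
  assumes decay: "\<bar>f l\<bar> \<le> C * \<Delta> ^ l" and \<Delta>: "0 < \<Delta>" "\<Delta> < 1"
begin

lemma abs_summable: "summable (\<lambda>l. norm (f l))"
  by (rule summable_comparison_test[of _ "\<lambda>l. C * \<Delta> ^ l"])
     (use decay \<Delta> in \<open>auto intro!: summable_mult summable_geometric\<close>)

lemma C_nonneg: "0 \<le> C"
  using decay[of 0] by simp

lemma tail: "\<bar>suminf f - (\<Sum>l<p. f l)\<bar> \<le> C * \<Delta> ^ p / (1 - \<Delta>)"
proof -
  have s: "summable f"
    using abs_summable by (rule summable_norm_cancel)
  have s': "summable (\<lambda>l. norm (f (l + p)))"
    using abs_summable by (subst summable_iff_shift)
  have g: "(\<lambda>l. C * \<Delta> ^ p * \<Delta> ^ l) sums (C * \<Delta> ^ p * (1 / (1 - \<Delta>)))"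
    using \<Delta> by (intro sums_mult geometric_sums) auto
  have "suminf f - (\<Sum>l<p. f l) = (\<Sum>l. f (l + p))"
    using suminf_split_initial_segment[OF s, of p] by simp
  also have "\<bar>\<dots>\<bar> \<le> (\<Sum>l. norm (f (l + p)))"
    using summable_norm_cancel[OF s'] Series.summable_norm[OF s'] by simp
  also have "\<dots> \<le> (\<Sum>l. C * \<Delta> ^ p * \<Delta> ^ l)"
  proof (rule suminf_le[OF _ s' sums_summable[OF g]])
    show "norm (f (l + p)) \<le> C * \<Delta> ^ p * \<Delta> ^ l" for l
      using decay[of "l + p"] by (simp add: power_add mult_ac)
  qed
  also have "\<dots> = C * \<Delta> ^ p / (1 - \<Delta>)"
    using sums_unique[OF g] by simp
  finally show ?thesis .
qed

text \<open>For an autocovariance \<open>f\<close> the left side is the second moment of a sum of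
  \<open>n\<close> consecutive stationary terms (\<open>square_sum_eq\<close>). Replacing each
  partial sum by the full series costs a geometric tail, and these tails add up to a bound free of
  \<open>n\<close>.\<close>

lemma sum_upper_bound: "(\<Sum>k<n. 2 * (\<Sum>l<Suc k. f l) - f 0)
    \<le> n * (2 * suminf f - f 0) + 2 * C / (1 - \<Delta>)\<^sup>2"
proof -
  have "(\<Sum>k<n. 2 * (\<Sum>l<Suc k. f l) - f 0)
      \<le> (\<Sum>k<n. (2 * suminf f - f 0) + 2 * C / (1 - \<Delta>) * \<Delta> ^ k)"
  proof (rule sum_mono)
    fix k
    have "(\<Sum>l<Suc k. f l) \<le> suminf f + C * \<Delta> ^ Suc k / (1 - \<Delta>)"
      using tail[of "Suc k"] by linarith
    also have "C * \<Delta> ^ Suc k / (1 - \<Delta>) \<le> C / (1 - \<Delta>) * \<Delta> ^ k"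
      using \<Delta> C_nonneg mult_left_le[of \<Delta> "C * \<Delta> ^ k"]
      by (auto simp: mult_ac intro!: divide_right_mono)
    finally show "2 * (\<Sum>l<Suc k. f l) - f 0 \<le> 2 * suminf f - f 0 + 2 * C / (1 - \<Delta>) * \<Delta> ^ k"
      by simp
  qed
  also have "\<dots> = n * (2 * suminf f - f 0) + 2 * C / (1 - \<Delta>) * (\<Sum>k<n. \<Delta> ^ k)"
    by (simp add: sum.distrib sum_distrib_left)
  finally have "(\<Sum>k<n. 2 * (\<Sum>l<Suc k. f l) - f 0)
      \<le> n * (2 * suminf f - f 0) + 2 * C / (1 - \<Delta>) * (\<Sum>k<n. \<Delta> ^ k)" .
  moreover have "(\<Sum>k<n. \<Delta> ^ k) \<le> 1 / (1 - \<Delta>)"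
    using \<Delta> by (subst sum_gp_strict) (auto intro: divide_right_mono)
  ultimately show ?thesis
    using \<Delta> C_nonneg mult_left_mono[of "\<Sum>k<n. \<Delta> ^ k" "1 / (1 - \<Delta>)" "2 * C / (1 - \<Delta>)"]
    by (simp add: power2_eq_square)
qed

end

text \<open>Closeness uniform in the lag is not summable, so only the first \<open>b\<close> lags
  are compared and the rest is left to the decay. In \<open>3 * b * \<eta>\<close> two parts come
  from the two-sided sum and one from lag 0; the factor 4 counts two sides and two families.\<close>

lemma even_sum_diff:
  fixes \<eta> :: real
  assumes "geometric_decay f C \<Delta>" "geometric_decay g C \<Delta>"
    and diff: "\<And>l. \<bar>f l - g l\<bar> \<le> \<eta>" and b: "0 < b"
  shows "\<bar>(2 * suminf f - f 0) - (2 * suminf g - g 0)\<bar> \<le> 3 * b * \<eta> + 4 * (C * \<Delta> ^ b / (1 - \<Delta>))"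
proof -
  interpret f: geometric_decay f C \<Delta> by fact
  interpret g: geometric_decay g C \<Delta> by fact
  have "\<bar>(\<Sum>l<b. f l) - (\<Sum>l<b. g l)\<bar> \<le> (\<Sum>l<b. \<bar>f l - g l\<bar>)"
    by (simp add: sum_subtractf[symmetric] sum_abs)
  also have "\<dots> \<le> b * \<eta>"
    using sum_bounded_above[of "{..<b}" "\<lambda>l. \<bar>f l - g l\<bar>" \<eta>] diff by simp
  finally have 1: "\<bar>(\<Sum>l<b. f l) - (\<Sum>l<b. g l)\<bar> \<le> b * \<eta>" .
  have "0 \<le> \<eta>"
    using diff[of 0] by linarith
  then have "\<bar>f 0 - g 0\<bar> \<le> b * \<eta>"
    using diff[of 0] b mult_right_mono[of 1 "real b" \<eta>] by linarith
  with 1 f.tail[of b] g.tail[of b] show ?thesis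
    by linarith
qed

text \<open>A taper equal to 1 up to lag \<open>p\<close> biases only the lags beyond
  \<open>p\<close>, where \<open>f\<close> is already geometrically small, while weights at most 1
  do not amplify the estimation error \<open>\<eta>\<close>. Both the taper bias and the truncation
  at \<open>b\<close> cost one tail per side, hence the factor 4.\<close>

lemma (in geometric_decay) windowed_sum:
  fixes r v :: "nat \<Rightarrow> real" and \<eta> :: real
  assumes diff: "\<And>l. l < b \<Longrightarrow> \<bar>r l - f l\<bar> \<le> \<eta>"
    and v: "\<And>l. 0 \<le> v l" "\<And>l. v l \<le> 1" "\<And>l. l \<le> p \<Longrightarrow> v l = 1"
    and p: "0 < p" "p \<le> b"
  shows "\<bar>(2 * (\<Sum>l<b. v l * r l) - v 0 * r 0) - (2 * suminf f - f 0)\<bar>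
      \<le> 3 * b * \<eta> + 4 * (C * \<Delta> ^ p / (1 - \<Delta>))"
proof -
  have "\<bar>(\<Sum>l<b. v l * r l) - (\<Sum>l<b. f l)\<bar> \<le> (\<Sum>l<b. \<bar>v l * r l - f l\<bar>)"
    by (simp add: sum_subtractf[symmetric] sum_abs)
  also have "\<dots> \<le> (\<Sum>l<b. \<eta> + (1 - v l) * \<bar>f l\<bar>)"
  proof (rule sum_mono)
    fix l assume l: "l \<in> {..<b}"
    \<comment> \<open>Noise plus bias: the weight damps the estimation error
      \<open>r l - f l\<close>, and the taper loses \<open>(1 - v l) * f l\<close>, which is zero up
      to lag \<open>p\<close>.\<close>
    have "v l * r l - f l = v l * (r l - f l) - (1 - v l) * f l"
      by (simp add: algebra_simps)
    also have "\<bar>\<dots>\<bar> \<le> \<bar>v l * (r l - f l)\<bar> + \<bar>(1 - v l) * f l\<bar>"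
      by (rule abs_triangle_ineq4)
    also have "\<bar>v l * (r l - f l)\<bar> = v l * \<bar>r l - f l\<bar>"
      using v by (simp add: abs_mult)
    also have "v l * \<bar>r l - f l\<bar> \<le> 1 * \<eta>"
      using v diff[of l] l by (intro mult_mono) auto
    also have "\<bar>(1 - v l) * f l\<bar> = (1 - v l) * \<bar>f l\<bar>"
      using v(2)[of l] by (simp add: abs_mult)
    finally show "\<bar>v l * r l - f l\<bar> \<le> \<eta> + (1 - v l) * \<bar>f l\<bar>" by simp
  qed
  also have "\<dots> = b * \<eta> + (\<Sum>l<b. (1 - v l) * \<bar>f l\<bar>)"
    by (simp add: sum.distrib)
  also have "(\<Sum>l<b. (1 - v l) * \<bar>f l\<bar>) = (\<Sum>l=p..<b. (1 - v l) * \<bar>f l\<bar>)"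
    using v(3) by (intro sum.mono_neutral_right) auto
  also have "\<dots> \<le> (\<Sum>l=p..<b. C * \<Delta> ^ l)"
  proof (rule sum_mono)
    fix l
    have "(1 - v l) * \<bar>f l\<bar> \<le> 1 * \<bar>f l\<bar>"
      using v(1)[of l] by (intro mult_right_mono) auto
    then show "(1 - v l) * \<bar>f l\<bar> \<le> C * \<Delta> ^ l"
      using decay[of l] by simp
  qed
  also have "\<dots> = (\<Sum>l<b - p. C * \<Delta> ^ p * \<Delta> ^ l)"
    using p by (intro sum.reindex_bij_witness[of _ "\<lambda>l. l + p" "\<lambda>l. l - p"])
      (auto simp: power_add[symmetric])
  also have "\<dots> = C * \<Delta> ^ p * (\<Sum>l<b - p. \<Delta> ^ l)"
    by (simp add: sum_distrib_left)
  also have "(\<Sum>l<b - p. \<Delta> ^ l) \<le> 1 / (1 - \<Delta>)"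
    using \<Delta> by (subst sum_gp_strict) (auto intro: divide_right_mono)
  finally have 1: "\<bar>(\<Sum>l<b. v l * r l) - (\<Sum>l<b. f l)\<bar> \<le> b * \<eta> + C * \<Delta> ^ p / (1 - \<Delta>)"
    using C_nonneg \<Delta> by (simp add: mult_left_mono)
  have "\<bar>suminf f - (\<Sum>l<b. f l)\<bar> \<le> C * \<Delta> ^ p / (1 - \<Delta>)"
    using tail[of b] power_decreasing[of p b \<Delta>] p \<Delta> C_nonneg
    by (smt (verit) divide_right_mono mult_left_mono)
  moreover have "\<bar>v 0 * r 0 - f 0\<bar> \<le> b * \<eta>"
    using v(3)[of 0] diff[of 0] p mult_right_mono[of 1 "real b" \<eta>] by fastforce
  ultimately show ?thesis
    using 1 by linarith
qed

lemma square_sum_eq: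
  fixes x :: "nat \<Rightarrow> real"
  shows "(\<Sum>k<n. x k)\<^sup>2 = (\<Sum>k<n. x k * x k + 2 * (\<Sum>j<k. x j * x k))"
proof (induction n)
  case (Suc n)
  have "(\<Sum>k<Suc n. x k)\<^sup>2 = (\<Sum>k<n. x k)\<^sup>2 + (x n * x n + 2 * ((\<Sum>j<n. x j) * x n))"
    by (simp add: power2_eq_square algebra_simps)
  then show ?case
    by (simp add: Suc sum_distrib_right)
qed simp

subsection \<open>Stationary chains and their autocovariances\<close>

lemma abs_integral_le:
  fixes f :: "'a \<Rightarrow> real"
  assumes "integrable M f" "(\<integral>\<^sup>+x. ennreal \<bar>f x\<bar> \<partial>M) \<le> ennreal r" "0 \<le> r"
  shows "\<bar>\<integral>x. f x \<partial>M\<bar> \<le> r"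
proof -
  have "ennreal \<bar>\<integral>x. f x \<partial>M\<bar> \<le> (\<integral>\<^sup>+x. ennreal \<bar>f x\<bar> \<partial>M)"
    using integral_norm_bound_ennreal[OF assms(1)] by simp
  also note assms(2)
  finally show ?thesis
    using assms(3) by simp
qed

text \<open>Lets \<open>invariant_moment\<close> split a truncated distance while truncating only
  the part that is not yet known to be integrable.\<close>

lemma min_le_min_add:
  fixes u v w N :: ennreal
  assumes "u \<le> v + w"
  shows "min N u \<le> min N v + w"
proof (cases "N \<le> v")
  case True
  have "min N u \<le> N + 0" by simp
  also have "\<dots> \<le> N + w" by (rule add_left_mono) simp
  finally show ?thesis
    using True by simp
next
  case False
  have "min N u \<le> u" by simp
  also note assms
  finally show ?thesis
    using False by simp
qed

lemma (in pair_sigma_finite) integrable_tensor: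
  fixes f :: "'a \<Rightarrow> real" and g :: "'b \<Rightarrow> real"
  assumes "integrable M1 f" "integrable M2 g"
  shows "integrable (M1 \<Otimes>\<^sub>M M2) (\<lambda>(x, y). f x * g y)"
proof (rule Fubini_integrable)
  have [measurable]: "f \<in> borel_measurable M1" "g \<in> borel_measurable M2"
    using assms by auto
  show "(\<lambda>(x, y). f x * g y) \<in> borel_measurable (M1 \<Otimes>\<^sub>M M2)"
    by measurable
qed (use assms in \<open>simp_all add: abs_mult\<close>)

locale invariant_maps = contracting_maps Q X F d \<Delta> + \<mu>: prob_space \<mu>
  for Q :: "'e measure" and X :: "'x measure" and F d \<Delta> and \<mu> :: "'x measure" +
  assumes sets_\<mu> [measurable_cong]: "sets \<mu> = sets X"
    and invariant: "distr (\<mu> \<Otimes>\<^sub>M Q) X (\<lambda>(x, s). F x s) = \<mu>"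
begin

sublocale D: pair_prob_space \<mu> S ..

lemma space_\<mu>: "space \<mu> = space X"
  by (rule sets_eq_imp_space_eq[OF sets_\<mu>])

lemma nn_integral_path_stationary:
  assumes G [measurable]: "G \<in> borel_measurable X"
  shows "(\<integral>\<^sup>+x. \<integral>\<^sup>+e. G (path x e j) \<partial>S \<partial>\<mu>) = (\<integral>\<^sup>+x. G x \<partial>\<mu>)"
proof (induction j)
  case 0
  show ?case by (simp add: P.emeasure_space_1)
next
  case (Suc j)
  define H where "H y = (\<integral>\<^sup>+e. G (path y e j) \<partial>S)" for y
  have H [measurable]: "H \<in> borel_measurable X"
    unfolding H_def by measurable
  have Fm: "(\<lambda>(x, s). F x s) \<in> \<mu> \<Otimes>\<^sub>M Q \<rightarrow>\<^sub>M X"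
    using F_measurable by (simp cong: measurable_cong_sets)
  have "(\<integral>\<^sup>+x. \<integral>\<^sup>+e. G (path x e (Suc j)) \<partial>S \<partial>\<mu>) = (\<integral>\<^sup>+x. \<integral>\<^sup>+s. H (F x s) \<partial>Q \<partial>\<mu>)"
  proof (rule nn_integral_cong)
    fix x assume "x \<in> space \<mu>"
    then have [measurable]: "x \<in> space X" by (simp add: space_\<mu>)
    have "(\<lambda>e. G (path x e (Suc j))) \<in> borel_measurable S" by measurable
    from nn_integral_case_nat[OF this]
    show "(\<integral>\<^sup>+e. G (path x e (Suc j)) \<partial>S) = (\<integral>\<^sup>+s. H (F x s) \<partial>Q)"
      by (simp only: path_case_nat H_def)
  qed
  also have "\<dots> = (\<integral>\<^sup>+z. H (case z of (x, s) \<Rightarrow> F x s) \<partial>(\<mu> \<Otimes>\<^sub>M Q))"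
    using Q.nn_integral_fst[OF measurable_compose[OF Fm H]] by simp
  also have "\<dots> = (\<integral>\<^sup>+y. H y \<partial>distr (\<mu> \<Otimes>\<^sub>M Q) X (\<lambda>(x, s). F x s))"
    by (rule nn_integral_distr[OF Fm, symmetric]) simp
  also have "\<dots> = (\<integral>\<^sup>+x. G x \<partial>\<mu>)"
    unfolding invariant H_def by (rule Suc.IH)
  finally show ?case .
qed

text \<open>The Markov property and invariance together: the state at time \<open>j\<close> with the
  remaining innovations has the same joint law as the initial state with all innovations. Hence the
  law of the whole trajectory is invariant under time shifts.\<close>

lemma distr_path_shift:
  "distr (\<mu> \<Otimes>\<^sub>M S) (X \<Otimes>\<^sub>M S) (\<lambda>(x, e). (path x e j, shift j e)) = \<mu> \<Otimes>\<^sub>M S"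
proof (rule measure_eqI)
  show sets: "sets (distr (\<mu> \<Otimes>\<^sub>M S) (X \<Otimes>\<^sub>M S) (\<lambda>(x, e). (path x e j, shift j e))) = sets (\<mu> \<Otimes>\<^sub>M S)"
    by (simp add: sets_\<mu> cong: sets_pair_measure_cong)
  fix A assume "A \<in> sets (distr (\<mu> \<Otimes>\<^sub>M S) (X \<Otimes>\<^sub>M S) (\<lambda>(x, e). (path x e j, shift j e)))"
  then have A [measurable]: "A \<in> sets (X \<Otimes>\<^sub>M S)" by simp
  have A\<mu>: "A \<in> sets (\<mu> \<Otimes>\<^sub>M S)"
    using A by (simp add: sets_\<mu> cong: sets_pair_measure_cong)
  define T where "T = (\<lambda>(x, e). (path x e j, shift j e))"
  have T: "T \<in> \<mu> \<Otimes>\<^sub>M S \<rightarrow>\<^sub>M X \<Otimes>\<^sub>M S"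
    unfolding T_def by measurable
  have ind: "(\<lambda>(x, e). indicator A (x, e) :: ennreal) \<in> borel_measurable (X \<Otimes>\<^sub>M S)"
    by simp
  have "emeasure (distr (\<mu> \<Otimes>\<^sub>M S) (X \<Otimes>\<^sub>M S) T) A
      = (\<integral>\<^sup>+z. indicator A z \<partial>distr (\<mu> \<Otimes>\<^sub>M S) (X \<Otimes>\<^sub>M S) T)"
    by simp
  also have "\<dots> = (\<integral>\<^sup>+z. indicator A (T z) \<partial>(\<mu> \<Otimes>\<^sub>M S))"
    by (rule nn_integral_distr[OF T]) simp
  also have "\<dots> = (\<integral>\<^sup>+x. \<integral>\<^sup>+e. indicator A (T (x, e)) \<partial>S \<partial>\<mu>)"
    by (rule P.nn_integral_fst[symmetric], rule measurable_compose[OF T]) simp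
  also have "\<dots> = (\<integral>\<^sup>+x. \<integral>\<^sup>+e. \<integral>\<^sup>+e'. indicator A (path x e j, e') \<partial>S \<partial>S \<partial>\<mu>)"
    unfolding T_def prod.case
    by (intro nn_integral_cong nn_integral_path_shift[OF ind]) (simp add: space_\<mu>)
  also have "\<dots> = (\<integral>\<^sup>+x. \<integral>\<^sup>+e'. indicator A (x, e') \<partial>S \<partial>\<mu>)"
    by (rule nn_integral_path_stationary) measurable
  also have "\<dots> = emeasure (\<mu> \<Otimes>\<^sub>M S) A"
    by (rule P.emeasure_pair_measure[OF A\<mu>, symmetric])
  finally show "emeasure (distr (\<mu> \<Otimes>\<^sub>M S) (X \<Otimes>\<^sub>M S) (\<lambda>(x, e). (path x e j, shift j e))) A
      = emeasure (\<mu> \<Otimes>\<^sub>M S) A"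
    unfolding T_def .
qed

text \<open>The paths from \<open>F x0 s\<close> and from \<open>x0\<close> with common innovations
  are within \<open>\<Delta> ^ k * d (F x0 s) x0\<close> in mean after \<open>k\<close> steps, so
  each additional step adds a term of a geometric series.\<close>

lemma path_drift:
  assumes x0: "x0 \<in> space X"
  shows "(\<integral>\<^sup>+e. ennreal (d (path x0 e k) x0) \<partial>S)
    \<le> ennreal (1 / (1 - \<Delta>)) * (\<integral>\<^sup>+s. ennreal (d (F x0 s) x0) \<partial>Q) + ennreal (d x0 x0)"
proof -
  note [measurable] = x0
  define I where "I = (\<integral>\<^sup>+s. ennreal (d (F x0 s) x0) \<partial>Q)"
  have "(\<integral>\<^sup>+e. ennreal (d (path x0 e k) x0) \<partial>S) \<le> ennreal (\<Sum>j<k. \<Delta> ^ j) * I + ennreal (d x0 x0)"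
  proof (induction k)
    case 0
    show ?case by (simp add: P.emeasure_space_1)
  next
    case (Suc k)
    have 1: "(\<lambda>e. ennreal (d (path x0 e (Suc k)) x0)) \<in> borel_measurable S"
      by measurable
    have "(\<integral>\<^sup>+e. ennreal (d (path x0 e (Suc k)) x0) \<partial>S)
        = (\<integral>\<^sup>+s. \<integral>\<^sup>+e. ennreal (d (path (F x0 s) e k) x0) \<partial>S \<partial>Q)"
      using nn_integral_case_nat[OF 1] by (simp only: path_case_nat)
    also have "\<dots> \<le> (\<integral>\<^sup>+s. ennreal (\<Delta> ^ k) * ennreal (d (F x0 s) x0)
        + (\<integral>\<^sup>+e. ennreal (d (path x0 e k) x0) \<partial>S) \<partial>Q)"
    proof (rule nn_integral_mono)
      fix s assume s: "s \<in> space Q"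
      note [measurable] = F_space[OF x0 s]
      have "(\<integral>\<^sup>+e. ennreal (d (path (F x0 s) e k) x0) \<partial>S)
          \<le> (\<integral>\<^sup>+e. ennreal (d (path (F x0 s) e k) (path x0 e k)) + ennreal (d (path x0 e k) x0) \<partial>S)"
        using d_triangle by (intro nn_integral_mono) (simp add: d_nonneg ennreal_leI flip: ennreal_plus)
      also have "\<dots> = (\<integral>\<^sup>+e. ennreal (d (path (F x0 s) e k) (path x0 e k)) \<partial>S)
          + (\<integral>\<^sup>+e. ennreal (d (path x0 e k) x0) \<partial>S)"
        by (rule nn_integral_add) measurable
      also have "\<dots> \<le> ennreal (\<Delta> ^ k) * ennreal (d (F x0 s) x0) + (\<integral>\<^sup>+e. ennreal (d (path x0 e k) x0) \<partial>S)"
        by (intro add_right_mono path_contraction F_space x0 s)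
      finally show "(\<integral>\<^sup>+e. ennreal (d (path (F x0 s) e k) x0) \<partial>S)
          \<le> ennreal (\<Delta> ^ k) * ennreal (d (F x0 s) x0) + (\<integral>\<^sup>+e. ennreal (d (path x0 e k) x0) \<partial>S)" .
    qed
    also have "\<dots> = ennreal (\<Delta> ^ k) * I + (\<integral>\<^sup>+e. ennreal (d (path x0 e k) x0) \<partial>S)"
      unfolding I_def by (simp add: nn_integral_add nn_integral_cmult Q.emeasure_space_1)
    also have "\<dots> \<le> ennreal (\<Delta> ^ k) * I + (ennreal (\<Sum>j<k. \<Delta> ^ j) * I + ennreal (d x0 x0))"
      by (intro add_left_mono Suc.IH)
    also have "\<dots> = ennreal (\<Sum>j<Suc k. \<Delta> ^ j) * I + ennreal (d x0 x0)"
      using rate by (simp add: sum_nonneg ennreal_plus distrib_right add_ac)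
    finally show ?case .
  qed
  also have "\<dots> \<le> ennreal (1 / (1 - \<Delta>)) * I + ennreal (d x0 x0)"
  proof (intro add_right_mono mult_right_mono ennreal_leI)
    show "(\<Sum>j<k. \<Delta> ^ j) \<le> 1 / (1 - \<Delta>)"
      using rate by (subst sum_gp_strict) (auto intro: divide_right_mono)
  qed simp
  finally show ?thesis
    unfolding I_def .
qed

text \<open>The truncated moment of the invariant law is at most that of the path from \<open>x0\<close> plus a
  term that vanishes as the number of steps grows.\<close>

lemma invariant_moment:
  assumes x0: "x0 \<in> space X" and fin: "(\<integral>\<^sup>+s. ennreal (d (F x0 s) x0) \<partial>Q) < \<infinity>"
  shows "(\<integral>\<^sup>+y. ennreal (d y x0) \<partial>\<mu>) < \<infinity>"
proof -
  note [measurable] = x0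
  define b where "b = ennreal (1 / (1 - \<Delta>)) * (\<integral>\<^sup>+s. ennreal (d (F x0 s) x0) \<partial>Q) + ennreal (d x0 x0)"
  have b: "b < \<infinity>"
    using fin by (simp add: b_def ennreal_mult_less_top)
  \<comment> \<open>Untruncated, the comparison below could read
    \<open>\<infinity> \<le> \<infinity> + b\<close>. The truncated moment is finite from the start,
    and since \<open>b\<close> does not depend on the level \<open>n\<close>, the truncation can be
    lifted at the end by monotone convergence.\<close>
  have trunc: "(\<integral>\<^sup>+y. min (of_nat n) (ennreal (d y x0)) \<partial>\<mu>) \<le> b" for n :: nat
  proof -
    define v where "v k x = min (of_nat n :: ennreal) (ennreal (\<Delta> ^ k * d x x0))" for k x
    have v [measurable]: "v k \<in> borel_measurable \<mu>" for k
      unfolding v_def by measurable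
    have step: "(\<integral>\<^sup>+y. min (of_nat n) (ennreal (d y x0)) \<partial>\<mu>) \<le> (\<integral>\<^sup>+x. v k x \<partial>\<mu>) + b" for k
    proof -
      have "(\<integral>\<^sup>+y. min (of_nat n) (ennreal (d y x0)) \<partial>\<mu>)
          = (\<integral>\<^sup>+x. \<integral>\<^sup>+e. min (of_nat n) (ennreal (d (path x e k) x0)) \<partial>S \<partial>\<mu>)"
        by (rule nn_integral_path_stationary[symmetric]) measurable
      also have "\<dots> \<le> (\<integral>\<^sup>+x. v k x + b \<partial>\<mu>)"
      proof (rule nn_integral_mono)
        fix x assume "x \<in> space \<mu>"
        then have x [measurable]: "x \<in> space X" by (simp add: space_\<mu>)
        have "(\<integral>\<^sup>+e. min (of_nat n) (ennreal (d (path x e k) x0)) \<partial>S)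
            \<le> (\<integral>\<^sup>+e. min (of_nat n) (ennreal (d (path x e k) (path x0 e k))) + ennreal (d (path x0 e k) x0) \<partial>S)"
        proof (rule nn_integral_mono)
          fix e
          have "ennreal (d (path x e k) x0) \<le> ennreal (d (path x e k) (path x0 e k)) + ennreal (d (path x0 e k) x0)"
            using d_triangle by (simp add: d_nonneg ennreal_leI flip: ennreal_plus)
          then show "min (of_nat n) (ennreal (d (path x e k) x0))
              \<le> min (of_nat n) (ennreal (d (path x e k) (path x0 e k))) + ennreal (d (path x0 e k) x0)"
            by (rule min_le_min_add)
        qed
        also have "\<dots> = (\<integral>\<^sup>+e. min (of_nat n) (ennreal (d (path x e k) (path x0 e k))) \<partial>S)
            + (\<integral>\<^sup>+e. ennreal (d (path x0 e k) x0) \<partial>S)"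
          by (rule nn_integral_add) measurable
        also have "\<dots> \<le> v k x + b"
        \<comment> \<open>The expectation is bounded both by the level and by the contraction;
          taking the smaller of the two is Jensen's inequality for the concave truncation.\<close>
        proof (rule add_mono)
          have "(\<integral>\<^sup>+e. min (of_nat n) (ennreal (d (path x e k) (path x0 e k))) \<partial>S) \<le> (\<integral>\<^sup>+e. of_nat n \<partial>S)"
            by (intro nn_integral_mono) simp
          moreover have "(\<integral>\<^sup>+e. min (of_nat n) (ennreal (d (path x e k) (path x0 e k))) \<partial>S)
              \<le> (\<integral>\<^sup>+e. ennreal (d (path x e k) (path x0 e k)) \<partial>S)"
            by (intro nn_integral_mono) simp
          moreover note path_contraction[OF x x0, of k]
          ultimately show "(\<integral>\<^sup>+e. min (of_nat n) (ennreal (d (path x e k) (path x0 e k))) \<partial>S) \<le> v k x"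
            using rate by (auto simp: v_def P.emeasure_space_1 d_nonneg ennreal_mult)
          show "(\<integral>\<^sup>+e. ennreal (d (path x0 e k) x0) \<partial>S) \<le> b"
            unfolding b_def by (rule path_drift[OF x0])
        qed
        finally show "(\<integral>\<^sup>+e. min (of_nat n) (ennreal (d (path x e k) x0)) \<partial>S) \<le> v k x + b" .
      qed
      also have "\<dots> = (\<integral>\<^sup>+x. v k x \<partial>\<mu>) + b"
        by (simp add: nn_integral_add \<mu>.emeasure_space_1)
      finally show ?thesis .
    qed
    have "(\<lambda>k. \<integral>\<^sup>+x. v k x \<partial>\<mu>) \<longlonglongrightarrow> (\<integral>\<^sup>+x. 0 \<partial>\<mu>)"
    proof (rule nn_integral_dominated_convergence)
      show "AE x in \<mu>. v k x \<le> of_nat n" for k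
        by (simp add: v_def)
      show "(\<integral>\<^sup>+x. of_nat n \<partial>\<mu>) < \<infinity>"
        by (simp add: \<mu>.emeasure_space_1 of_nat_less_top)
      show "AE x in \<mu>. (\<lambda>k. v k x) \<longlonglongrightarrow> 0"
      proof (rule AE_I2)
        fix x
        have "(\<lambda>k. ennreal (\<Delta> ^ k * d x x0)) \<longlonglongrightarrow> ennreal (0 * d x x0)"
          using rate by (intro tendsto_ennrealI tendsto_mult LIMSEQ_power_zero tendsto_const) auto
        then have "(\<lambda>k. min (of_nat n) (ennreal (\<Delta> ^ k * d x x0))) \<longlonglongrightarrow> min (of_nat n) (ennreal (0 * d x x0))"
          by (intro tendsto_min tendsto_const)
        then show "(\<lambda>k. v k x) \<longlonglongrightarrow> 0"
          by (simp add: v_def)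
      qed
    qed measurable
    then have "(\<lambda>k. (\<integral>\<^sup>+x. v k x \<partial>\<mu>) + b) \<longlonglongrightarrow> 0 + b"
      by (intro tendsto_add tendsto_const) simp
    from LIMSEQ_le_const[OF this] step show ?thesis by simp
  qed
  have "(\<lambda>n. \<integral>\<^sup>+y. min (of_nat n) (ennreal (d y x0)) \<partial>\<mu>) \<longlonglongrightarrow> (\<integral>\<^sup>+y. ennreal (d y x0) \<partial>\<mu>)"
  proof (rule nn_integral_LIMSEQ)
    show "incseq (\<lambda>n y. min (of_nat n) (ennreal (d y x0)))"
      by (intro incseq_SucI le_funI min.mono order_refl of_nat_mono) simp
    fix y
    obtain m :: nat where m: "d y x0 \<le> m"
      using real_arch_simple by blast
    have "min (of_nat n) (ennreal (d y x0)) = ennreal (d y x0)" if "m \<le> n" for n :: nat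
      using that m by (intro min_absorb2) (simp add: ennreal_of_nat_eq_real_of_nat ennreal_leI)
    then show "(\<lambda>n. min (of_nat n) (ennreal (d y x0))) \<longlonglongrightarrow> ennreal (d y x0)"
      by (intro tendsto_eventually) (auto simp: eventually_sequentially)
  qed measurable
  from LIMSEQ_le_const2[OF this] trunc have "(\<integral>\<^sup>+y. ennreal (d y x0) \<partial>\<mu>) \<le> b"
    by blast
  with b show ?thesis
    by (rule le_less_trans[rotated])
qed

end

text \<open>The first moment of the invariant law enters through the explicit number
  \<open>a\<close>, so that later constants mention no other feature of
  \<open>\<mu>\<close>.\<close>

locale stationary_maps = invariant_maps Q X F d \<Delta> \<mu>
  for Q :: "'e measure" and X :: "'x measure" and F d \<Delta> and \<mu> :: "'x measure" +
  fixes x0 :: 'x and a :: real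
  assumes x0 [measurable]: "x0 \<in> space X"
    and moment: "(\<integral>\<^sup>+y. ennreal (d y x0) \<partial>\<mu>) \<le> ennreal a"
    and a_nonneg: "0 \<le> a"
begin

text \<open>One class of functions of a pair of states serves both for the products behind
  autocovariances (\<open>two_point_product\<close>) and for single values behind the mean
  (\<open>two_point_fst\<close>), so that one deviation bound covers both.\<close>

definition two_point :: "('x \<Rightarrow> 'x \<Rightarrow> real) \<Rightarrow> real \<Rightarrow> real \<Rightarrow> bool" where
  "two_point \<Phi> \<beta> L \<longleftrightarrow> (\<lambda>(x, y). \<Phi> x y) \<in> borel_measurable (X \<Otimes>\<^sub>M X) \<and> 0 \<le> L \<and>
     (\<forall>x\<in>space X. \<forall>y\<in>space X. \<bar>\<Phi> x y\<bar> \<le> \<beta>) \<and>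
     (\<forall>x\<in>space X. \<forall>y\<in>space X. \<forall>x'\<in>space X. \<forall>y'\<in>space X.
        \<bar>\<Phi> x y - \<Phi> x' y'\<bar> \<le> L * (d x x' + d y y'))"

definition lag_mean :: "('x \<Rightarrow> 'x \<Rightarrow> real) \<Rightarrow> nat \<Rightarrow> real" where
  "lag_mean \<Phi> l = (\<integral>z. \<Phi> (fst z) (path (fst z) (snd z) l) \<partial>(\<mu> \<Otimes>\<^sub>M S))"

lemma measurable_two_point:
  assumes "two_point \<Phi> \<beta> L" "f \<in> N \<rightarrow>\<^sub>M X" "g \<in> N \<rightarrow>\<^sub>M X"
  shows "(\<lambda>\<omega>. \<Phi> (f \<omega>) (g \<omega>)) \<in> borel_measurable N"
proof -
  have "(\<lambda>(x, y). \<Phi> x y) \<in> borel_measurable (X \<Otimes>\<^sub>M X)"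
    using assms(1) by (simp add: two_point_def)
  from measurable_compose[OF measurable_Pair[OF assms(2,3)] this] show ?thesis
    by simp
qed

lemma lag_mean_shift:
  assumes \<Phi>: "two_point \<Phi> \<beta> L"
  shows "lag_mean \<Phi> l = (\<integral>z. \<Phi> (path (fst z) (snd z) j) (path (fst z) (snd z) (j + l)) \<partial>(\<mu> \<Otimes>\<^sub>M S))"
proof -
  define T where "T = (\<lambda>(x, e). (path x e j, shift j e))"
  have T: "T \<in> \<mu> \<Otimes>\<^sub>M S \<rightarrow>\<^sub>M X \<Otimes>\<^sub>M S"
    unfolding T_def by measurable
  have m: "(\<lambda>z. \<Phi> (fst z) (path (fst z) (snd z) l)) \<in> borel_measurable (X \<Otimes>\<^sub>M S)"
    by (rule measurable_two_point[OF \<Phi>]) measurable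
  have "lag_mean \<Phi> l = (\<integral>z. \<Phi> (fst z) (path (fst z) (snd z) l) \<partial>distr (\<mu> \<Otimes>\<^sub>M S) (X \<Otimes>\<^sub>M S) T)"
    unfolding lag_mean_def T_def by (simp only: distr_path_shift)
  also have "\<dots> = (\<integral>z. \<Phi> (fst (T z)) (path (fst (T z)) (snd (T z)) l) \<partial>(\<mu> \<Otimes>\<^sub>M S))"
    by (rule integral_distr[OF T m])
  finally show ?thesis
    by (simp add: T_def split_beta' path_add)
qed

lemma two_point_integrable:
  assumes \<Phi>: "two_point \<Phi> \<beta> L" and f: "f \<in> N \<rightarrow>\<^sub>M X" and g: "g \<in> N \<rightarrow>\<^sub>M X" and N: "prob_space N"
  shows "integrable N (\<lambda>\<omega>. \<Phi> (f \<omega>) (g \<omega>))"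
proof -
  interpret N: prob_space N by fact
  show ?thesis
    using \<Phi> measurable_space[OF f] measurable_space[OF g]
    by (intro N.integrable_const_bound[of _ \<beta>] measurable_two_point[OF \<Phi> f g])
       (auto simp: two_point_def)
qed

lemma two_point_integral_diff:
  assumes \<Phi>: "two_point \<Phi> \<beta> L" and N: "prob_space N"
    and f: "f \<in> N \<rightarrow>\<^sub>M X" and g: "g \<in> N \<rightarrow>\<^sub>M X" and f': "f' \<in> N \<rightarrow>\<^sub>M X" and g': "g' \<in> N \<rightarrow>\<^sub>M X"
    and 1: "(\<integral>\<^sup>+\<omega>. ennreal (d (f \<omega>) (f' \<omega>)) \<partial>N) \<le> ennreal r"
    and 2: "(\<integral>\<^sup>+\<omega>. ennreal (d (g \<omega>) (g' \<omega>)) \<partial>N) \<le> ennreal r" and r: "0 \<le> r"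
  shows "\<bar>(\<integral>\<omega>. \<Phi> (f \<omega>) (g \<omega>) \<partial>N) - (\<integral>\<omega>. \<Phi> (f' \<omega>) (g' \<omega>) \<partial>N)\<bar> \<le> 2 * L * r"
proof -
  have L: "0 \<le> L"
    using \<Phi> by (simp add: two_point_def)
  note [measurable] = f g f' g'
  note int = two_point_integrable[OF \<Phi> f g N] two_point_integrable[OF \<Phi> f' g' N]
  have "(\<integral>\<^sup>+\<omega>. ennreal \<bar>\<Phi> (f \<omega>) (g \<omega>) - \<Phi> (f' \<omega>) (g' \<omega>)\<bar> \<partial>N)
      \<le> (\<integral>\<^sup>+\<omega>. ennreal L * (ennreal (d (f \<omega>) (f' \<omega>)) + ennreal (d (g \<omega>) (g' \<omega>))) \<partial>N)"
    using \<Phi> L measurable_space[OF f] measurable_space[OF g] measurable_space[OF f'] measurable_space[OF g']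
    by (intro nn_integral_mono)
       (auto simp: two_point_def d_nonneg simp flip: ennreal_plus ennreal_mult intro!: ennreal_leI)
  also have "\<dots> = ennreal L * ((\<integral>\<^sup>+\<omega>. ennreal (d (f \<omega>) (f' \<omega>)) \<partial>N) + (\<integral>\<^sup>+\<omega>. ennreal (d (g \<omega>) (g' \<omega>)) \<partial>N))"
    by (subst nn_integral_cmult, measurable) (subst nn_integral_add, measurable)
  also have "\<dots> \<le> ennreal L * (ennreal r + ennreal r)"
    by (intro mult_left_mono add_mono 1 2) simp
  also have "\<dots> = ennreal (2 * L * r)"
    using L r by (simp add: mult_ac flip: ennreal_plus ennreal_mult)
  finally have "\<bar>\<integral>\<omega>. \<Phi> (f \<omega>) (g \<omega>) - \<Phi> (f' \<omega>) (g' \<omega>) \<partial>N\<bar> \<le> 2 * L * r"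
    using int L r by (intro abs_integral_le) auto
  then show ?thesis
    using int by simp
qed

text \<open>The law \<open>\<nu>\<close> is free because both the invariant law and the initial law
  of the chain are compared with the path from \<open>x0\<close>.\<close>

lemma path_to_x0:
  assumes "prob_space \<nu>" and \<nu>: "sets \<nu> = sets X" and "(\<integral>\<^sup>+y. ennreal (d y x0) \<partial>\<nu>) \<le> ennreal a'"
  shows "(\<integral>\<^sup>+x. \<integral>\<^sup>+e. ennreal (d (path x e k) (path x0 e k)) \<partial>S \<partial>\<nu>) \<le> ennreal (\<Delta> ^ k) * ennreal a'"
proof -
  have sp: "space \<nu> = space X"
    by (rule sets_eq_imp_space_eq[OF \<nu>])
  note [measurable_cong] = \<nu>
  have "(\<integral>\<^sup>+x. \<integral>\<^sup>+e. ennreal (d (path x e k) (path x0 e k)) \<partial>S \<partial>\<nu>)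
      \<le> (\<integral>\<^sup>+x. ennreal (\<Delta> ^ k) * ennreal (d x x0) \<partial>\<nu>)"
    by (intro nn_integral_mono path_contraction) (auto simp: sp x0)
  also have "\<dots> = ennreal (\<Delta> ^ k) * (\<integral>\<^sup>+x. ennreal (d x x0) \<partial>\<nu>)"
    by (rule nn_integral_cmult) measurable
  also have "\<dots> \<le> ennreal (\<Delta> ^ k) * ennreal a'"
    by (intro mult_left_mono assms) simp
  finally show ?thesis .
qed

lemma path_to_x0_\<mu>:
  "(\<integral>\<^sup>+z. ennreal (d (path (fst z) (snd z) k) (path x0 (snd z) k)) \<partial>(\<mu> \<Otimes>\<^sub>M S)) \<le> ennreal (\<Delta> ^ k * a)"
proof -
  have "(\<integral>\<^sup>+z. ennreal (d (path (fst z) (snd z) k) (path x0 (snd z) k)) \<partial>(\<mu> \<Otimes>\<^sub>M S))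
      = (\<integral>\<^sup>+x. \<integral>\<^sup>+e. ennreal (d (path x e k) (path x0 e k)) \<partial>S \<partial>\<mu>)"
    using P.nn_integral_fst[of "\<lambda>z. ennreal (d (path (fst z) (snd z) k) (path x0 (snd z) k))" \<mu>] by simp
  also have "\<dots> \<le> ennreal (\<Delta> ^ k) * ennreal a"
    by (rule path_to_x0[OF _ sets_\<mu> moment]) unfold_locales
  finally show ?thesis
    using rate a_nonneg by (simp add: ennreal_mult)
qed

lemma integral_snd_\<mu>:
  fixes G :: "(nat \<Rightarrow> 'e) \<Rightarrow> real"
  assumes "integrable S G"
  shows "(\<integral>z. G (snd z) \<partial>(\<mu> \<Otimes>\<^sub>M S)) = P.expectation G"
proof -
  have "integrable (\<mu> \<Otimes>\<^sub>M S) (\<lambda>(x, e). (1::real) * G e)"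
    by (rule D.integrable_tensor) (use assms in simp_all)
  from D.integral_fst'[OF this] show ?thesis
    by (simp add: split_beta' \<mu>.prob_space)
qed

text \<open>After \<open>j\<close> steps the path from \<open>x0\<close> is within
  \<open>\<Delta> ^ j * a\<close> in mean of the stationary path with the same innovations, and
  \<open>l\<close> further steps only bring them closer. This is the bias left over when windows are
  centred at their own mean.\<close>

lemma window_mean:
  assumes \<Phi>: "two_point \<Phi> \<beta> L"
  shows "\<bar>P.expectation (\<lambda>e. \<Phi> (path x0 e j) (path x0 e (j + l))) - lag_mean \<Phi> l\<bar> \<le> 2 * L * (\<Delta> ^ j * a)"
proof -
  have pS: "prob_space S" and pD: "prob_space (\<mu> \<Otimes>\<^sub>M S)" by unfold_locales
  have int: "integrable S (\<lambda>e. \<Phi> (path x0 e j) (path x0 e (j + l)))"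
    by (rule two_point_integrable[OF \<Phi> _ _ pS]) measurable
  have "\<Delta> ^ (j + l) \<le> \<Delta> ^ j"
    using rate by (intro power_decreasing) auto
  then have le: "ennreal (\<Delta> ^ (j + l) * a) \<le> ennreal (\<Delta> ^ j * a)"
    using a_nonneg by (intro ennreal_leI mult_right_mono)
  have "\<bar>(\<integral>z. \<Phi> (path (fst z) (snd z) j) (path (fst z) (snd z) (j + l)) \<partial>(\<mu> \<Otimes>\<^sub>M S))
      - (\<integral>z. \<Phi> (path x0 (snd z) j) (path x0 (snd z) (j + l)) \<partial>(\<mu> \<Otimes>\<^sub>M S))\<bar> \<le> 2 * L * (\<Delta> ^ j * a)"
  proof (rule two_point_integral_diff[OF \<Phi> pD])
    show "0 \<le> \<Delta> ^ j * a"
      using rate a_nonneg by simp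
  qed (measurable, rule path_to_x0_\<mu>, rule order_trans[OF path_to_x0_\<mu> le])
  then show ?thesis
    unfolding lag_mean_shift[OF \<Phi>, of l j] integral_snd_\<mu>[OF int]
    by (simp add: abs_minus_commute)
qed

text \<open>Requiring \<open>1 \<le> \<beta>\<close> gives \<open>\<beta> \<le> \<beta>^2\<close>
  and \<open>L \<le> \<beta> * L\<close>, so that \<open>g\<close> and the products
  \<open>g x * g y\<close> are \<open>two_point\<close> with the same constants.\<close>

definition lip_fun :: "('x \<Rightarrow> real) \<Rightarrow> real \<Rightarrow> real \<Rightarrow> bool" where
  "lip_fun g \<beta> L \<longleftrightarrow> g \<in> borel_measurable X \<and> 0 \<le> L \<and> 1 \<le> \<beta> \<and> (\<forall>x\<in>space X. \<bar>g x\<bar> \<le> \<beta>) \<and>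
     (\<forall>x\<in>space X. \<forall>y\<in>space X. \<bar>g x - g y\<bar> \<le> L * d x y)"

definition autocov :: "('x \<Rightarrow> real) \<Rightarrow> nat \<Rightarrow> real" where
  "autocov g = lag_mean (\<lambda>x y. g x * g y)"

lemma two_point_product:
  assumes "lip_fun g \<beta> L"
  shows "two_point (\<lambda>x y. g x * g y) (\<beta>\<^sup>2) (\<beta> * L)"
proof -
  have g [measurable]: "g \<in> borel_measurable X" and L: "0 \<le> L" "1 \<le> \<beta>"
    and bound: "\<And>x. x \<in> space X \<Longrightarrow> \<bar>g x\<bar> \<le> \<beta>"
    and lip: "\<And>x y. x \<in> space X \<Longrightarrow> y \<in> space X \<Longrightarrow> \<bar>g x - g y\<bar> \<le> L * d x y"
    using assms by (auto simp: lip_fun_def)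
  have "\<bar>g x * g y - g x' * g y'\<bar> \<le> \<beta> * L * (d x x' + d y y')"
    if "x \<in> space X" "y \<in> space X" "x' \<in> space X" "y' \<in> space X" for x y x' y'
  proof -
    have "\<bar>g x * g y - g x' * g y'\<bar> = \<bar>(g x - g x') * g y + g x' * (g y - g y')\<bar>"
      by (simp add: algebra_simps)
    also have "\<dots> \<le> \<bar>g x - g x'\<bar> * \<bar>g y\<bar> + \<bar>g x'\<bar> * \<bar>g y - g y'\<bar>"
      by (metis abs_mult abs_triangle_ineq)
    also have "\<dots> \<le> (L * d x x') * \<beta> + \<beta> * (L * d y y')"
      using that L by (intro add_mono mult_mono bound lip) (auto simp: d_nonneg)
    finally show ?thesis by (simp add: algebra_simps)
  qed
  moreover have "\<bar>g x * g y\<bar> \<le> \<beta>\<^sup>2" if "x \<in> space X" "y \<in> space X" for x y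
    using bound[OF that(1)] bound[OF that(2)] L
    by (auto simp: abs_mult power2_eq_square intro!: mult_mono)
  ultimately show ?thesis
    using L by (auto simp: two_point_def)
qed

lemma two_point_fst:
  assumes "lip_fun g \<beta> L"
  shows "two_point (\<lambda>x y. g x) (\<beta>\<^sup>2) (\<beta> * L)"
proof -
  have g [measurable]: "g \<in> borel_measurable X" and L: "0 \<le> L" "1 \<le> \<beta>"
    using assms by (auto simp: lip_fun_def)
  have "\<beta> \<le> \<beta>\<^sup>2"
    using L by (simp add: self_le_power)
  moreover have "L * d x x' \<le> \<beta> * L * (d x x' + d y y')" for x x' y y'
  proof -
    have "1 * (L * d x x') \<le> \<beta> * (L * (d x x' + d y y'))"
      using L by (intro mult_mono) (auto simp: d_nonneg)
    then show ?thesis by (simp add: mult_ac)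
  qed
  moreover have "\<bar>g x\<bar> \<le> \<beta>" if "x \<in> space X" for x
    using assms that by (auto simp: lip_fun_def)
  moreover have "\<bar>g x - g x'\<bar> \<le> L * d x x'" if "x \<in> space X" "x' \<in> space X" for x x'
    using assms that by (auto simp: lip_fun_def)
  moreover have "(\<lambda>(x, y :: 'x). g x) \<in> borel_measurable (X \<Otimes>\<^sub>M X)"
    by measurable
  ultimately show ?thesis
    unfolding two_point_def using L by (blast intro: order_trans mult_nonneg_nonneg order_trans[OF zero_le_one])
qed

lemma integrable_\<mu>:
  assumes "lip_fun g \<beta> L"
  shows "integrable \<mu> g"
  using assms by (intro \<mu>.integrable_const_bound[of _ \<beta>]) (auto simp: lip_fun_def space_\<mu> cong: measurable_cong_sets)

lemma lag_mean_fst: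
  assumes "lip_fun g \<beta> L"
  shows "lag_mean (\<lambda>x y. g x) 0 = (\<integral>x. g x \<partial>\<mu>)"
proof -
  have [measurable]: "g \<in> borel_measurable X"
    using assms by (simp add: lip_fun_def)
  have "integrable (\<mu> \<Otimes>\<^sub>M S) (\<lambda>(x, e). g x * (1::real))"
    by (rule D.integrable_tensor) (use integrable_\<mu>[OF assms] in simp_all)
  from D.integral_fst'[OF this] show ?thesis
    unfolding lag_mean_def by (simp add: split_beta' P.prob_space)
qed

text \<open>Comparing \<open>X\<^sub>l\<close> with the path from \<open>x0\<close> driven by the same innovations, which is
  independent of the initial state, turns the centring of \<open>g\<close> into geometric decay.\<close>

lemma autocov_decay:
  assumes g: "lip_fun g \<beta> L" and center: "(\<integral>x. g x \<partial>\<mu>) = 0"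
  shows "\<bar>autocov g l\<bar> \<le> \<beta> * L * a * \<Delta> ^ l"
proof -
  have gm [measurable]: "g \<in> borel_measurable X" and L: "0 \<le> L" "1 \<le> \<beta>"
    and bound: "\<And>x. x \<in> space X \<Longrightarrow> \<bar>g x\<bar> \<le> \<beta>"
    and lip: "\<And>x y. x \<in> space X \<Longrightarrow> y \<in> space X \<Longrightarrow> \<bar>g x - g y\<bar> \<le> L * d x y"
    using g by (auto simp: lip_fun_def)
  have pS: "prob_space S" and pD: "prob_space (\<mu> \<Otimes>\<^sub>M S)" by unfold_locales
  have intS: "integrable S (\<lambda>e. g (path x0 e l))"
    by (rule two_point_integrable[OF two_point_fst[OF g] _ _ pS]) measurable
  have int2: "integrable (\<mu> \<Otimes>\<^sub>M S) (\<lambda>(x, e). g x * g (path x0 e l))"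
    by (rule D.integrable_tensor[OF integrable_\<mu>[OF g] intS])
  \<comment> \<open>The initial state and the path from \<open>x0\<close> are independent, so the
    integral factorises and the centred factor annihilates it.\<close>
  have zero: "(\<integral>z. g (fst z) * g (path x0 (snd z) l) \<partial>(\<mu> \<Otimes>\<^sub>M S)) = 0"
    using D.integral_fst'[OF int2] center by (simp add: split_beta')
  have int1: "integrable (\<mu> \<Otimes>\<^sub>M S) (\<lambda>z. g (fst z) * g (path (fst z) (snd z) l))"
    by (rule two_point_integrable[OF two_point_product[OF g] _ _ pD]) measurable
  have "(\<integral>\<^sup>+z. ennreal \<bar>g (fst z) * g (path (fst z) (snd z) l) - g (fst z) * g (path x0 (snd z) l)\<bar> \<partial>(\<mu> \<Otimes>\<^sub>M S))
      \<le> (\<integral>\<^sup>+z. ennreal (\<beta> * L) * ennreal (d (path (fst z) (snd z) l) (path x0 (snd z) l)) \<partial>(\<mu> \<Otimes>\<^sub>M S))"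
  proof (rule nn_integral_mono)
    fix z assume "z \<in> space (\<mu> \<Otimes>\<^sub>M S)"
    then have z: "fst z \<in> space X" "snd z \<in> space S"
      by (auto simp: space_pair_measure space_\<mu>)
    have "\<bar>g (fst z) * g (path (fst z) (snd z) l) - g (fst z) * g (path x0 (snd z) l)\<bar>
        = \<bar>g (fst z)\<bar> * \<bar>g (path (fst z) (snd z) l) - g (path x0 (snd z) l)\<bar>"
      by (simp add: right_diff_distrib[symmetric] abs_mult)
    also have "\<dots> \<le> \<beta> * (L * d (path (fst z) (snd z) l) (path x0 (snd z) l))"
      using z L x0 by (intro mult_mono bound lip path_space) auto
    finally show "ennreal \<bar>g (fst z) * g (path (fst z) (snd z) l) - g (fst z) * g (path x0 (snd z) l)\<bar>
        \<le> ennreal (\<beta> * L) * ennreal (d (path (fst z) (snd z) l) (path x0 (snd z) l))"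
      using L by (simp add: d_nonneg mult.assoc ennreal_leI flip: ennreal_mult)
  qed
  also have "\<dots> = ennreal (\<beta> * L) * (\<integral>\<^sup>+z. ennreal (d (path (fst z) (snd z) l) (path x0 (snd z) l)) \<partial>(\<mu> \<Otimes>\<^sub>M S))"
    by (rule nn_integral_cmult) measurable
  also have "\<dots> \<le> ennreal (\<beta> * L) * ennreal (\<Delta> ^ l * a)"
    by (intro mult_left_mono path_to_x0_\<mu>) simp
  also have "\<dots> = ennreal (\<beta> * L * a * \<Delta> ^ l)"
    using L rate a_nonneg by (simp add: mult_ac flip: ennreal_mult)
  finally have "\<bar>\<integral>z. g (fst z) * g (path (fst z) (snd z) l) - g (fst z) * g (path x0 (snd z) l) \<partial>(\<mu> \<Otimes>\<^sub>M S)\<bar>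
      \<le> \<beta> * L * a * \<Delta> ^ l"
    using int1 int2 L rate a_nonneg by (intro abs_integral_le) (auto simp: split_beta')
  then show ?thesis
    using int1 int2 zero by (simp add: autocov_def lag_mean_def split_beta')
qed

lemma geometric_decay_autocov:
  assumes "lip_fun g \<beta> L" "(\<integral>x. g x \<partial>\<mu>) = 0"
  shows "geometric_decay (autocov g) (\<beta> * L * a) \<Delta>"
  using autocov_decay[OF assms] rate by unfold_locales auto

definition long_run_var :: "('x \<Rightarrow> real) \<Rightarrow> real" where
  "long_run_var g = 2 * suminf (autocov g) - autocov g 0"

text \<open>The second moment of the sum of the first \<open>n\<close> terms is at most
  \<open>n * long_run_var g\<close> plus a constant; a negative value would make it negative for
  large \<open>n\<close>. Nonnegativity is what later identifies the infimum as 0 once a constant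
  function is available.\<close>

lemma long_run_var_nonneg:
  assumes g: "lip_fun g \<beta> L" and center: "(\<integral>x. g x \<partial>\<mu>) = 0"
  shows "0 \<le> long_run_var g"
proof (rule ccontr)
  assume "\<not> 0 \<le> long_run_var g"
  then have neg: "long_run_var g < 0" by simp
  interpret f: geometric_decay "autocov g" "\<beta> * L * a" \<Delta>
    by (rule geometric_decay_autocov[OF assms])
  have pD: "prob_space (\<mu> \<Otimes>\<^sub>M S)" by unfold_locales
  have [measurable]: "g \<in> borel_measurable X"
    using g by (simp add: lip_fun_def)
  define x where "x k z = g (path (fst z) (snd z) k)" for k z
  have int: "integrable (\<mu> \<Otimes>\<^sub>M S) (\<lambda>z. x j z * x k z)" for j k
    unfolding x_def by (rule two_point_integrable[OF two_point_product[OF g] _ _ pD]) measurable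
  have mean: "(\<integral>z. x j z * x k z \<partial>(\<mu> \<Otimes>\<^sub>M S)) = autocov g (k - j)" if "j \<le> k" for j k
    using that lag_mean_shift[OF two_point_product[OF g], of "k - j" j]
    by (simp add: autocov_def x_def)
  have lower: "0 \<le> n * long_run_var g + 2 * (\<beta> * L * a) / (1 - \<Delta>)\<^sup>2" for n :: nat
  proof -
    have "0 \<le> (\<integral>z. (\<Sum>k<n. x k z)\<^sup>2 \<partial>(\<mu> \<Otimes>\<^sub>M S))"
      by simp
    also have "\<dots> = (\<Sum>k<n. autocov g 0 + 2 * (\<Sum>j<k. autocov g (k - j)))"
      unfolding square_sum_eq using int mean
      by (simp add: Bochner_Integration.integral_sum Bochner_Integration.integrable_sum)
    also have "\<dots> = (\<Sum>k<n. 2 * (\<Sum>l<Suc k. autocov g l) - autocov g 0)"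
    proof (rule sum.cong[OF refl])
      fix k
      have "(\<Sum>j<k. autocov g (k - j)) = (\<Sum>l<k. autocov g (Suc l))"
        by (subst sum.nat_diff_reindex[symmetric]) (auto intro: sum.cong simp: Suc_diff_Suc)
      then show "autocov g 0 + 2 * (\<Sum>j<k. autocov g (k - j)) = 2 * (\<Sum>l<Suc k. autocov g l) - autocov g 0"
        by (simp add: sum.lessThan_Suc_shift del: sum.lessThan_Suc)
    qed
    also have "\<dots> \<le> n * long_run_var g + 2 * (\<beta> * L * a) / (1 - \<Delta>)\<^sup>2"
      unfolding long_run_var_def by (rule f.sum_upper_bound)
    finally show ?thesis .
  qed
  obtain n :: nat where "2 * (\<beta> * L * a) / (1 - \<Delta>)\<^sup>2 / (- long_run_var g) < n"
    using reals_Archimedean2 by blast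
  then have "2 * (\<beta> * L * a) / (1 - \<Delta>)\<^sup>2 < n * (- long_run_var g)"
    by (subst (asm) pos_divide_less_eq) (use neg in simp_all)
  with lower[of n] show False by simp
qed

text \<open>Closeness in L1 of the invariant law suffices at every lag, because each state of a
  stationary path has law \<open>\<mu>\<close> and the other factor of the product is at most
  \<open>\<beta>\<close>.\<close>

lemma autocov_diff:
  assumes g: "lip_fun g \<beta> L" and h: "lip_fun h \<beta> L"
    and diff: "(\<integral>x. \<bar>g x - h x\<bar> \<partial>\<mu>) \<le> \<epsilon>"
  shows "\<bar>autocov g l - autocov h l\<bar> \<le> 2 * \<beta> * \<epsilon>"
proof -
  have gm [measurable]: "g \<in> borel_measurable X" "h \<in> borel_measurable X" and L: "0 \<le> L" "1 \<le> \<beta>"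
    and bound: "\<And>x. x \<in> space X \<Longrightarrow> \<bar>g x\<bar> \<le> \<beta>" "\<And>x. x \<in> space X \<Longrightarrow> \<bar>h x\<bar> \<le> \<beta>"
    using g h by (auto simp: lip_fun_def)
  have pD: "prob_space (\<mu> \<Otimes>\<^sub>M S)" by unfold_locales
  have \<epsilon>: "0 \<le> \<epsilon>"
    using order_trans[OF Bochner_Integration.integral_nonneg diff] by simp
  have int: "integrable (\<mu> \<Otimes>\<^sub>M S) (\<lambda>z. k (fst z) * k (path (fst z) (snd z) l))" if "lip_fun k \<beta> L" for k
  proof -
    have [measurable]: "k \<in> borel_measurable X"
      using that by (simp add: lip_fun_def)
    show ?thesis
      by (rule two_point_integrable[OF two_point_product[OF that] _ _ pD]) measurable
  qed
  have nn: "(\<integral>\<^sup>+x. ennreal \<bar>g x - h x\<bar> \<partial>\<mu>) \<le> ennreal \<epsilon>"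
    using integrable_\<mu>[OF g] integrable_\<mu>[OF h] diff
    by (subst nn_integral_eq_integral) (auto intro: ennreal_leI)
  \<comment> \<open>Stated for every time \<open>j\<close>, so that \<open>j = 0\<close> covers the
    initial state as well.\<close>
  have nnj: "(\<integral>\<^sup>+z. ennreal \<bar>g (path (fst z) (snd z) j) - h (path (fst z) (snd z) j)\<bar> \<partial>(\<mu> \<Otimes>\<^sub>M S)) \<le> ennreal \<epsilon>" for j
  proof -
    have "(\<integral>\<^sup>+z. ennreal \<bar>g (path (fst z) (snd z) j) - h (path (fst z) (snd z) j)\<bar> \<partial>(\<mu> \<Otimes>\<^sub>M S))
        = (\<integral>\<^sup>+x. \<integral>\<^sup>+e. ennreal \<bar>g (path x e j) - h (path x e j)\<bar> \<partial>S \<partial>\<mu>)"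
      using P.nn_integral_fst[of "\<lambda>z. ennreal \<bar>g (path (fst z) (snd z) j) - h (path (fst z) (snd z) j)\<bar>" \<mu>] by simp
    also have "\<dots> = (\<integral>\<^sup>+x. ennreal \<bar>g x - h x\<bar> \<partial>\<mu>)"
      by (rule nn_integral_path_stationary) measurable
    finally show ?thesis using nn by simp
  qed
  have "(\<integral>\<^sup>+z. ennreal \<bar>g (fst z) * g (path (fst z) (snd z) l) - h (fst z) * h (path (fst z) (snd z) l)\<bar> \<partial>(\<mu> \<Otimes>\<^sub>M S))
      \<le> (\<integral>\<^sup>+z. ennreal \<beta> * (ennreal \<bar>g (path (fst z) (snd z) 0) - h (path (fst z) (snd z) 0)\<bar>
            + ennreal \<bar>g (path (fst z) (snd z) l) - h (path (fst z) (snd z) l)\<bar>) \<partial>(\<mu> \<Otimes>\<^sub>M S))"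
  proof (rule nn_integral_mono)
    fix z assume "z \<in> space (\<mu> \<Otimes>\<^sub>M S)"
    then have z: "fst z \<in> space X" "path (fst z) (snd z) l \<in> space X"
      by (auto simp: space_pair_measure space_\<mu> path_space)
    define x y where "x = fst z" and "y = path (fst z) (snd z) l"
    have "\<bar>g x * g y - h x * h y\<bar> = \<bar>(g x - h x) * g y + h x * (g y - h y)\<bar>"
      by (simp add: algebra_simps)
    also have "\<dots> \<le> \<bar>g x - h x\<bar> * \<bar>g y\<bar> + \<bar>h x\<bar> * \<bar>g y - h y\<bar>"
      by (metis abs_mult abs_triangle_ineq)
    also have "\<dots> \<le> \<bar>g x - h x\<bar> * \<beta> + \<beta> * \<bar>g y - h y\<bar>"
      using z L unfolding x_def y_def by (intro add_mono mult_mono bound) auto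
    finally show "ennreal \<bar>g (fst z) * g (path (fst z) (snd z) l) - h (fst z) * h (path (fst z) (snd z) l)\<bar>
      \<le> ennreal \<beta> * (ennreal \<bar>g (path (fst z) (snd z) 0) - h (path (fst z) (snd z) 0)\<bar>
            + ennreal \<bar>g (path (fst z) (snd z) l) - h (path (fst z) (snd z) l)\<bar>)"
      using L unfolding x_def y_def
      by (simp add: algebra_simps ennreal_leI flip: ennreal_mult ennreal_plus)
  qed
  also have "\<dots> = ennreal \<beta> * ((\<integral>\<^sup>+z. ennreal \<bar>g (path (fst z) (snd z) 0) - h (path (fst z) (snd z) 0)\<bar> \<partial>(\<mu> \<Otimes>\<^sub>M S))
      + (\<integral>\<^sup>+z. ennreal \<bar>g (path (fst z) (snd z) l) - h (path (fst z) (snd z) l)\<bar> \<partial>(\<mu> \<Otimes>\<^sub>M S)))"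
    by (subst nn_integral_cmult, measurable) (subst nn_integral_add, measurable)
  also have "\<dots> \<le> ennreal \<beta> * (ennreal \<epsilon> + ennreal \<epsilon>)"
    by (intro mult_left_mono add_mono nnj) simp
  also have "\<dots> = ennreal (2 * \<beta> * \<epsilon>)"
    using L \<epsilon> by (simp add: mult_ac flip: ennreal_plus ennreal_mult)
  finally have "\<bar>\<integral>z. g (fst z) * g (path (fst z) (snd z) l) - h (fst z) * h (path (fst z) (snd z) l) \<partial>(\<mu> \<Otimes>\<^sub>M S)\<bar> \<le> 2 * \<beta> * \<epsilon>"
    using int[OF g] int[OF h] L \<epsilon> by (intro abs_integral_le) auto
  then show ?thesis
    using int[OF g] int[OF h] by (simp add: autocov_def lag_mean_def)
qed

end

subsection \<open>Deviations of empirical autocovariances\<close>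

lemma sum_lessThan_add:
  fixes f :: "nat \<Rightarrow> real"
  shows "(\<Sum>k<p + N. f k) = (\<Sum>k<p. f k) + (\<Sum>j<N. f (j + p))"
  by (induction N) (simp_all add: add_ac)

text \<open>Centring at the empirical mean instead of \<open>c\<close> changes the sum by
  \<open>m\<close> times an average of terms \<open>x k + x (k + l) - m\<close>, each at most
  \<open>3 * \<beta>\<close>. As \<open>m\<close> is itself at most \<open>\<delta>\<close>, this
  adds \<open>3 * \<beta> * \<delta>\<close>.\<close>

lemma emp_autocov_approx:
  assumes n: "0 < n" and x: "\<And>k. k < n \<Longrightarrow> \<bar>h (X k) - c\<bar> \<le> \<beta>"
    and mean: "\<bar>(\<Sum>k<n. h (X k) - c) / n\<bar> \<le> \<delta>"
    and cov: "\<bar>(\<Sum>k<n - l. (h (X k) - c) * (h (X (k + l)) - c)) / n - r\<bar> \<le> \<delta>"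
  shows "\<bar>emp_autocov n h X l - r\<bar> \<le> (1 + 3 * \<beta>) * \<delta>"
proof -
  define x where "x k = h (X k) - c" for k
  define m where "m = emp_mean n h X - c"
  define N where "N = n - l"
  have m: "m = (\<Sum>k<n. x k) / n"
    using n by (simp add: m_def x_def emp_mean_def sum_subtractf diff_divide_distrib)
  have \<beta>: "0 \<le> \<beta>"
    using x[OF n] by linarith
  have m_le: "\<bar>m\<bar> \<le> \<delta>"
    using mean by (simp add: m x_def)
  have "\<bar>\<Sum>k<n. x k\<bar> \<le> (\<Sum>k<n. \<beta>)"
    using x by (intro order_trans[OF sum_abs] sum_mono) (simp add: x_def)
  then have m_le': "\<bar>m\<bar> \<le> \<beta>"
    using n by (simp add: m pos_divide_le_eq mult.commute)
  have "emp_autocov n h X l = (\<Sum>k<N. (x k - m) * (x (k + l) - m)) / n"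
    by (simp add: emp_autocov_def N_def x_def m_def algebra_simps)
  also have "\<dots> = (\<Sum>k<N. x k * x (k + l) - m * (x k + x (k + l) - m)) / n"
    by (simp add: algebra_simps)
  also have "\<dots> = (\<Sum>k<N. x k * x (k + l)) / n - m * ((\<Sum>k<N. x k + x (k + l) - m) / n)"
    unfolding sum_subtractf[of "\<lambda>k. x k * x (k + l)"] sum_distrib_left[symmetric]
    by (simp add: diff_divide_distrib)
  finally have eq: "emp_autocov n h X l
      = (\<Sum>k<N. x k * x (k + l)) / n - m * ((\<Sum>k<N. x k + x (k + l) - m) / n)" .
  have "\<bar>\<Sum>k<N. x k + x (k + l) - m\<bar> \<le> (\<Sum>k<N. 3 * \<beta>)"
  proof (intro order_trans[OF sum_abs] sum_mono)
    fix k assume "k \<in> {..<N}"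
    then have "\<bar>x k\<bar> \<le> \<beta>" "\<bar>x (k + l)\<bar> \<le> \<beta>"
      using x[of k] x[of "k + l"] by (auto simp: x_def N_def)
    then show "\<bar>x k + x (k + l) - m\<bar> \<le> 3 * \<beta>"
      using m_le' by linarith
  qed
  also have "\<dots> \<le> n * (3 * \<beta>)"
    using \<beta> by (simp add: N_def mult_right_mono)
  finally have "\<bar>(\<Sum>k<N. x k + x (k + l) - m) / n\<bar> \<le> 3 * \<beta>"
    using n by (simp add: pos_divide_le_eq mult_ac)
  with m_le have "\<bar>m * ((\<Sum>k<N. x k + x (k + l) - m) / n)\<bar> \<le> \<delta> * (3 * \<beta>)"
    unfolding abs_mult by (intro mult_mono) auto
  then have "\<bar>m * ((\<Sum>k<N. x k + x (k + l) - m) / n)\<bar> \<le> 3 * \<beta> * \<delta>"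
    by (simp only: mult.commute[of \<delta>])
  moreover have "\<bar>(\<Sum>k<N. x k * x (k + l)) / n - r\<bar> \<le> \<delta>"
    using cov by (simp add: N_def x_def)
  ultimately show ?thesis
    unfolding eq by (simp only: distrib_right)
qed

text \<open>\<open>c1\<close> is any upper bound for \<open>a' + 2 * a\<close> and not the sum
  itself, because the moment of the initial law can be recovered from \<open>const_R\<close> only up
  to an inequality.\<close>

locale started_maps = stationary_maps Q X F d \<Delta> \<mu> x0 a + \<nu>: prob_space \<nu>
  for Q :: "'e measure" and X :: "'x measure" and F d \<Delta> \<mu> x0 a and \<nu> :: "'x measure" +
  fixes a' c1 :: real
  assumes sets_\<nu> [measurable_cong]: "sets \<nu> = sets X"
    and moment_\<nu>: "(\<integral>\<^sup>+y. ennreal (d y x0) \<partial>\<nu>) \<le> ennreal a'"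
    and a'_nonneg: "0 \<le> a'"
    and c1: "a' + 2 * a \<le> c1" "0 < c1"
begin

sublocale E: pair_prob_space \<nu> S ..

lemma space_\<nu>: "space \<nu> = space X"
  by (rule sets_eq_imp_space_eq[OF sets_\<nu>])

text \<open>Comparison with a stationary path, in place of summing the drift, keeps the constant in
  terms of \<open>a\<close>: one \<open>a\<close> for the distance between the paths, one for the
  stationary moment.\<close>

lemma path_x0_moment: "(\<integral>\<^sup>+e. ennreal (d (path x0 e j) x0) \<partial>S) \<le> ennreal (2 * a)"
proof -
  have "(\<integral>\<^sup>+e. ennreal (d (path x0 e j) x0) \<partial>S) = (\<integral>\<^sup>+y. \<integral>\<^sup>+e. ennreal (d (path x0 e j) x0) \<partial>S \<partial>\<mu>)"
    by (simp add: \<mu>.emeasure_space_1)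
  also have "\<dots> \<le> (\<integral>\<^sup>+y. \<integral>\<^sup>+e. (ennreal (d (path y e j) (path x0 e j)) + ennreal (d (path y e j) x0)) \<partial>S \<partial>\<mu>)"
  proof (intro nn_integral_mono)
    fix y e
    have "d (path x0 e j) x0 \<le> d (path y e j) (path x0 e j) + d (path y e j) x0"
      using d_triangle[of "path x0 e j" x0 "path y e j"] by (simp add: d_sym)
    then show "ennreal (d (path x0 e j) x0)
        \<le> ennreal (d (path y e j) (path x0 e j)) + ennreal (d (path y e j) x0)"
      by (simp add: d_nonneg ennreal_leI flip: ennreal_plus)
  qed
  also have "\<dots> = (\<integral>\<^sup>+y. (\<integral>\<^sup>+e. ennreal (d (path y e j) (path x0 e j)) \<partial>S)
      + (\<integral>\<^sup>+e. ennreal (d (path y e j) x0) \<partial>S) \<partial>\<mu>)"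
    by (intro nn_integral_cong nn_integral_add) (auto simp: space_\<mu>)
  also have "\<dots> = (\<integral>\<^sup>+y. \<integral>\<^sup>+e. ennreal (d (path y e j) (path x0 e j)) \<partial>S \<partial>\<mu>)
      + (\<integral>\<^sup>+y. \<integral>\<^sup>+e. ennreal (d (path y e j) x0) \<partial>S \<partial>\<mu>)"
    by (rule nn_integral_add) measurable
  also have "(\<integral>\<^sup>+y. \<integral>\<^sup>+e. ennreal (d (path y e j) x0) \<partial>S \<partial>\<mu>) = (\<integral>\<^sup>+y. ennreal (d y x0) \<partial>\<mu>)"
    by (rule nn_integral_path_stationary) measurable
  also have "(\<integral>\<^sup>+y. \<integral>\<^sup>+e. ennreal (d (path y e j) (path x0 e j)) \<partial>S \<partial>\<mu>) + (\<integral>\<^sup>+y. ennreal (d y x0) \<partial>\<mu>)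
      \<le> ennreal (\<Delta> ^ j) * ennreal a + ennreal a"
    by (intro add_mono path_to_x0[OF _ sets_\<mu> moment] moment) unfold_locales
  also have "\<dots> \<le> ennreal 1 * ennreal a + ennreal a"
    using rate a_nonneg by (intro add_mono mult_right_mono ennreal_leI power_le_one) auto
  also have "\<dots> = ennreal (2 * a)"
    using a_nonneg by (simp flip: ennreal_plus)
  finally show ?thesis .
qed

lemma path_moment: "(\<integral>\<^sup>+x. \<integral>\<^sup>+e. ennreal (d (path x e j) x0) \<partial>S \<partial>\<nu>) \<le> ennreal c1"
proof -
  have "(\<integral>\<^sup>+x. \<integral>\<^sup>+e. ennreal (d (path x e j) x0) \<partial>S \<partial>\<nu>)
      \<le> (\<integral>\<^sup>+x. \<integral>\<^sup>+e. ennreal (d (path x e j) (path x0 e j)) + ennreal (d (path x0 e j) x0) \<partial>S \<partial>\<nu>)"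
    using d_triangle by (intro nn_integral_mono) (simp add: d_nonneg ennreal_leI flip: ennreal_plus)
  also have "\<dots> = (\<integral>\<^sup>+x. (\<integral>\<^sup>+e. ennreal (d (path x e j) (path x0 e j)) \<partial>S)
      + (\<integral>\<^sup>+e. ennreal (d (path x0 e j) x0) \<partial>S) \<partial>\<nu>)"
    by (intro nn_integral_cong nn_integral_add) (auto simp: space_\<nu>)
  also have "\<dots> = (\<integral>\<^sup>+x. \<integral>\<^sup>+e. ennreal (d (path x e j) (path x0 e j)) \<partial>S \<partial>\<nu>)
      + (\<integral>\<^sup>+x. \<integral>\<^sup>+e. ennreal (d (path x0 e j) x0) \<partial>S \<partial>\<nu>)"
    by (rule nn_integral_add) measurable
  also have "\<dots> \<le> ennreal (\<Delta> ^ j) * ennreal a' + ennreal (2 * a)"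
    using path_x0_moment[of j]
    by (intro add_mono path_to_x0[OF _ sets_\<nu> moment_\<nu>]) (unfold_locales, simp add: \<nu>.emeasure_space_1)
  also have "\<dots> \<le> ennreal 1 * ennreal a' + ennreal (2 * a)"
    using rate a_nonneg by (intro add_mono mult_right_mono ennreal_leI power_le_one) auto
  also have "\<dots> \<le> ennreal c1"
    using a_nonneg a'_nonneg c1 by (simp add: ennreal_leI flip: ennreal_plus)
  finally show ?thesis .
qed

text \<open>The Markov property at time \<open>j\<close> turns the restart into two paths with
  common innovations from the current state and from \<open>x0\<close>. Their mean initial distance
  is at most \<open>c1\<close>, uniformly in \<open>j\<close>.\<close>

lemma restart_distance:
  "(\<integral>\<^sup>+z. ennreal (d (path (fst z) (snd z) (j + k)) (path x0 (shift j (snd z)) k)) \<partial>(\<nu> \<Otimes>\<^sub>M S))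
    \<le> ennreal (\<Delta> ^ k * c1)"
proof -
  have G: "(\<lambda>(y, e). ennreal (d (path y e k) (path x0 e k))) \<in> borel_measurable (X \<Otimes>\<^sub>M S)"
    by measurable
  have "(\<integral>\<^sup>+z. ennreal (d (path (fst z) (snd z) (j + k)) (path x0 (shift j (snd z)) k)) \<partial>(\<nu> \<Otimes>\<^sub>M S))
      = (\<integral>\<^sup>+x. \<integral>\<^sup>+e. ennreal (d (path (path x e j) (shift j e) k) (path x0 (shift j e) k)) \<partial>S \<partial>\<nu>)"
    using P.nn_integral_fst[of "\<lambda>z. ennreal (d (path (fst z) (snd z) (j + k)) (path x0 (shift j (snd z)) k))" \<nu>]
    by (simp add: path_add)
  also have "\<dots> = (\<integral>\<^sup>+x. \<integral>\<^sup>+e. \<integral>\<^sup>+e'. ennreal (d (path (path x e j) e' k) (path x0 e' k)) \<partial>S \<partial>S \<partial>\<nu>)"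
    by (intro nn_integral_cong nn_integral_path_shift[OF G]) (simp add: space_\<nu>)
  also have "\<dots> \<le> (\<integral>\<^sup>+x. \<integral>\<^sup>+e. ennreal (\<Delta> ^ k) * ennreal (d (path x e j) x0) \<partial>S \<partial>\<nu>)"
    by (intro nn_integral_mono path_contraction path_space) (auto simp: space_\<nu> x0)
  also have "\<dots> = (\<integral>\<^sup>+x. ennreal (\<Delta> ^ k) * (\<integral>\<^sup>+e. ennreal (d (path x e j) x0) \<partial>S) \<partial>\<nu>)"
    by (intro nn_integral_cong nn_integral_cmult) (auto simp: space_\<nu>)
  also have "\<dots> = ennreal (\<Delta> ^ k) * (\<integral>\<^sup>+x. \<integral>\<^sup>+e. ennreal (d (path x e j) x0) \<partial>S \<partial>\<nu>)"
    by (rule nn_integral_cmult) measurable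
  also have "\<dots> \<le> ennreal (\<Delta> ^ k) * ennreal c1"
    by (intro mult_left_mono path_moment) simp
  also have "\<dots> = ennreal (\<Delta> ^ k * c1)"
    using rate c1 by (simp add: ennreal_mult)
  finally show ?thesis .
qed

text \<open>A pair at lag \<open>l\<close> needs the restart from time \<open>j\<close> to be
  accurate at \<open>j + b\<close> and at \<open>j + b + l\<close>; summing over all
  \<open>l < b\<close> lets one event serve every lag.\<close>

definition restart_err :: "nat \<Rightarrow> nat \<Rightarrow> 'x \<times> (nat \<Rightarrow> 'e) \<Rightarrow> real" where
  "restart_err b n z = (\<Sum>j<n - b. \<Sum>l<b.
     d (path (fst z) (snd z) (j + (b + l))) (path x0 (shift j (snd z)) (b + l)))"

lemma restart_err_measurable [measurable]: "restart_err b n \<in> borel_measurable (\<nu> \<Otimes>\<^sub>M S)"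
  unfolding restart_err_def by measurable

text \<open>There are at most \<open>n * b\<close> summands of mean at most \<open>c1 / n^2\<close>,
  so the total has mean at most \<open>b * c1 / n\<close>. Markov's inequality at level
  \<open>2 * b * c1\<close> leaves half of the admissible failure probability
  \<open>1 / n\<close>.\<close>

lemma restart_err_prob:
  assumes n: "0 < n" and b: "0 < b" and \<Delta>b: "\<Delta> ^ b \<le> 1 / (real n)\<^sup>2"
  shows "E.prob {z \<in> space (\<nu> \<Otimes>\<^sub>M S). 2 * real b * c1 \<le> restart_err b n z} \<le> 1 / (2 * real n)"
proof -
  have "(\<integral>\<^sup>+z. ennreal (restart_err b n z) \<partial>(\<nu> \<Otimes>\<^sub>M S))
      = (\<integral>\<^sup>+z. (\<Sum>j<n - b. \<Sum>l<b. ennreal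
          (d (path (fst z) (snd z) (j + (b + l))) (path x0 (shift j (snd z)) (b + l)))) \<partial>(\<nu> \<Otimes>\<^sub>M S))"
    unfolding restart_err_def by (simp add: sum_nonneg d_nonneg flip: sum_ennreal)
  also have "\<dots> = (\<Sum>j<n - b. \<Sum>l<b. \<integral>\<^sup>+z. ennreal
          (d (path (fst z) (snd z) (j + (b + l))) (path x0 (shift j (snd z)) (b + l))) \<partial>(\<nu> \<Otimes>\<^sub>M S))"
    by (subst nn_integral_sum, measurable, intro sum.cong refl nn_integral_sum, measurable)
  also have "\<dots> \<le> (\<Sum>j<n - b. \<Sum>l<b. ennreal (1 / (real n)\<^sup>2 * c1))"
  proof (intro sum_mono order_trans[OF restart_distance] ennreal_leI mult_right_mono)
    fix l
    show "\<Delta> ^ (b + l) \<le> 1 / (real n)\<^sup>2"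
      using rate by (intro order_trans[OF power_decreasing \<Delta>b]) auto
  qed (use c1 in auto)
  also have "\<dots> = ennreal (real (n - b) * (real b * (1 / (real n)\<^sup>2 * c1)))"
    using c1 by (simp add: ennreal_of_nat_eq_real_of_nat flip: ennreal_mult)
  also have "\<dots> \<le> ennreal (real n * (real b * (1 / (real n)\<^sup>2 * c1)))"
    using c1 by (intro ennreal_leI mult_right_mono) auto
  also have "real n * (real b * (1 / (real n)\<^sup>2 * c1)) = b * c1 / n"
    using n by (simp add: power2_eq_square)
  finally have int: "(\<integral>\<^sup>+z. ennreal (restart_err b n z) \<partial>(\<nu> \<Otimes>\<^sub>M S)) \<le> ennreal (b * c1 / n)" .
  have pos: "0 < 2 * real b * c1"
    using b c1 by simp
  define \<kappa> where "\<kappa> = 1 / (2 * real b * c1)"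
  have \<kappa>: "0 < \<kappa>"
    using pos by (simp add: \<kappa>_def)
  have nonneg: "0 \<le> restart_err b n z" for z
    unfolding restart_err_def by (intro sum_nonneg d_nonneg)
  have "{z \<in> space (\<nu> \<Otimes>\<^sub>M S). 2 * real b * c1 \<le> restart_err b n z}
      = {z \<in> space (\<nu> \<Otimes>\<^sub>M S). 1 \<le> ennreal \<kappa> * ennreal (restart_err b n z)}"
    using pos \<kappa> nonneg
    by (simp add: \<kappa>_def pos_le_divide_eq flip: ennreal_mult ennreal_1)
  then have "emeasure (\<nu> \<Otimes>\<^sub>M S) {z \<in> space (\<nu> \<Otimes>\<^sub>M S). 2 * real b * c1 \<le> restart_err b n z}
      \<le> ennreal \<kappa> * (\<integral>\<^sup>+z. ennreal (restart_err b n z) * indicator (space (\<nu> \<Otimes>\<^sub>M S)) z \<partial>(\<nu> \<Otimes>\<^sub>M S))"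
    using nn_integral_Markov_inequality[of "\<lambda>z. ennreal (restart_err b n z)" "space (\<nu> \<Otimes>\<^sub>M S)" "\<nu> \<Otimes>\<^sub>M S" "ennreal \<kappa>"]
    by simp
  also have "(\<integral>\<^sup>+z. ennreal (restart_err b n z) * indicator (space (\<nu> \<Otimes>\<^sub>M S)) z \<partial>(\<nu> \<Otimes>\<^sub>M S))
      = (\<integral>\<^sup>+z. ennreal (restart_err b n z) \<partial>(\<nu> \<Otimes>\<^sub>M S))"
    by (rule nn_integral_cong) simp
  also have "ennreal \<kappa> * (\<integral>\<^sup>+z. ennreal (restart_err b n z) \<partial>(\<nu> \<Otimes>\<^sub>M S))
      \<le> ennreal \<kappa> * ennreal (b * c1 / n)"
    by (intro mult_left_mono int) simp
  also have "\<dots> = ennreal (1 / (2 * real n))"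
    using b c1 \<kappa> by (simp add: \<kappa>_def flip: ennreal_mult)
  finally show ?thesis
    by (simp add: E.emeasure_eq_measure)
qed

lemma deviation:
  assumes \<Phi>: "two_point \<Phi> \<beta> L" and \<beta>: "0 \<le> \<beta>" and l: "l < b" and n: "0 < n"
    and \<Delta>b: "\<Delta> ^ b \<le> 1 / (real n)\<^sup>2"
    and z: "x \<in> space X" "e \<in> space S" and err: "restart_err b n (x, e) < 2 * real b * c1"
    and W: "W = (\<lambda>e. \<Phi> (path x0 e b) (path x0 e (b + l)))"
    and dev: "\<bar>\<Sum>j<n - l - b. W (shift j e) - P.expectation W\<bar> \<le> t * n"
  shows "\<bar>(\<Sum>k<n - l. \<Phi> (path x e k) (path x e (k + l))) / n - lag_mean \<Phi> l\<bar>
    \<le> t + (6 * L * c1 + 3 * \<beta>) * b / n"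
proof -
  have L: "0 \<le> L"
    and bound: "\<And>x y. x \<in> space X \<Longrightarrow> y \<in> space X \<Longrightarrow> \<bar>\<Phi> x y\<bar> \<le> \<beta>"
    and lip: "\<And>x y x' y'. x \<in> space X \<Longrightarrow> y \<in> space X \<Longrightarrow> x' \<in> space X \<Longrightarrow> y' \<in> space X \<Longrightarrow>
        \<bar>\<Phi> x y - \<Phi> x' y'\<bar> \<le> L * (d x x' + d y y')"
    using \<Phi> by (auto simp: two_point_def)
  define N where "N = n - l - b"
  \<comment> \<open>The minimum covers \<open>n - l < b\<close>, where the truncated difference
    \<open>N\<close> is 0 and all terms belong to the burn-in.\<close>
  define p where "p = min b (n - l)"
  define f where "f k = \<Phi> (path x e k) (path x e (k + l))" for k
  define m where "m = lag_mean \<Phi> l"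
  define w where "w = P.expectation W"
  have pN: "n - l = p + N"
    by (auto simp: p_def N_def)
  have "(\<Sum>j<N. f (j + p)) = (\<Sum>j<N. f (j + b))"
  proof (cases "N = 0")
    case False
    then have "p = b" by (auto simp: p_def N_def)
    then show ?thesis by simp
  qed simp
  then have split: "(\<Sum>k<n - l. f k) = (\<Sum>k<p. f k) + (\<Sum>j<N. f (j + b))"
    unfolding pN sum_lessThan_add by simp
  have "(\<Sum>j<N. f (j + b)) - N * m
      = (\<Sum>j<N. f (j + b) - W (shift j e)) + (\<Sum>j<N. W (shift j e) - w) + N * (w - m)"
    by (simp add: sum_subtractf algebra_simps)
  \<comment> \<open>Five errors: burn-in terms with no full window before them
    (\<open>b * \<beta>\<close>), restarts (\<open>4 * L * b * c1\<close>), fluctuation of the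
    windows (\<open>t * n\<close>), their bias (\<open>2 * L * c1 * b\<close>), and the count
    \<open>N\<close> in place of \<open>n\<close> (\<open>2 * b * \<beta>\<close>). Apart from
    \<open>t * n\<close> they add up to \<open>(6 * L * c1 + 3 * \<beta>) * b\<close>.\<close>
  then have decomp: "(\<Sum>k<n - l. f k) - n * m
      = (\<Sum>k<p. f k) + (\<Sum>j<N. f (j + b) - W (shift j e)) + (\<Sum>j<N. W (shift j e) - w)
        + N * (w - m) - (real n - N) * m"
    unfolding split by (simp add: algebra_simps)
  have 1: "\<bar>\<Sum>k<p. f k\<bar> \<le> b * \<beta>"
  proof -
    have "\<bar>\<Sum>k<p. f k\<bar> \<le> (\<Sum>k<p. \<beta>)"
      unfolding f_def by (intro order_trans[OF sum_abs] sum_mono bound path_space z)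
    also have "\<dots> \<le> b * \<beta>"
      using \<beta> by (simp add: p_def mult_right_mono)
    finally show ?thesis .
  qed
  have 2: "\<bar>\<Sum>j<N. f (j + b) - W (shift j e)\<bar> \<le> L * (4 * real b * c1)"
  proof -
    define D where "D j i = d (path x e (j + (b + i))) (path x0 (shift j e) (b + i))" for j i
    have D: "0 \<le> D j i" for j i
      by (simp add: D_def d_nonneg)
    have "\<bar>\<Sum>j<N. f (j + b) - W (shift j e)\<bar> \<le> (\<Sum>j<N. L * (D j 0 + D j l))"
    proof (intro order_trans[OF sum_abs] sum_mono)
      fix j
      show "\<bar>f (j + b) - W (shift j e)\<bar> \<le> L * (D j 0 + D j l)"
        using lip[of "path x e (j + b)" "path x e (j + (b + l))" "path x0 (shift j e) b" "path x0 (shift j e) (b + l)"] z x0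
        by (simp add: f_def W D_def path_space shift_space add.assoc)
    qed
    also have "\<dots> \<le> (\<Sum>j<N. L * (2 * (\<Sum>i<b. D j i)))"
    proof (intro sum_mono mult_left_mono L)
      fix j
      have "D j i \<le> (\<Sum>i<b. D j i)" if "i < b" for i
        using that D by (intro member_le_sum) auto
      from this[of 0] this[of l] show "D j 0 + D j l \<le> 2 * (\<Sum>i<b. D j i)"
        using l by simp
    qed
    also have "\<dots> = L * (2 * (\<Sum>j<N. \<Sum>i<b. D j i))"
      by (simp add: sum_distrib_left)
    also have "\<dots> \<le> L * (2 * restart_err b n (x, e))"
      unfolding restart_err_def fst_conv snd_conv D_def[symmetric]
      using D by (intro mult_left_mono L sum_mono2) (auto simp: N_def sum_nonneg)
    also have "\<dots> \<le> L * (4 * real b * c1)"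
      using err L by (intro mult_left_mono) (simp_all add: mult_ac)
    finally show ?thesis .
  qed
  have 3: "\<bar>\<Sum>j<N. W (shift j e) - w\<bar> \<le> t * n"
    using dev by (simp add: N_def w_def)
  have 4: "\<bar>N * (w - m)\<bar> \<le> 2 * L * c1 * b"
  proof -
    have "\<bar>w - m\<bar> \<le> 2 * L * (\<Delta> ^ b * a)"
      unfolding w_def m_def W by (rule window_mean[OF \<Phi>])
    also have "\<dots> \<le> 2 * L * (1 / (real n)\<^sup>2 * a)"
      using L a_nonneg \<Delta>b by (intro mult_left_mono mult_right_mono) auto
    finally have "\<bar>w - m\<bar> \<le> 2 * L * (1 / (real n)\<^sup>2 * a)" .
    then have "real N * \<bar>w - m\<bar> \<le> real n * (2 * L * (1 / (real n)\<^sup>2 * a))"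
      by (intro mult_mono) (auto simp: N_def)
    then have "\<bar>N * (w - m)\<bar> \<le> real n * (2 * L * (1 / (real n)\<^sup>2 * a))"
      by (simp add: abs_mult)
    also have "\<dots> = 2 * L * (a / n)"
      using n by (simp add: power2_eq_square)
    also have "\<dots> \<le> 2 * L * (c1 * b)"
    proof (intro mult_left_mono)
      have "a / n \<le> a / 1"
        using n a_nonneg by (intro divide_left_mono) auto
      also have "\<dots> \<le> c1 * 1"
        using c1 a_nonneg a'_nonneg by simp
      also have "\<dots> \<le> c1 * b"
        using c1 l by (intro mult_left_mono) auto
      finally show "a / n \<le> c1 * b" .
    qed (use L in simp)
    finally show ?thesis by (simp add: mult.assoc)
  qed
  have 5: "\<bar>(real n - N) * m\<bar> \<le> 2 * b * \<beta>"
  proof -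
    have "\<bar>m\<bar> \<le> \<beta>"
    proof -
      have pD: "prob_space (\<mu> \<Otimes>\<^sub>M S)" by unfold_locales
      have i: "integrable (\<mu> \<Otimes>\<^sub>M S) (\<lambda>z. \<Phi> (fst z) (path (fst z) (snd z) l))"
        by (rule two_point_integrable[OF \<Phi> _ _ pD]) measurable
      have "(\<integral>\<^sup>+z. ennreal \<bar>\<Phi> (fst z) (path (fst z) (snd z) l)\<bar> \<partial>(\<mu> \<Otimes>\<^sub>M S)) \<le> (\<integral>\<^sup>+z. ennreal \<beta> \<partial>(\<mu> \<Otimes>\<^sub>M S))"
        by (intro nn_integral_mono ennreal_leI bound)
           (auto simp: space_pair_measure space_\<mu> path_space)
      then show ?thesis
        unfolding m_def lag_mean_def using i \<beta>
        by (intro abs_integral_le) (simp_all add: D.emeasure_space_1)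
    qed
    moreover have "real n - N \<le> 2 * b" "0 \<le> real n - N"
      using l by (auto simp: N_def)
    ultimately show ?thesis
      unfolding abs_mult using \<beta> by (intro mult_mono) auto
  qed
  have "\<bar>(\<Sum>k<n - l. f k) - n * m\<bar> \<le> t * n + (6 * L * c1 + 3 * \<beta>) * b"
    unfolding decomp using 1 2 3 4 5 by (simp add: algebra_simps)
  then have "\<bar>(\<Sum>k<n - l. f k) - n * m\<bar> / n \<le> (t * n + (6 * L * c1 + 3 * \<beta>) * b) / n"
    by (intro divide_right_mono) auto
  moreover have "\<bar>(\<Sum>k<n - l. f k) - n * m\<bar> / n = \<bar>(\<Sum>k<n - l. f k) / n - m\<bar>"
  proof -
    have "((\<Sum>k<n - l. f k) - n * m) / n = (\<Sum>k<n - l. f k) / n - m"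
      using n by (simp add: diff_divide_distrib)
    then show ?thesis
      by (metis abs_divide abs_of_nat)
  qed
  ultimately show ?thesis
    using n by (simp add: f_def m_def add_divide_distrib)
qed

end

text \<open>\<open>\<kappa>\<close> bounds the bandwidth in units of \<open>ln n\<close>; \<open>\<kappa>'\<close> is an exponent such that \<open>n powr - \<kappa>'\<close>
  absorbs the cardinality of the net and the number of lags and blocks.\<close>

definition excess_const :: "real \<Rightarrow> real \<Rightarrow> real \<Rightarrow> real \<Rightarrow> real \<Rightarrow> real \<Rightarrow> real \<Rightarrow> real" where
  "excess_const \<beta> L a c1 \<Delta> \<rho> C\<rho> =
     (let \<kappa> = 2 * (1 / ln (1 / \<Delta>) + 1 / ln 2);
          \<kappa>' = \<rho> + 3 + log 2 (max 1 (16 * \<kappa>\<^sup>2 * C\<rho>));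
          c2 = 2 * \<beta>\<^sup>2 * sqrt (\<kappa> * \<kappa>') + (6 * (\<beta> * L) * c1 + 3 * \<beta>\<^sup>2) * \<kappa>
      in (6 * \<kappa> * (1 + 3 * \<beta>) * c2 + 6 * \<beta> * \<kappa> + 12 * (\<beta> * L * a / (1 - \<Delta>))) * ln 2 powr (-5/2))"

text \<open>Half the bandwidth already gives \<open>\<Delta> ^ p \<le> 1 / n\<close>. The ceiling
  adds at most 1, and \<open>1 \<le> ln n / ln 2\<close> for \<open>n \<ge> 2\<close> absorbs this
  into a pure multiple of \<open>ln n\<close>.\<close>

lemma bandwidth_props:
  assumes \<Delta>: "0 < \<Delta>" "\<Delta> < 1" and n: "2 \<le> n"
  obtains p where "bandwidth \<Delta> n = 2 * p" "0 < p" "\<Delta> ^ p \<le> 1 / n"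
    "bandwidth \<Delta> n \<le> 2 * (1 / ln (1 / \<Delta>) + 1 / ln 2) * ln n"
proof -
  define p where "p = nat \<lceil>ln (real n) / ln (1 / \<Delta>)\<rceil>"
  have l: "0 < ln (1 / \<Delta>)" and ln2: "ln 2 \<le> ln (real n)"
    using \<Delta> n by auto
  have pos: "0 < ln (real n) / ln (1 / \<Delta>)"
    using l n by simp
  have p1: "ln (real n) / ln (1 / \<Delta>) \<le> p"
    unfolding p_def by linarith
  have p2: "p \<le> ln (real n) / ln (1 / \<Delta>) + 1"
    using pos unfolding p_def by linarith
  have p: "0 < p"
    using p1 pos by (metis gr0I le_less_trans of_nat_0 not_le order_refl)
  have "ln (\<Delta> ^ p) = - (p * ln (1 / \<Delta>))"
    using \<Delta> by (simp add: ln_realpow ln_div)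
  also have "\<dots> \<le> ln (1 / n)"
    using p1 l n by (simp add: pos_divide_le_eq ln_div)
  finally have "\<Delta> ^ p \<le> 1 / n"
    using \<Delta> n by (subst (asm) ln_le_cancel_iff) auto
  moreover have "bandwidth \<Delta> n \<le> 2 * (1 / ln (1 / \<Delta>) + 1 / ln 2) * ln n"
  proof -
    have "1 \<le> ln (real n) / ln 2"
      using ln2 by simp
    with p2 have "real p \<le> ln (real n) / ln (1 / \<Delta>) + ln (real n) / ln 2"
      by (rule order_trans[OF _ add_left_mono])
    then have "2 * real p \<le> 2 * (ln (real n) / ln (1 / \<Delta>) + ln (real n) / ln 2)"
      by simp
    also have "\<dots> = 2 * (1 / ln (1 / \<Delta>) + 1 / ln 2) * ln n"
      by (simp add: algebra_simps)
    finally show ?thesis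
      by (simp add: bandwidth_def p_def)
  qed
  ultimately show thesis
    using that[of p] p by (simp add: bandwidth_def p_def)
qed

section \<open>Deviation of the spectral variance, uniform over a finite net\<close>

context started_maps
begin

text \<open>The bad restart event is counted once and only the Hoeffding events are summed over
  \<open>I\<close>. A restarted pair at lag \<open>lag i\<close> reads \<open>b + lag i\<close>
  innovations, fewer than \<open>2 * b\<close>, whence the exponent common to all indices.\<close>

lemma uniform_deviation:
  fixes \<Phi> :: "'i \<Rightarrow> 'x \<Rightarrow> 'x \<Rightarrow> real" and lag :: "'i \<Rightarrow> nat" and t \<beta> :: real
  assumes I: "finite I" and \<Phi>: "\<And>i. i \<in> I \<Longrightarrow> two_point (\<Phi> i) \<beta> L" and lag: "\<And>i. i \<in> I \<Longrightarrow> lag i < b"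
    and \<beta>: "0 < \<beta>" and n: "0 < n" and b: "0 < b" and \<Delta>b: "\<Delta> ^ b \<le> 1 / (real n)\<^sup>2" and t: "0 < t"
  shows "\<exists>A\<in>sets (\<nu> \<Otimes>\<^sub>M S).
    1 - 1 / (2 * real n) - real (card I) * (4 * real b * exp (- (t\<^sup>2 * n / (4 * real b * \<beta>\<^sup>2)))) \<le> E.prob A \<and>
    (\<forall>(x, e)\<in>A. \<forall>i\<in>I. \<bar>(\<Sum>k<n - lag i. \<Phi> i (path x e k) (path x e (k + lag i))) / n - lag_mean (\<Phi> i) (lag i)\<bar>
      \<le> t + (6 * L * c1 + 3 * \<beta>) * b / n)"
proof -
  define W where "W i e = \<Phi> i (path x0 e b) (path x0 e (b + lag i))" for i e
  define B where "B i = {e \<in> space S. t * n \<le> \<bar>\<Sum>j<n - lag i - b. W i (shift j e) - P.expectation (W i)\<bar>}" for i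
  define B' where "B' i = space \<nu> \<times> B i" for i
  define R where "R = {z \<in> space (\<nu> \<Otimes>\<^sub>M S). 2 * real b * c1 \<le> restart_err b n z}"
  have pS: "prob_space S" by unfold_locales
  have Wm: "W i \<in> borel_measurable S" if "i \<in> I" for i
    unfolding W_def by (rule measurable_two_point[OF \<Phi>[OF that]]) measurable
  have Bm: "B i \<in> sets S" if "i \<in> I" for i
    using measurable_compose[OF shift_measurable[of "\<lambda>e. e" S] Wm[OF that]] unfolding B_def by simp
  have B'm: "B' i \<in> sets (\<nu> \<Otimes>\<^sub>M S)" if "i \<in> I" for i
    unfolding B'_def using Bm[OF that] by simp
  have Rm: "R \<in> sets (\<nu> \<Otimes>\<^sub>M S)"
    unfolding R_def by simp
  have B_prob: "P.prob (B i) \<le> 4 * real b * exp (- (t\<^sup>2 * n / (4 * real b * \<beta>\<^sup>2)))" if i: "i \<in> I" for i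
  proof (cases "b + lag i \<le> n")
    case True
    have "P.prob (B i) \<le> 2 * real (b + lag i) * exp (- (t\<^sup>2 * n / (2 * real (b + lag i) * \<beta>\<^sup>2)))"
      unfolding B_def
    proof (rule block_hoeffding[OF Wm[OF i]])
      show "W i e = W i e'" if "\<And>k. k < b + lag i \<Longrightarrow> e k = e' k" for e e'
      proof -
        have "path x0 e b = path x0 e' b" "path x0 e (b + lag i) = path x0 e' (b + lag i)"
          using that by (auto intro: path_cong)
        then show ?thesis by (simp add: W_def)
      qed
      show "\<bar>W i e\<bar> \<le> \<beta>" if "e \<in> space S" for e
        using \<Phi>[OF i] that x0 by (simp add: W_def two_point_def path_space)
    qed (use True \<beta> t b in auto)
    also have "\<dots> \<le> 4 * real b * exp (- (t\<^sup>2 * n / (4 * real b * \<beta>\<^sup>2)))"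
    proof (rule mult_mono)
      have "2 * real (b + lag i) * \<beta>\<^sup>2 \<le> 4 * real b * \<beta>\<^sup>2"
        using lag[OF i] by (intro mult_right_mono) auto
      then have "t\<^sup>2 * n / (4 * real b * \<beta>\<^sup>2) \<le> t\<^sup>2 * n / (2 * real (b + lag i) * \<beta>\<^sup>2)"
        using b \<beta> by (intro divide_left_mono) auto
      then show "exp (- (t\<^sup>2 * n / (2 * real (b + lag i) * \<beta>\<^sup>2))) \<le> exp (- (t\<^sup>2 * n / (4 * real b * \<beta>\<^sup>2)))"
        by simp
    qed (use lag[OF i] in auto)
    finally show ?thesis .
  next
    case False
    \<comment> \<open>The window does not fit: \<open>n - lag i - b\<close> is truncated to 0, the
      sum is empty and its bad event is void.\<close>
    have "0 < t * real n"
      using t n by simp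
    with False have "B i = {}"
      by (auto simp: B_def)
    then show ?thesis by simp
  qed
  have B'_prob: "E.prob (B' i) = P.prob (B i)" if "i \<in> I" for i
    unfolding B'_def measure_def using Bm[OF that]
    by (subst P.emeasure_pair_measure_Times) (simp_all add: \<nu>.emeasure_space_1)
  define A where "A = space (\<nu> \<Otimes>\<^sub>M S) - (R \<union> (\<Union>i\<in>I. B' i))"
  have Um: "R \<union> (\<Union>i\<in>I. B' i) \<in> sets (\<nu> \<Otimes>\<^sub>M S)"
    using Rm B'm I by auto
  have Am: "A \<in> sets (\<nu> \<Otimes>\<^sub>M S)"
    unfolding A_def using Um by auto
  have "E.prob (R \<union> (\<Union>i\<in>I. B' i)) \<le> E.prob R + E.prob (\<Union>i\<in>I. B' i)"
    using Rm B'm I by (intro measure_Un_le) auto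
  also have "E.prob (\<Union>i\<in>I. B' i) \<le> (\<Sum>i\<in>I. E.prob (B' i))"
    using B'm I by (intro E.finite_measure_subadditive_finite) auto
  also have "\<dots> \<le> (\<Sum>i\<in>I. 4 * real b * exp (- (t\<^sup>2 * n / (4 * real b * \<beta>\<^sup>2))))"
    using B_prob B'_prob by (intro sum_mono) simp
  also have "E.prob R \<le> 1 / (2 * real n)"
    unfolding R_def by (rule restart_err_prob[OF n b \<Delta>b])
  finally have "E.prob (R \<union> (\<Union>i\<in>I. B' i))
      \<le> 1 / (2 * real n) + real (card I) * (4 * real b * exp (- (t\<^sup>2 * n / (4 * real b * \<beta>\<^sup>2))))"
    by simp
  then have "1 - 1 / (2 * real n) - real (card I) * (4 * real b * exp (- (t\<^sup>2 * n / (4 * real b * \<beta>\<^sup>2)))) \<le> E.prob A"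
    unfolding A_def E.prob_compl[OF Um] by simp
  moreover have "\<bar>(\<Sum>k<n - lag i. \<Phi> i (path x e k) (path x e (k + lag i))) / n - lag_mean (\<Phi> i) (lag i)\<bar>
      \<le> t + (6 * L * c1 + 3 * \<beta>) * b / n" if A: "(x, e) \<in> A" and i: "i \<in> I" for x e i
  proof (rule deviation[OF \<Phi>[OF i] _ lag[OF i] n \<Delta>b])
    have sp: "(x, e) \<in> space (\<nu> \<Otimes>\<^sub>M S)"
      using A by (simp add: A_def)
    then show "x \<in> space X" "e \<in> space S"
      by (auto simp: space_pair_measure space_\<nu>)
    show "restart_err b n (x, e) < 2 * real b * c1"
      using A sp by (simp add: A_def R_def)
    have "e \<notin> B i"
      using A i \<open>x \<in> space X\<close> by (auto simp: A_def B'_def space_\<nu>)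
    then show "\<bar>\<Sum>j<n - lag i - b. W i (shift j e) - P.expectation (W i)\<bar> \<le> t * n"
      using \<open>e \<in> space S\<close> by (simp add: B_def)
    show "W i = (\<lambda>e. \<Phi> i (path x0 e b) (path x0 e (b + lag i)))"
      by (simp add: W_def fun_eq_iff)
  qed (use \<beta> in auto)
  ultimately show ?thesis
    using Am by blast
qed

lemma spectral_var_deviation:
  fixes t \<beta> :: real
  assumes N: "finite N" and lip: "\<And>h. h \<in> N \<Longrightarrow> lip_fun (\<lambda>x. h x - c) \<beta> L"
    and center: "\<And>h. h \<in> N \<Longrightarrow> (\<integral>x. h x - c \<partial>\<mu>) = 0" and \<beta>: "1 \<le> \<beta>"
    and w: "lag_window w" and n: "0 < n" and p: "0 < p" "b = 2 * p" "\<Delta> ^ p \<le> 1 / n" and t: "0 < t"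
  shows "\<exists>A\<in>sets (\<nu> \<Otimes>\<^sub>M S).
    1 - 1 / (2 * real n) - real (card N) * (real b + 1) * (4 * real b * exp (- (t\<^sup>2 * n / (4 * real b * (\<beta>\<^sup>2)\<^sup>2)))) \<le> E.prob A \<and>
    (\<forall>(x, e)\<in>A. \<forall>h\<in>N. \<bar>spectral_var w b n (path x e) h - long_run_var (\<lambda>x. h x - c)\<bar>
      \<le> 3 * real b * ((1 + 3 * \<beta>) * (t + (6 * (\<beta> * L) * c1 + 3 * \<beta>\<^sup>2) * b / n)) + 4 * (\<beta> * L * a / (1 - \<Delta>)) / n)"
proof -
  \<comment> \<open>An index \<open>(h, l)\<close> with \<open>l < b\<close> stands for the product
    at lag \<open>l\<close>; the surplus index \<open>l = b\<close> stands for the value of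
    \<open>h\<close> itself and controls the empirical mean. Hence \<open>b + 1\<close> indices per
    function.\<close>
  define \<Phi> :: "('x \<Rightarrow> real) \<times> nat \<Rightarrow> 'x \<Rightarrow> 'x \<Rightarrow> real" where
    "\<Phi> = (\<lambda>(h, l). if l < b then (\<lambda>x y. (h x - c) * (h y - c)) else (\<lambda>x y. h x - c))"
  define lag :: "('x \<Rightarrow> real) \<times> nat \<Rightarrow> nat" where "lag = (\<lambda>(h, l). if l < b then l else 0)"
  define \<delta> where "\<delta> = t + (6 * (\<beta> * L) * c1 + 3 * \<beta>\<^sup>2) * b / n"
  have b: "0 < b"
    using p by simp
  have "\<Delta> ^ b = \<Delta> ^ p * \<Delta> ^ p"
    using p by (simp add: mult_2 power_add)
  also have "\<dots> \<le> (1 / n) * (1 / n)"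
    using p rate by (intro mult_mono) auto
  finally have \<Delta>b: "\<Delta> ^ b \<le> 1 / (real n)\<^sup>2"
    by (simp add: power2_eq_square)
  have "\<exists>A\<in>sets (\<nu> \<Otimes>\<^sub>M S).
    1 - 1 / (2 * real n) - real (card (N \<times> {..b})) * (4 * real b * exp (- (t\<^sup>2 * n / (4 * real b * (\<beta>\<^sup>2)\<^sup>2)))) \<le> E.prob A \<and>
    (\<forall>(x, e)\<in>A. \<forall>i\<in>N \<times> {..b}. \<bar>(\<Sum>k<n - lag i. \<Phi> i (path x e k) (path x e (k + lag i))) / n - lag_mean (\<Phi> i) (lag i)\<bar>
      \<le> t + (6 * (\<beta> * L) * c1 + 3 * \<beta>\<^sup>2) * b / n)"
  proof (rule uniform_deviation[of "N \<times> {..b}" \<Phi> "\<beta>\<^sup>2" "\<beta> * L" lag b n t])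
    show "two_point (\<Phi> i) (\<beta>\<^sup>2) (\<beta> * L)" if "i \<in> N \<times> {..b}" for i
      using that two_point_product[OF lip] two_point_fst[OF lip] by (auto simp: \<Phi>_def)
    show "lag i < b" for i
      using b by (auto simp: lag_def split: prod.split)
  qed (use N \<beta> n b \<Delta>b t in auto)
  then obtain A where A: "A \<in> sets (\<nu> \<Otimes>\<^sub>M S)"
    "1 - 1 / (2 * real n) - real (card (N \<times> {..b})) * (4 * real b * exp (- (t\<^sup>2 * n / (4 * real b * (\<beta>\<^sup>2)\<^sup>2)))) \<le> E.prob A"
    "\<And>x e i. (x, e) \<in> A \<Longrightarrow> i \<in> N \<times> {..b} \<Longrightarrow>
      \<bar>(\<Sum>k<n - lag i. \<Phi> i (path x e k) (path x e (k + lag i))) / n - lag_mean (\<Phi> i) (lag i)\<bar> \<le> \<delta>"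
    unfolding \<delta>_def by blast
  have "\<bar>spectral_var w b n (path x e) h - long_run_var (\<lambda>x. h x - c)\<bar>
      \<le> 3 * real b * ((1 + 3 * \<beta>) * \<delta>) + 4 * (\<beta> * L * a / (1 - \<Delta>)) / n"
    if xe: "(x, e) \<in> A" and h: "h \<in> N" for x e h
  proof -
    define g where "g = (\<lambda>x. h x - c)"
    have g: "lip_fun g \<beta> L" and g0: "(\<integral>x. g x \<partial>\<mu>) = 0"
      using lip[OF h] center[OF h] by (auto simp: g_def)
    interpret f: geometric_decay "autocov g" "\<beta> * L * a" \<Delta>
      by (rule geometric_decay_autocov[OF g g0])
    have "(x, e) \<in> space (\<nu> \<Otimes>\<^sub>M S)"
      using A(1) xe sets.sets_into_space by blast
    then have sp: "x \<in> space X" "e \<in> space S"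
      by (auto simp: space_pair_measure space_\<nu>)
    have mean: "\<bar>(\<Sum>k<n. h (path x e k) - c) / n\<bar> \<le> \<delta>"
      using A(3)[OF xe, of "(h, b)"] h lag_mean_fst[OF g] g0 by (simp add: \<Phi>_def lag_def g_def)
    have cov: "\<bar>(\<Sum>k<n - l. (h (path x e k) - c) * (h (path x e (k + l)) - c)) / n - autocov g l\<bar> \<le> \<delta>" if "l < b" for l
      using A(3)[OF xe, of "(h, l)"] h that by (simp add: \<Phi>_def lag_def g_def autocov_def)
    have r: "\<bar>emp_autocov n h (path x e) l - autocov g l\<bar> \<le> (1 + 3 * \<beta>) * \<delta>" if "l < b" for l
      using g sp by (intro emp_autocov_approx[where X = "path x e" and h = h and c = c, OF n _ mean cov[OF that]]) (auto simp: lip_fun_def g_def path_space)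
    \<comment> \<open>Clipping by \<open>min 1\<close> keeps the argument in the interval where
      \<open>lag_window\<close> bounds \<open>w\<close> by 1, so that \<open>v\<close> is a taper
      for all \<open>l\<close>; for \<open>l < b\<close> it changes nothing. Since
      \<open>p / b = 1 / 2\<close>, the weight is 1 up to lag \<open>p\<close>.\<close>
    define v where "v l = w (min 1 (real l / b))" for l
    have v: "0 \<le> v l" "v l \<le> 1" "l \<le> p \<Longrightarrow> v l = 1" for l
    proof -
      show "0 \<le> v l"
        using w by (simp add: lag_window_def v_def)
      have "min 1 (real l / b) \<in> {0..1}" by simp
      then have "\<bar>w (min 1 (real l / b))\<bar> \<le> 1"
        using w unfolding lag_window_def by blast
      then show "v l \<le> 1" by (simp add: v_def)
      assume "l \<le> p"
      then have "min 1 (real l / b) \<in> {-1/2..1/2}"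
        using p by (simp add: min_def field_simps)
      then show "v l = 1"
        using w unfolding v_def lag_window_def by blast
    qed
    have sym: "w (real_of_int l / b) = w (real (nat \<bar>l\<bar>) / b)" for l
    proof (cases "0 \<le> l")
      case False
      then have "real (nat \<bar>l\<bar>) / b = - (real_of_int l / b)" by simp
      then show ?thesis
        using w unfolding lag_window_def by metis
    qed simp
    have "spectral_var w b n (path x e) h
        = (\<Sum>l\<in>{l::int. \<bar>l\<bar> < int b}. v (nat \<bar>l\<bar>) * emp_autocov n h (path x e) (nat \<bar>l\<bar>))"
      unfolding spectral_var_def
    proof (rule sum.cong[OF refl])
      fix l :: int assume "l \<in> {l. \<bar>l\<bar> < int b}"
      then have "nat \<bar>l\<bar> < b" by auto
      then have "real (nat \<bar>l\<bar>) / b \<le> 1" by simp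
      then have "w (real_of_int l / b) = v (nat \<bar>l\<bar>)"
        unfolding sym v_def by (simp only: min_absorb2)
      then show "w (real_of_int l / b) * emp_autocov n h (path x e) (nat \<bar>l\<bar>)
          = v (nat \<bar>l\<bar>) * emp_autocov n h (path x e) (nat \<bar>l\<bar>)"
        by simp
    qed
    also have "\<dots> = 2 * (\<Sum>l<b. v l * emp_autocov n h (path x e) l) - v 0 * emp_autocov n h (path x e) 0"
      by (rule sum_even_int[OF b, of "\<lambda>l. v l * emp_autocov n h (path x e) l"])
    finally have "\<bar>spectral_var w b n (path x e) h - long_run_var g\<bar>
        \<le> 3 * real b * ((1 + 3 * \<beta>) * \<delta>) + 4 * (\<beta> * L * a * \<Delta> ^ p / (1 - \<Delta>))"
      unfolding long_run_var_def using f.windowed_sum[where v = v and p = p and b = b, OF r v] p by simp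
    also have "\<beta> * L * a * \<Delta> ^ p / (1 - \<Delta>) \<le> \<beta> * L * a * (1 / n) / (1 - \<Delta>)"
      using p rate f.C_nonneg by (intro divide_right_mono mult_left_mono) auto
    finally show ?thesis
      by (simp add: g_def mult.commute)
  qed
  moreover have cardI: "real (card (N \<times> {..b})) = real (card N) * (real b + 1)"
    by (simp add: card_cartesian_product algebra_simps)
  ultimately show ?thesis
    using A(1) A(2)[unfolded cardI] unfolding \<delta>_def by blast
qed

end

section \<open>From the net to the whole class\<close>

lemma (in prob_space) integral_abs_le_L2:
  fixes f :: "'a \<Rightarrow> real"
  assumes f: "f \<in> borel_measurable M" and bound: "\<And>x. x \<in> space M \<Longrightarrow> \<bar>f x\<bar> \<le> b"
  shows "(\<integral>x. \<bar>f x\<bar> \<partial>M) \<le> sqrt (\<integral>x. (f x)\<^sup>2 \<partial>M)"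
proof -
  have f1: "integrable M (\<lambda>x. \<bar>f x\<bar>)"
    using f bound by (intro integrable_const_bound[of _ b]) auto
  have "\<bar>f x\<bar>\<^sup>2 \<le> b\<^sup>2" if "x \<in> space M" for x
    using bound[OF that] by (intro power_mono) auto
  then have f2: "integrable M (\<lambda>x. \<bar>f x\<bar>\<^sup>2)"
    using f by (intro integrable_const_bound[of _ "b\<^sup>2"]) auto
  \<comment> \<open>Nonnegativity of a variance plays the part of Cauchy--Schwarz. The result turns
    the L2 radius of the net into the L1 closeness that \<open>autocov_diff\<close> takes.\<close>
  have "0 \<le> variance (\<lambda>x. \<bar>f x\<bar>)"
    by (rule variance_positive)
  also have "\<dots> = expectation (\<lambda>x. \<bar>f x\<bar>\<^sup>2) - (expectation (\<lambda>x. \<bar>f x\<bar>))\<^sup>2"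
    by (rule variance_eq[OF f1 f2])
  finally have "(expectation (\<lambda>x. \<bar>f x\<bar>))\<^sup>2 \<le> expectation (\<lambda>x. (f x)\<^sup>2)"
    by simp
  then show ?thesis
    by (rule real_le_rsqrt)
qed

text \<open>Origin of \<open>\<kappa>'\<close>: \<open>\<rho>\<close> pays for the net, 2 for
  \<open>(ln n)^2 \<le> n^2\<close>, 1 for the probability \<open>1 / (2 * n)\<close>, and the
  logarithm to base 2 turns the constant \<open>16 * \<kappa>^2 * C\<rho>\<close> into a power of
  \<open>n\<close>, as \<open>n \<ge> 2\<close>. The \<open>max 1\<close> keeps that power
  nonnegative.\<close>

lemma exp_absorbs_polynomial:
  fixes C\<rho> \<rho> \<kappa> \<kappa>' :: real and n :: nat
  assumes n: "2 \<le> n" and \<kappa>: "0 < \<kappa>"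
    and \<kappa>': "\<kappa>' = \<rho> + 3 + log 2 (max 1 (16 * \<kappa>\<^sup>2 * C\<rho>))"
  shows "C\<rho> * n powr \<rho> * (8 * (\<kappa> * ln n)\<^sup>2) * exp (- (\<kappa>' * ln n)) \<le> 1 / (2 * real n)"
proof (cases "0 < C\<rho>")
  case True
  have n0: "0 < real n" using n by simp
  define l where "l = log 2 (max 1 (16 * \<kappa>\<^sup>2 * C\<rho>))"
  have l: "0 \<le> l"
    by (simp add: l_def)
  have "16 * \<kappa>\<^sup>2 * C\<rho> \<le> 2 powr l"
    by (simp add: l_def)
  also have "\<dots> \<le> n powr l"
    using n l by (intro powr_mono2) auto
  finally have 1: "16 * \<kappa>\<^sup>2 * C\<rho> \<le> n powr l" .
  have "(\<kappa> * ln n)\<^sup>2 \<le> (\<kappa> * n)\<^sup>2"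
    using n \<kappa> by (intro power_mono mult_left_mono) (auto intro: less_imp_le[OF ln_less_self])
  then have "C\<rho> * n powr \<rho> * (8 * (\<kappa> * ln n)\<^sup>2) \<le> C\<rho> * n powr \<rho> * (8 * (\<kappa> * n)\<^sup>2)"
    using True by (intro mult_left_mono) auto
  also have "\<dots> = (16 * \<kappa>\<^sup>2 * C\<rho>) * n powr (\<rho> + 3) / (2 * n)"
    using n0 by (simp add: powr_add power_mult_distrib power2_eq_square powr_numeral power3_eq_cube)
  also have "\<dots> \<le> n powr l * n powr (\<rho> + 3) / (2 * n)"
    using 1 n0 by (intro divide_right_mono mult_right_mono) auto
  also have "\<dots> = n powr \<kappa>' / (2 * n)"
    by (simp add: \<kappa>' l_def powr_add mult_ac)
  finally have "C\<rho> * n powr \<rho> * (8 * (\<kappa> * ln n)\<^sup>2) * exp (- (\<kappa>' * ln n))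
      \<le> n powr \<kappa>' / (2 * n) * exp (- (\<kappa>' * ln n))"
    by (intro mult_right_mono) auto
  also have "\<dots> = 1 / (2 * real n)"
    using n0 by (simp add: powr_def exp_minus)
  finally show ?thesis .
next
  case False
  then have "C\<rho> * n powr \<rho> * (8 * (\<kappa> * ln n)\<^sup>2) * exp (- (\<kappa>' * ln n)) \<le> 0"
    by (intro mult_nonpos_nonneg) auto
  then show ?thesis
    by (rule order_trans) simp
qed

text \<open>Since \<open>ln x / ln 2 \<ge> 1\<close> and \<open>ln 2 \<le> 1\<close>, all lower
  powers of the logarithm are dominated by the power 5/2 of this quotient. Here the order
  \<open>ln n ^ 2\<close> is relaxed to the exponent 5/2.\<close>

lemma ln_power_le:
  fixes x :: real
  assumes x: "2 \<le> x" and y: "y \<in> {1, ln x, (ln x)\<^sup>2}"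
  shows "y \<le> ln 2 powr (-5/2) * ln x powr (5/2)"
proof -
  define q where "q = ln x / ln 2"
  have ln2: "0 < ln (2::real)" "ln 2 \<le> (1::real)"
    using ln_2_less_1 by auto
  have lnx: "ln 2 \<le> ln x"
    using x by simp
  have q: "1 \<le> q"
    using lnx ln2 by (auto simp: q_def)
  have eq: "ln 2 powr (-5/2) * ln x powr (5/2) = q powr (5/2)"
  proof -
    have "ln 2 powr (-5/2) = 1 / ln 2 powr (5/2 :: real)"
      using powr_minus_divide[of "ln 2" "5/2 :: real"] by (simp only: minus_divide_left)
    moreover have "q powr (5/2) = ln x powr (5/2) / ln 2 powr (5/2)"
      unfolding q_def by (rule powr_divide)
    ultimately show ?thesis by simp
  qed
  have *: "q\<^sup>2 \<le> q powr (5/2)" "q \<le> q powr (5/2)" "1 \<le> q powr (5/2)"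
    using powr_mono[of 2 "5/2" q] powr_mono[of 1 "5/2" q] ge_one_powr_ge_zero[of q "5/2"] q by simp_all
  have lnx0: "0 \<le> ln x"
    using x by simp
  have "ln x \<le> q"
    using ln2(2) lnx0 by (simp add: q_def pos_le_divide_eq mult_left_le)
  moreover from this have "(ln x)\<^sup>2 \<le> q\<^sup>2"
    using lnx0 by (intro power_mono)
  ultimately show ?thesis
    using y * unfolding eq by auto
qed

context started_maps
begin

text \<open>At radius \<open>1 / n\<close> the net error is of order \<open>ln n / n\<close>,
  negligible against \<open>1 / sqrt n\<close>, whereas the polynomial cardinality of so fine a net
  enters the deviation only through its logarithm.\<close>

lemma selection_bound:
  fixes \<beta> \<rho> C\<rho> :: real
  assumes lip: "\<And>h. h \<in> H \<Longrightarrow> lip_fun (\<lambda>x. h x - c) \<beta> L"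
    and center: "\<And>h. h \<in> H \<Longrightarrow> (\<integral>x. h x - c \<partial>\<mu>) = 0" and \<beta>: "1 \<le> \<beta>" and L: "0 \<le> L"
    and w: "lag_window w" and n: "2 \<le> n" and b: "b = bandwidth \<Delta> n"
    and N: "finite N" "N \<subseteq> H" and card: "card N \<le> C\<rho> * n powr \<rho>"
    and net: "\<And>h. h \<in> H \<Longrightarrow> \<exists>g\<in>N. L2_dist \<mu> h g \<le> 1 / n" and \<rho>: "0 < \<rho>"
  shows "\<exists>A\<in>sets (\<nu> \<Otimes>\<^sub>M S). 1 - 1 / n \<le> E.prob A \<and>
    (\<forall>(x, e)\<in>A. \<forall>k h. is_arg_min (spectral_var w b n (path x e)) (\<lambda>h. h \<in> N) k \<longrightarrow> h \<in> H \<longrightarrow>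
      long_run_var (\<lambda>x. k x - c) - long_run_var (\<lambda>x. h x - c)
        \<le> excess_const \<beta> L a c1 \<Delta> \<rho> C\<rho> * real n powr (-1/2) * ln n powr (5/2))"
proof -
  define \<kappa> where "\<kappa> = 2 * (1 / ln (1 / \<Delta>) + 1 / ln 2)"
  define \<kappa>' where "\<kappa>' = \<rho> + 3 + log 2 (max 1 (16 * \<kappa>\<^sup>2 * C\<rho>))"
  define c2 where "c2 = 2 * \<beta>\<^sup>2 * sqrt (\<kappa> * \<kappa>') + (6 * (\<beta> * L) * c1 + 3 * \<beta>\<^sup>2) * \<kappa>"
  define \<tau> where "\<tau> = \<beta> * L * a / (1 - \<Delta>)"
  define l where "l = ln (real n)"
  define r where "r = sqrt (real n)"
  obtain p where p: "b = 2 * p" "0 < p" "\<Delta> ^ p \<le> 1 / n" and b_le: "b \<le> \<kappa> * l"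
    using bandwidth_props[OF rate n] unfolding b \<kappa>_def l_def by metis
  have n0: "0 < real n" and n1: "0 < n"
    using n by auto
  have l: "0 < l"
    using n by (simp add: l_def)
  have r: "0 < r" "r \<le> n" "r * r = n"
    using n by (auto simp: r_def sqrt_le_D intro: real_sqrt_le_iff[THEN iffD1] real_le_lsqrt simp: power2_eq_square)
  have inv_n: "1 / real n \<le> 1 / r"
    using r n0 by (intro divide_left_mono) auto
  have \<kappa>: "0 < \<kappa>"
    using rate unfolding \<kappa>_def by (intro mult_pos_pos add_pos_pos divide_pos_pos) auto
  have \<kappa>': "0 < \<kappa>'"
    using \<rho> by (auto simp: \<kappa>'_def intro: add_pos_nonneg)
  have b0: "1 \<le> real b"
    using p by simp
  have \<tau>: "0 \<le> \<tau>"
    using \<beta> L a_nonneg rate by (simp add: \<tau>_def)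
  \<comment> \<open>Chosen so that
    \<open>t^2 * n = 4 * \<beta>^4 * \<kappa> * \<kappa>' * l^2\<close>; with
    \<open>b \<le> \<kappa> * l\<close> the Hoeffding exponent is then at least
    \<open>\<kappa>' * l\<close>, as \<open>exp_absorbs_polynomial\<close> expects.\<close>
  define t where "t = 2 * \<beta>\<^sup>2 * sqrt (\<kappa> * \<kappa>') * l / r"
  have t: "0 < t"
    using \<beta> \<kappa> \<kappa>' l r by (simp add: t_def)
  have fail: "card N * (real b + 1) * (4 * real b * exp (- (t\<^sup>2 * n / (4 * real b * (\<beta>\<^sup>2)\<^sup>2)))) \<le> 1 / (2 * real n)"
  proof -
    have "t\<^sup>2 * n = 4 * (\<beta>\<^sup>2)\<^sup>2 * (\<kappa> * \<kappa>') * l\<^sup>2 * (n / (r * r))"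
      using \<kappa> \<kappa>' by (simp add: t_def power_mult_distrib power_divide power2_eq_square[of r])
    also have "n / (r * r) = 1"
      using r n0 by simp
    finally have "t\<^sup>2 * n / (4 * real b * (\<beta>\<^sup>2)\<^sup>2) = \<kappa>' * l * (\<kappa> * l / b)"
      using \<beta> b0 by (simp add: power2_eq_square field_simps)
    also have "\<kappa>' * l * 1 \<le> \<kappa>' * l * (\<kappa> * l / b)"
      using b_le b0 \<kappa>' l by (intro mult_left_mono) auto
    finally have ex: "exp (- (t\<^sup>2 * n / (4 * real b * (\<beta>\<^sup>2)\<^sup>2))) \<le> exp (- (\<kappa>' * l))"
      by simp
    have "(real b + 1) * (4 * real b) \<le> (real b + real b) * (4 * real b)"
      using b0 by (intro mult_right_mono) auto
    also have "\<dots> = 8 * (real b)\<^sup>2"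
      by (simp add: power2_eq_square)
    also have "\<dots> \<le> 8 * (\<kappa> * l)\<^sup>2"
      using b_le by (intro mult_left_mono power_mono) auto
    finally have bb: "(real b + 1) * (4 * real b) \<le> 8 * (\<kappa> * l)\<^sup>2" .
    have "card N * (real b + 1) * (4 * real b * exp (- (t\<^sup>2 * n / (4 * real b * (\<beta>\<^sup>2)\<^sup>2))))
        = card N * ((real b + 1) * (4 * real b)) * exp (- (t\<^sup>2 * n / (4 * real b * (\<beta>\<^sup>2)\<^sup>2)))"
      by simp
    also have "\<dots> \<le> (C\<rho> * n powr \<rho>) * (8 * (\<kappa> * l)\<^sup>2) * exp (- (\<kappa>' * l))"
      by (rule mult_mono[OF mult_mono[OF card bb] ex]) (use order_trans[OF of_nat_0_le_iff card] in auto)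
    also have "\<dots> \<le> 1 / (2 * real n)"
      unfolding l_def by (rule exp_absorbs_polynomial[OF n \<kappa> \<kappa>'_def])
    finally show ?thesis .
  qed
  define dev where "dev = 3 * real b * ((1 + 3 * \<beta>) * (t + (6 * (\<beta> * L) * c1 + 3 * \<beta>\<^sup>2) * b / n)) + 4 * \<tau> / n"
  obtain A where A: "A \<in> sets (\<nu> \<Otimes>\<^sub>M S)"
    "1 - 1 / (2 * real n) - real (card N) * (real b + 1) * (4 * real b * exp (- (t\<^sup>2 * n / (4 * real b * (\<beta>\<^sup>2)\<^sup>2)))) \<le> E.prob A"
    "\<And>x e h. (x, e) \<in> A \<Longrightarrow> h \<in> N \<Longrightarrow> \<bar>spectral_var w b n (path x e) h - long_run_var (\<lambda>x. h x - c)\<bar> \<le> dev"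
    using spectral_var_deviation[OF N(1) lip center \<beta> w n1 p(2,1,3) t] N(2) unfolding dev_def \<tau>_def by blast
  have "1 - 1 / n \<le> E.prob A"
    using A(2) fail by (simp add: field_simps)
  moreover have "long_run_var (\<lambda>x. k x - c) - long_run_var (\<lambda>x. h x - c)
        \<le> excess_const \<beta> L a c1 \<Delta> \<rho> C\<rho> * real n powr (-1/2) * ln n powr (5/2)"
    if xe: "(x, e) \<in> A" and k: "is_arg_min (spectral_var w b n (path x e)) (\<lambda>h. h \<in> N) k" and h: "h \<in> H" for x e k h
  proof -
    obtain g where g: "g \<in> N" "L2_dist \<mu> h g \<le> 1 / n"
      using net[OF h] by blast
    have kN: "k \<in> N" and min: "spectral_var w b n (path x e) k \<le> spectral_var w b n (path x e) g"
      using k g(1) by (auto simp: is_arg_min_def not_less)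
    define h' g' where "h' = (\<lambda>x. h x - c)" and "g' = (\<lambda>x. g x - c)"
    have lh: "lip_fun h' \<beta> L" "(\<integral>x. h' x \<partial>\<mu>) = 0" and lg: "lip_fun g' \<beta> L" "(\<integral>x. g' x \<partial>\<mu>) = 0"
      using lip center h g N by (auto simp: h'_def g'_def)
    have "(\<integral>x. \<bar>h' x - g' x\<bar> \<partial>\<mu>) \<le> sqrt (\<integral>x. (h' x - g' x)\<^sup>2 \<partial>\<mu>)"
    proof (rule \<mu>.integral_abs_le_L2)
      show "(\<lambda>x. h' x - g' x) \<in> borel_measurable \<mu>"
        using lh lg by (auto simp: lip_fun_def cong: measurable_cong_sets)
      show "\<bar>h' x - g' x\<bar> \<le> 2 * \<beta>" if "x \<in> space \<mu>" for x
      proof -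
        have "\<bar>h' x\<bar> \<le> \<beta>" "\<bar>g' x\<bar> \<le> \<beta>"
          using lh lg that by (auto simp: lip_fun_def space_\<mu>)
        then show ?thesis by linarith
      qed
    qed
    also have "\<dots> = L2_dist \<mu> h g"
      by (simp add: L2_dist_def h'_def g'_def)
    also note g(2)
    finally have L1: "(\<integral>x. \<bar>h' x - g' x\<bar> \<partial>\<mu>) \<le> 1 / n" .
    have "\<bar>long_run_var h' - long_run_var g'\<bar>
        \<le> 3 * real b * (2 * \<beta> * (1 / n)) + 4 * (\<beta> * L * a * \<Delta> ^ b / (1 - \<Delta>))"
      unfolding long_run_var_def
      by (rule even_sum_diff[OF geometric_decay_autocov[OF lh] geometric_decay_autocov[OF lg]
            autocov_diff[OF lh(1) lg(1) L1]]) (use p in simp)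
    also have "\<beta> * L * a * \<Delta> ^ b / (1 - \<Delta>) \<le> \<tau> * (1 / n)"
    proof -
      have "\<Delta> ^ b \<le> \<Delta> ^ p"
        using rate p by (intro power_decreasing) auto
      with p(3) have "\<Delta> ^ b \<le> 1 / n" by linarith
      then have "\<tau> * \<Delta> ^ b \<le> \<tau> * (1 / n)"
        using \<tau> by (intro mult_left_mono)
      then show ?thesis by (simp add: \<tau>_def)
    qed
    finally have gh: "\<bar>long_run_var h' - long_run_var g'\<bar> \<le> 3 * real b * (2 * \<beta> * (1 / n)) + 4 * (\<tau> * (1 / n))"
      by simp
    \<comment> \<open>\<open>k\<close> does at least as well empirically as the net point
      \<open>g\<close>, so the excess is at most two deviations, at \<open>k\<close> and at
      \<open>g\<close>, plus the gap between \<open>g\<close> and \<open>h\<close>.\<close>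
    have "long_run_var (\<lambda>x. k x - c) - long_run_var h'
        \<le> 2 * dev + (3 * real b * (2 * \<beta> * (1 / n)) + 4 * (\<tau> * (1 / n)))"
      using A(3)[OF xe kN] A(3)[OF xe g(1)] min gh unfolding g'_def by linarith
    also have "\<dots> \<le> (6 * \<kappa> * (1 + 3 * \<beta>) * c2 * l\<^sup>2 + 6 * \<beta> * \<kappa> * l + 12 * \<tau> * 1) * (1 / r)"
    proof -
      have \<kappa>l: "0 \<le> \<kappa> * l"
        using \<kappa> l by simp
      have bn: "b / n \<le> \<kappa> * l * (1 / r)"
        using mult_mono[OF b_le inv_n] \<kappa>l r by simp
      have c1': "0 \<le> 6 * (\<beta> * L) * c1 + 3 * \<beta>\<^sup>2"
        using \<beta> L c1 by simp
      have "t + (6 * (\<beta> * L) * c1 + 3 * \<beta>\<^sup>2) * b / n \<le> t + (6 * (\<beta> * L) * c1 + 3 * \<beta>\<^sup>2) * (\<kappa> * l * (1 / r))"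
        using mult_left_mono[OF bn c1'] by simp
      also have "\<dots> = c2 * l * (1 / r)"
        by (simp add: t_def c2_def algebra_simps add_divide_distrib)
      finally have 1: "t + (6 * (\<beta> * L) * c1 + 3 * \<beta>\<^sup>2) * b / n \<le> c2 * l * (1 / r)" .
      have t': "0 \<le> t + (6 * (\<beta> * L) * c1 + 3 * \<beta>\<^sup>2) * b / n"
        using t c1' n0 by (intro add_nonneg_nonneg) auto
      have 2: "3 * real b * ((1 + 3 * \<beta>) * (t + (6 * (\<beta> * L) * c1 + 3 * \<beta>\<^sup>2) * b / n))
          \<le> 3 * (\<kappa> * l) * ((1 + 3 * \<beta>) * (c2 * l * (1 / r)))"
        using b_le 1 t' \<beta> \<kappa> l by (intro mult_mono mult_nonneg_nonneg) auto
      have 3: "\<tau> * (1 / n) \<le> \<tau> * (1 / r)"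
        using inv_n \<tau> by (rule mult_left_mono)
      have 4: "6 * \<beta> * (b / n) \<le> 6 * \<beta> * (\<kappa> * l * (1 / r))"
        using bn \<beta> by (intro mult_left_mono) auto
      have "2 * dev + (3 * real b * (2 * \<beta> * (1 / n)) + 4 * (\<tau> * (1 / n)))
          = 2 * (3 * real b * ((1 + 3 * \<beta>) * (t + (6 * (\<beta> * L) * c1 + 3 * \<beta>\<^sup>2) * b / n)))
            + 6 * \<beta> * (b / n) + 12 * (\<tau> * (1 / n))"
        unfolding dev_def by simp
      also have "\<dots> \<le> 2 * (3 * (\<kappa> * l) * ((1 + 3 * \<beta>) * (c2 * l * (1 / r))))
            + 6 * \<beta> * (\<kappa> * l * (1 / r)) + 12 * (\<tau> * (1 / r))"
        using 2 3 4 by linarith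
      also have "\<dots> = (6 * \<kappa> * (1 + 3 * \<beta>) * c2 * l\<^sup>2 + 6 * \<beta> * \<kappa> * l + 12 * \<tau> * 1) * (1 / r)"
        by (simp add: power2_eq_square algebra_simps add_divide_distrib)
      finally show ?thesis .
    qed
    also have "\<dots> \<le> (6 * \<kappa> * (1 + 3 * \<beta>) * c2 * (ln 2 powr (-5/2) * l powr (5/2))
        + 6 * \<beta> * \<kappa> * (ln 2 powr (-5/2) * l powr (5/2)) + 12 * \<tau> * (ln 2 powr (-5/2) * l powr (5/2))) * (1 / r)"
    proof -
      have c2: "0 \<le> c2"
        using \<beta> L c1 \<kappa> \<kappa>' by (simp add: c2_def)
      show ?thesis
        using n r \<beta> \<tau> \<kappa> c2 unfolding l_def
        by (intro mult_right_mono add_mono mult_left_mono ln_power_le) auto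
    qed
    also have "\<dots> = excess_const \<beta> L a c1 \<Delta> \<rho> C\<rho> * (1 / r) * l powr (5/2)"
      unfolding excess_const_def Let_def \<kappa>_def[symmetric] \<kappa>'_def[symmetric] c2_def[symmetric] \<tau>_def[symmetric]
      by (simp add: algebra_simps add_divide_distrib)
    also have "1 / r = real n powr (-1/2)"
    proof -
      have "real n powr (-1/2) = 1 / real n powr (1/2)"
        using powr_minus_divide[of "real n" "1/2"] by (simp only: minus_divide_left)
      then show ?thesis
        by (simp add: r_def powr_half_sqrt)
    qed
    finally show ?thesis
      by (simp add: l_def h'_def)
  qed
  ultimately show ?thesis
    using A(1) by blast
qed

end

subsection \<open>Contraction of the SGLD step\<close>

lemma GDERIV_unique:
  fixes f :: "'a::euclidean_space \<Rightarrow> real"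
  assumes "GDERIV f x :> v" "GDERIV f x :> w"
  shows "v = w"
proof -
  have "(\<lambda>h. h \<bullet> v) = (\<lambda>h. h \<bullet> w)"
    using assms unfolding gderiv_def by (rule has_derivative_unique)
  then have "\<forall>h. h \<bullet> v = h \<bullet> w"
    by (simp add: fun_eq_iff)
  then show ?thesis
    by (simp only: vector_eq_ldot)
qed

lemma grad_eq: "GDERIV f x :> v \<Longrightarrow> grad f x = v"
  unfolding grad_def by (blast intro: GDERIV_unique)

text \<open>The derivative is a linear functional, represented by the vector
  \<open>adjoint D 1\<close>; uniqueness identifies this vector with the description in
  \<open>grad\<close>.\<close>

lemma GDERIV_grad:
  fixes f :: "'a::euclidean_space \<Rightarrow> real"
  assumes "f differentiable (at x)"
  shows "GDERIV f x :> grad f x"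
proof -
  obtain D where D: "(f has_derivative D) (at x)"
    using assms by (auto simp: differentiable_def)
  have "linear D"
    using D by (rule has_derivative_linear)
  then have "D = (\<lambda>h. h \<bullet> adjoint D 1)"
    by (simp add: adjoint_works fun_eq_iff)
  with D have "GDERIV f x :> adjoint D 1"
    by (simp add: gderiv_def)
  then show ?thesis
    using grad_eq by metis
qed

lemma GDERIV_along_line:
  fixes f :: "'a::euclidean_space \<Rightarrow> real"
  assumes "GDERIV f (y + t *\<^sub>R v) :> g"
  shows "((\<lambda>t. f (y + t *\<^sub>R v)) has_real_derivative (v \<bullet> g)) (at t)"
proof -
  have "((\<lambda>t. y + t *\<^sub>R v) has_derivative (\<lambda>s. s *\<^sub>R v)) (at t)"
    by (auto intro!: derivative_eq_intros)
  from has_derivative_compose[OF this assms[unfolded gderiv_def]] show ?thesis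
    by (simp add: has_field_derivative_def mult_commute_abs)
qed

lemma convex_gradient_lower:
  fixes f :: "'a::euclidean_space \<Rightarrow> real"
  assumes convex: "convex_on UNIV f" and g: "GDERIV f y :> g"
  shows "f y + g \<bullet> (z - y) \<le> f z"
proof -
  define \<phi> where "\<phi> t = f (y + t *\<^sub>R (z - y))" for t
  have "convex_on UNIV \<phi>"
  proof (rule convex_onI)
    fix t :: real and x x' :: real assume t: "0 < t" "t < 1"
    have eq: "y + ((1 - t) *\<^sub>R x + t *\<^sub>R x') *\<^sub>R (z - y)
        = (1 - t) *\<^sub>R (y + x *\<^sub>R (z - y)) + t *\<^sub>R (y + x' *\<^sub>R (z - y))"
      by (simp add: algebra_simps)
    show "\<phi> ((1 - t) *\<^sub>R x + t *\<^sub>R x') \<le> (1 - t) * \<phi> x + t * \<phi> x'"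
      unfolding \<phi>_def eq using t by (intro convex_onD[OF convex]) auto
  qed simp
  moreover have "(\<phi> has_real_derivative ((z - y) \<bullet> g)) (at 0)"
    unfolding \<phi>_def by (rule GDERIV_along_line) (use g in simp)
  ultimately have "((z - y) \<bullet> g) * (1 - 0) \<le> \<phi> 1 - \<phi> 0"
    by (intro convex_on_imp_above_tangent[of UNIV \<phi> 0 1]) auto
  then show ?thesis
    by (simp add: \<phi>_def inner_commute)
qed

text \<open>The descent lemma. Along the segment from \<open>x\<close> to \<open>z\<close> the gap
  \<open>\<psi>\<close> to the quadratic bound has derivative at most 0, by Cauchy--Schwarz and the
  Lipschitz condition, and monotonicity replaces integration of the gradient.\<close>

lemma lipschitz_gradient_upper:
  fixes f :: "'a::euclidean_space \<Rightarrow> real"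
  assumes g: "\<And>x. GDERIV f x :> g x" and lip: "C-lipschitz_on UNIV g"
  shows "f z \<le> f x + g x \<bullet> (z - x) + C / 2 * (norm (z - x))\<^sup>2"
proof -
  define v where "v = z - x"
  define \<psi> where "\<psi> t = f (x + t *\<^sub>R v) - t * (g x \<bullet> v) - C / 2 * t\<^sup>2 * (norm v)\<^sup>2" for t
  have "\<psi> 1 \<le> \<psi> 0"
  proof (rule DERIV_nonpos_imp_nonincreasing[of 0 1])
    fix t :: real assume t: "0 \<le> t" "t \<le> 1"
    have "(\<psi> has_real_derivative (v \<bullet> g (x + t *\<^sub>R v) - g x \<bullet> v - C * t * (norm v)\<^sup>2)) (at t)"
      unfolding \<psi>_def by (auto intro!: derivative_eq_intros GDERIV_along_line g)
    moreover have "v \<bullet> g (x + t *\<^sub>R v) - g x \<bullet> v - C * t * (norm v)\<^sup>2 \<le> 0"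
    proof -
      have "v \<bullet> g (x + t *\<^sub>R v) - g x \<bullet> v = v \<bullet> (g (x + t *\<^sub>R v) - g x)"
        by (simp add: inner_diff_right inner_commute)
      also have "\<dots> \<le> norm v * norm (g (x + t *\<^sub>R v) - g x)"
        by (rule norm_cauchy_schwarz)
      also have "norm (g (x + t *\<^sub>R v) - g x) \<le> C * norm (t *\<^sub>R v)"
        using lipschitz_onD[OF lip, of "x + t *\<^sub>R v" x] by (simp add: dist_norm)
      also have "norm v * (C * norm (t *\<^sub>R v)) = C * t * (norm v)\<^sup>2"
        using t by (simp add: power2_eq_square)
      finally show ?thesis
        by (simp add: mult_left_mono)
    qed
    ultimately show "\<exists>y. (\<psi> has_real_derivative y) (at t) \<and> y \<le> 0"
      by blast
  qed simp
  then show ?thesis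
    by (simp add: \<psi>_def v_def)
qed

text \<open>The Baillon--Haddad inequality, stated for \<open>f\<close> and \<open>g\<close> tied
  only by two inequalities. Both survive weighted sums, so it applies to a minibatch potential
  without differentiating it.\<close>

lemma cocoercive:
  fixes f :: "'a::euclidean_space \<Rightarrow> real"
  assumes lower: "\<And>x z. f x + g x \<bullet> (z - x) \<le> f z"
    and upper: "\<And>x z. f z \<le> f x + g x \<bullet> (z - x) + C / 2 * (norm (z - x))\<^sup>2" and C: "0 < C"
  shows "(norm (g x - g y))\<^sup>2 \<le> C * ((g x - g y) \<bullet> (x - y))"
proof -
  have half: "f y + g y \<bullet> (x - y) + (norm (g x - g y))\<^sup>2 / (2 * C) \<le> f x" for x y
  proof -
    define u where "u = g x - g y"
    \<comment> \<open>The minimiser of the quadratic upper bound at \<open>x\<close> minus the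
      linear function with slope \<open>g y\<close>; squeezing \<open>f z\<close> between the lower
      bound from \<open>y\<close> and the upper bound from \<open>x\<close> is sharpest
      there.\<close>
    define z where "z = x - (1 / C) *\<^sub>R u"
    have "f y + g y \<bullet> (z - y) \<le> f x + g x \<bullet> (z - x) + C / 2 * (norm (z - x))\<^sup>2"
      using lower[of y z] upper[of z x] by linarith
    moreover have "C / 2 * (norm (z - x))\<^sup>2 = (norm u)\<^sup>2 / (2 * C)"
      using C by (simp add: z_def power_divide power2_eq_square)
    moreover have "g y \<bullet> (z - y) = g y \<bullet> (x - y) - (g y \<bullet> u) / C"
      using C by (simp add: z_def inner_diff_right)
    moreover have "g x \<bullet> (z - x) = - (g x \<bullet> u) / C"
      using C by (simp add: z_def)
    moreover have "(g x \<bullet> u) / C - (g y \<bullet> u) / C = (norm u)\<^sup>2 / C"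
      by (simp add: u_def power2_norm_eq_inner inner_diff_left diff_divide_distrib)
    moreover have "(norm u)\<^sup>2 / C = 2 * ((norm u)\<^sup>2 / (2 * C))"
      using C by simp
    ultimately show ?thesis
      unfolding u_def by linarith
  qed
  have "2 * ((norm (g x - g y))\<^sup>2 / (2 * C)) \<le> (g x - g y) \<bullet> (x - y)"
    using half[of x y] half[of y x] by (simp add: inner_diff_left inner_diff_right norm_minus_commute)
  then have "(norm (g x - g y))\<^sup>2 / C \<le> (g x - g y) \<bullet> (x - y)"
    using C by simp
  then show ?thesis
    using C by (simp add: pos_divide_le_eq mult.commute)
qed

section \<open>Random batches and the contraction in mean\<close>

lemma finite_batches [simp]: "finite (batches K M)"
  unfolding batches_def by (rule finite_subset[of _ "Pow {1..K}"]) auto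

lemma card_batches: "card (batches K M) = K choose M"
  unfolding batches_def using n_subsets[of "{1..K}" M] by simp

lemma batches_nonempty: "M \<in> {1..K} \<Longrightarrow> batches K M \<noteq> {}"
  using card_batches[of K M] by (metis atLeastAtMost_iff card.empty binomial_eq_0_iff not_le)

text \<open>An index lies in the fraction \<open>M / K\<close> of all batches: deleting it maps the
  batches containing it bijectively to the sets of size \<open>M - 1\<close> in the rest, and the
  absorption identity compares the binomials.\<close>

lemma card_batches_containing:
  assumes M: "M \<in> {1..K}" and i: "i \<in> {1..K}"
  shows "real K * card {S \<in> batches K M. i \<in> S} = real M * card (batches K M)"
proof -
  have "bij_betw (\<lambda>S. S - {i}) {S \<in> batches K M. i \<in> S} {S. S \<subseteq> {1..K} - {i} \<and> card S = M - 1}"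
  proof (rule bij_betwI[of _ _ _ "insert i"])
    show "insert i \<in> {S. S \<subseteq> {1..K} - {i} \<and> card S = M - 1} \<rightarrow> {S \<in> batches K M. i \<in> S}"
    proof
      fix S assume S: "S \<in> {S. S \<subseteq> {1..K} - {i} \<and> card S = M - 1}"
      then have "finite S" "i \<notin> S"
        using finite_subset[of S "{1..K} - {i}"] by auto
      then have "card (insert i S) = M"
        using S M by simp
      then show "insert i S \<in> {S \<in> batches K M. i \<in> S}"
        using S i by (auto simp: batches_def)
    qed
  qed (auto simp: batches_def)
  then have "card {S \<in> batches K M. i \<in> S} = card {S. S \<subseteq> {1..K} - {i} \<and> card S = M - 1}"
    by (rule bij_betw_same_card)
  also have "\<dots> = (K - 1) choose (M - 1)"
    using i by (subst n_subsets) auto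
  finally have "K * card {S \<in> batches K M. i \<in> S} = K * ((K - 1) choose (M - 1))"
    by simp
  also have "\<dots> = M * (K choose M)"
    using times_binomial_minus1_eq[of M K] M by simp
  finally show ?thesis
    unfolding card_batches by (metis of_nat_mult)
qed

text \<open>Unbiasedness of the stochastic gradient: the weight \<open>K / M\<close> compensates the
  inclusion frequency \<open>M / K\<close>.\<close>

lemma sum_over_batches:
  fixes r :: "nat \<Rightarrow> real"
  assumes M: "M \<in> {1..K}"
  shows "(\<Sum>S\<in>batches K M. real K / real M * (\<Sum>i\<in>S. r i)) = card (batches K M) * (\<Sum>i=1..K. r i)"
proof -
  have "(\<Sum>S\<in>batches K M. \<Sum>i\<in>S. r i) = (\<Sum>S\<in>batches K M. \<Sum>i=1..K. if i \<in> S then r i else 0)"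
  proof (rule sum.cong[OF refl])
    fix S assume "S \<in> batches K M"
    then have "S = {1..K} \<inter> S" by (auto simp: batches_def)
    then have "(\<Sum>i\<in>S. r i) = (\<Sum>i\<in>{1..K} \<inter> S. r i)" by (rule arg_cong)
    also have "\<dots> = (\<Sum>i=1..K. if i \<in> S then r i else 0)"
      by (rule sum.inter_restrict) simp
    finally show "(\<Sum>i\<in>S. r i) = (\<Sum>i=1..K. if i \<in> S then r i else 0)" .
  qed
  also have "\<dots> = (\<Sum>i=1..K. \<Sum>S\<in>batches K M. if i \<in> S then r i else 0)"
    by (rule sum.swap)
  also have "\<dots> = (\<Sum>i=1..K. card {S \<in> batches K M. i \<in> S} * r i)"
    by (simp flip: sum.inter_filter)
  finally have "(\<Sum>S\<in>batches K M. real K / real M * (\<Sum>i\<in>S. r i))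
      = (\<Sum>i=1..K. real K / real M * (card {S \<in> batches K M. i \<in> S} * r i))"
    by (simp only: sum_distrib_left[symmetric])
  also have "\<dots> = (\<Sum>i=1..K. card (batches K M) * r i)"
  proof (rule sum.cong[OF refl])
    fix i assume i: "i \<in> {1..K}"
    have "real K / real M * card {S \<in> batches K M. i \<in> S} = card (batches K M)"
      using card_batches_containing[OF M i] M by (simp add: field_simps)
    then show "real K / real M * (card {S \<in> batches K M. i \<in> S} * r i) = card (batches K M) * r i"
      by (metis mult.assoc)
  qed
  finally show ?thesis
    by (simp add: sum_distrib_left)
qed

text \<open>The minibatch potential \<open>f\<close> is convex and smooth with constant
  \<open>Lt * (1 + (K / M) * M) = Lt * (K + 1)\<close>, the same for every batch; this is where the
  bound on the step size comes from.\<close>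

lemma stoch_grad_cocoercive:
  assumes U: "sgld_condition K U Lt mU" and Lt: "0 < Lt" and M: "M \<in> {1..K}" and S: "S \<in> batches K M"
  shows "(norm (stoch_grad K M U x S - stoch_grad K M U y S))\<^sup>2
    \<le> Lt * (real K + 1) * ((stoch_grad K M U x S - stoch_grad K M U y S) \<bullet> (x - y))"
proof -
  define f where "f \<theta> = U 0 \<theta> + real K / real M * (\<Sum>i\<in>S. U i \<theta>)" for \<theta>
  have GD: "GDERIV (U i) \<theta> :> grad (U i) \<theta>" if "i \<in> {0..K}" for i \<theta>
    using U that by (intro GDERIV_grad) (auto simp: sgld_condition_def)
  have lower: "U i x + grad (U i) x \<bullet> (z - x) \<le> U i z" if "i \<in> {0..K}" for i x z
    using U that by (intro convex_gradient_lower GD) (auto simp: sgld_condition_def)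
  have upper: "U i z \<le> U i x + grad (U i) x \<bullet> (z - x) + Lt / 2 * (norm (z - x))\<^sup>2" if "i \<in> {0..K}" for i x z
    using U that by (intro lipschitz_gradient_upper GD) (auto simp: sgld_condition_def)
  have SK: "S \<subseteq> {0..K}" "card S = M" and fin: "finite S"
    using S by (auto simp: batches_def intro: finite_subset)
  have inner: "stoch_grad K M U x S \<bullet> v = grad (U 0) x \<bullet> v + real K / real M * (\<Sum>i\<in>S. grad (U i) x \<bullet> v)" for x v
    by (simp add: stoch_grad_def inner_add_left inner_sum_left)
  have KM: "0 \<le> real K / real M" "real K / real M * M = K"
    using M by auto
  show ?thesis
  proof (rule cocoercive)
    fix x z
    have "(\<Sum>i\<in>S. U i x) + (\<Sum>i\<in>S. grad (U i) x \<bullet> (z - x)) \<le> (\<Sum>i\<in>S. U i z)"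
      unfolding sum.distrib[symmetric] using SK by (intro sum_mono lower) auto
    from mult_left_mono[OF this KM(1)] lower[of 0 x z]
    show "f x + stoch_grad K M U x S \<bullet> (z - x) \<le> f z"
      unfolding f_def inner by (simp add: distrib_left)
    have "(\<Sum>i\<in>S. U i z) \<le> (\<Sum>i\<in>S. U i x + grad (U i) x \<bullet> (z - x) + Lt / 2 * (norm (z - x))\<^sup>2)"
      using SK by (intro sum_mono upper) auto
    also have "\<dots> = (\<Sum>i\<in>S. U i x) + (\<Sum>i\<in>S. grad (U i) x \<bullet> (z - x)) + M * (Lt / 2 * (norm (z - x))\<^sup>2)"
      using SK by (simp add: sum.distrib)
    finally have "real K / real M * (\<Sum>i\<in>S. U i z) \<le> real K / real M * ((\<Sum>i\<in>S. U i x)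
        + (\<Sum>i\<in>S. grad (U i) x \<bullet> (z - x)) + M * (Lt / 2 * (norm (z - x))\<^sup>2))"
      using KM(1) by (rule mult_left_mono)
    also have "\<dots> = real K / real M * (\<Sum>i\<in>S. U i x) + real K / real M * (\<Sum>i\<in>S. grad (U i) x \<bullet> (z - x))
        + (real K / real M * M) * (Lt / 2 * (norm (z - x))\<^sup>2)"
      by (simp only: distrib_left mult.assoc)
    finally show "f z \<le> f x + stoch_grad K M U x S \<bullet> (z - x) + Lt * (real K + 1) / 2 * (norm (z - x))\<^sup>2"
      using upper[of 0 z x] unfolding f_def inner KM(2) by (simp add: algebra_simps add_divide_distrib)
  qed (use Lt in simp)
qed

lemma GDERIV_sum:
  assumes "\<And>i. i \<in> I \<Longrightarrow> GDERIV (f i) x :> g i"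
  shows "GDERIV (\<lambda>x. \<Sum>i\<in>I. f i x) x :> (\<Sum>i\<in>I. g i)"
  using assms unfolding gderiv_def inner_sum_right by (intro has_derivative_sum)

lemma grad_potential:
  assumes "sgld_condition K U Lt mU"
  shows "grad (potential K U) x = grad (U 0) x + (\<Sum>i=1..K. grad (U i) x)"
proof (rule grad_eq)
  have GD: "GDERIV (U i) x :> grad (U i) x" if "i \<in> {0..K}" for i
    using assms that by (intro GDERIV_grad) (auto simp: sgld_condition_def)
  show "GDERIV (potential K U) x :> grad (U 0) x + (\<Sum>i=1..K. grad (U i) x)"
    unfolding potential_def[abs_def] by (intro GDERIV_add GDERIV_sum GD) auto
qed

lemma strong_monotonicity:
  assumes U: "sgld_condition K U Lt mU"
  shows "mU * (norm (x - y))\<^sup>2 \<le> (grad (potential K U) x - grad (potential K U) y) \<bullet> (x - y)"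
proof -
  have *: "potential K U x + grad (potential K U) x \<bullet> (y - x) + mU / 2 * (norm (y - x))\<^sup>2 \<le> potential K U y" for x y
    using U by (auto simp: sgld_condition_def)
  show ?thesis
    using *[of x y] *[of y x]
    by (simp add: inner_diff_left inner_diff_right norm_minus_commute algebra_simps)
qed

text \<open>Secures \<open>\<gamma> * mU < 1\<close> and with it a positive
  \<open>contraction_rate\<close>. Strong monotonicity and the Lipschitz bound are compared at a
  unit vector and 0.\<close>

lemma strong_convexity_le_lipschitz:
  fixes U :: "nat \<Rightarrow> 'a::euclidean_space \<Rightarrow> real"
  assumes U: "sgld_condition K U Lt mU"
  shows "mU \<le> Lt * (real K + 1)"
proof -
  obtain e :: 'a where e: "norm e = 1"
    using SOME_Basis norm_Basis by blast
  have lip: "norm (grad (U i) e - grad (U i) 0) \<le> Lt" if "i \<in> {0..K}" for i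
    using U that e lipschitz_onD[of Lt UNIV "grad (U i)" e 0] by (auto simp: sgld_condition_def dist_norm)
  have "mU * (norm (e - 0))\<^sup>2 \<le> (grad (potential K U) e - grad (potential K U) 0) \<bullet> (e - 0)"
    by (rule strong_monotonicity[OF U])
  then have "mU \<le> (grad (potential K U) e - grad (potential K U) 0) \<bullet> e"
    using e by simp
  also have "\<dots> \<le> norm (grad (potential K U) e - grad (potential K U) 0)"
    using norm_cauchy_schwarz[of _ e] e by (metis mult.right_neutral)
  also have "\<dots> = norm ((grad (U 0) e - grad (U 0) 0) + (\<Sum>i=1..K. grad (U i) e - grad (U i) 0))"
    unfolding grad_potential[OF U] by (simp add: sum_subtractf algebra_simps)
  also have "\<dots> \<le> Lt + (\<Sum>i=1..K. Lt)"
    by (intro order_trans[OF norm_triangle_ineq] add_mono lip order_trans[OF norm_sum] sum_mono) auto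
  finally show ?thesis
    by (simp add: algebra_simps)
qed

text \<open>The noise \<open>z\<close> cancels. For each batch, cocoercivity and
  \<open>\<gamma> * (Lt * (K + 1)) \<le> 1\<close> absorb the quadratic term into half of the linear
  one, leaving \<open>norm v ^ 2 - \<gamma> * (G S \<bullet> v)\<close>. This is linear in
  \<open>G S\<close>, so averaging puts the full gradient in its place and strong monotonicity
  applies.\<close>

lemma sgld_step_contraction:
  assumes U: "sgld_condition K U Lt mU" and \<gamma>: "\<gamma> \<in> {0 <..< 1 / (Lt * (real K + 1))}" and M: "M \<in> {1..K}"
  shows "(\<Sum>S\<in>batches K M. norm (sgld_step K M U \<gamma> x S z - sgld_step K M U \<gamma> y S z)) / card (batches K M)
    \<le> contraction_rate \<gamma> mU * norm (x - y)"
proof -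
  define G where "G S = stoch_grad K M U x S - stoch_grad K M U y S" for S
  define v where "v = x - y"
  define n where "n = real (card (batches K M))"
  have n: "0 < n"
    using batches_nonempty[OF M] by (simp add: n_def card_gt_0_iff)
  have \<gamma>0: "0 < \<gamma>" and \<gamma>1: "\<gamma> < 1 / (Lt * (real K + 1))"
    using \<gamma> by auto
  \<comment> \<open>Positivity of \<open>Lt\<close> is read off from the interval for
    \<open>\<gamma>\<close> being nonempty.\<close>
  have "0 < 1 / (Lt * (real K + 1))"
    using \<gamma>0 \<gamma>1 by linarith
  then have LK: "0 < Lt * (real K + 1)"
    by (simp only: zero_less_divide_1_iff)
  then have Lt: "0 < Lt"
    by (simp add: zero_less_mult_iff)
  have \<gamma>LK: "\<gamma> * (Lt * (real K + 1)) \<le> 1"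
    using \<gamma>1 LK by (simp add: pos_less_divide_eq)
  have step: "sgld_step K M U \<gamma> x S z - sgld_step K M U \<gamma> y S z = v - \<gamma> *\<^sub>R G S" for S
    by (simp add: sgld_step_def v_def G_def algebra_simps)
  have sq: "(norm (v - \<gamma> *\<^sub>R G S))\<^sup>2 \<le> (norm v)\<^sup>2 - \<gamma> * (G S \<bullet> v)" if "S \<in> batches K M" for S
  proof -
    have co: "(norm (G S))\<^sup>2 \<le> Lt * (real K + 1) * (G S \<bullet> v)"
      unfolding G_def v_def by (rule stoch_grad_cocoercive[OF U Lt M that])
    then have nonneg: "0 \<le> G S \<bullet> v"
      using LK by (metis order_trans zero_le_mult_iff zero_le_power2 not_less)
    have "\<gamma> * (norm (G S))\<^sup>2 \<le> \<gamma> * (Lt * (real K + 1) * (G S \<bullet> v))"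
      using co \<gamma>0 by (intro mult_left_mono) auto
    also have "\<dots> = \<gamma> * (Lt * (real K + 1)) * (G S \<bullet> v)"
      by simp
    also have "\<dots> \<le> 1 * (G S \<bullet> v)"
      using \<gamma>LK nonneg by (rule mult_right_mono)
    finally have "\<gamma> * (\<gamma> * (norm (G S))\<^sup>2) \<le> \<gamma> * (G S \<bullet> v)"
      using \<gamma>0 by (intro mult_left_mono) auto
    moreover have "(norm (v - \<gamma> *\<^sub>R G S))\<^sup>2 = (norm v)\<^sup>2 - 2 * \<gamma> * (G S \<bullet> v) + \<gamma> * (\<gamma> * (norm (G S))\<^sup>2)"
      by (simp add: power2_norm_eq_inner inner_diff_left inner_diff_right inner_commute algebra_simps)
    ultimately show ?thesis by linarith
  qed
  have mean: "(\<Sum>S\<in>batches K M. G S \<bullet> v) = n * ((grad (potential K U) x - grad (potential K U) y) \<bullet> v)"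
  proof -
    have "(\<Sum>S\<in>batches K M. G S \<bullet> v) = (\<Sum>S\<in>batches K M. (grad (U 0) x - grad (U 0) y) \<bullet> v
        + real K / real M * (\<Sum>i\<in>S. (grad (U i) x - grad (U i) y) \<bullet> v))"
      by (intro sum.cong refl)
         (simp add: G_def stoch_grad_def inner_diff_left inner_add_left inner_sum_left sum_subtractf right_diff_distrib)
    also have "\<dots> = n * ((grad (U 0) x - grad (U 0) y) \<bullet> v) + n * (\<Sum>i=1..K. (grad (U i) x - grad (U i) y) \<bullet> v)"
      unfolding sum.distrib sum_over_batches[OF M] n_def by simp
    also have "\<dots> = n * ((grad (potential K U) x - grad (potential K U) y) \<bullet> v)"
      unfolding grad_potential[OF U]
      by (simp add: inner_diff_left inner_add_left inner_sum_left sum_subtractf algebra_simps)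
    finally show ?thesis .
  qed
  have "(\<Sum>S\<in>batches K M. (norm (v - \<gamma> *\<^sub>R G S))\<^sup>2) \<le> (\<Sum>S\<in>batches K M. (norm v)\<^sup>2 - \<gamma> * (G S \<bullet> v))"
    by (intro sum_mono sq)
  also have "\<dots> = n * (norm v)\<^sup>2 - \<gamma> * (\<Sum>S\<in>batches K M. G S \<bullet> v)"
    by (simp add: sum_subtractf sum_distrib_left n_def)
  also have "\<dots> \<le> n * (norm v)\<^sup>2 - \<gamma> * (n * (mU * (norm v)\<^sup>2))"
    unfolding mean using strong_monotonicity[OF U, of x y] \<gamma>0 n
    by (simp add: v_def mult_left_mono)
  also have "\<dots> = n * ((1 - \<gamma> * mU) * (norm v)\<^sup>2)"
    by (simp add: algebra_simps)
  finally have sqsum: "(\<Sum>S\<in>batches K M. (norm (v - \<gamma> *\<^sub>R G S))\<^sup>2) \<le> n * ((1 - \<gamma> * mU) * (norm v)\<^sup>2)" .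
  \<comment> \<open>Cauchy--Schwarz against the constant 1 passes from the mean square to the mean,
    which is why the rate is a square root.\<close>
  have "(\<Sum>S\<in>batches K M. 1 * norm (v - \<gamma> *\<^sub>R G S))\<^sup>2
      \<le> (\<Sum>S\<in>batches K M. 1\<^sup>2) * (\<Sum>S\<in>batches K M. (norm (v - \<gamma> *\<^sub>R G S))\<^sup>2)"
    by (rule Cauchy_Schwarz_ineq_sum)
  also have "\<dots> \<le> n * (n * ((1 - \<gamma> * mU) * (norm v)\<^sup>2))"
    using sqsum n by (simp add: n_def mult_left_mono)
  finally have "(\<Sum>S\<in>batches K M. norm (v - \<gamma> *\<^sub>R G S))\<^sup>2 \<le> (n * norm v)\<^sup>2 * (1 - \<gamma> * mU)"
    by (simp add: power_mult_distrib power2_eq_square mult_ac)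
  then have "(\<Sum>S\<in>batches K M. norm (v - \<gamma> *\<^sub>R G S)) \<le> sqrt ((n * norm v)\<^sup>2 * (1 - \<gamma> * mU))"
    by (rule real_le_rsqrt)
  also have "\<dots> = n * (contraction_rate \<gamma> mU * norm v)"
    using n by (simp add: real_sqrt_mult contraction_rate_def)
  finally show ?thesis
    unfolding step using n by (simp add: n_def[symmetric] v_def pos_divide_le_eq mult.commute)
qed

subsection \<open>The SGLD chain as a random map\<close>

lemma prob_space_batch_law:
  assumes "M \<in> {1..K}"
  shows "prob_space (batch_law K M)"
  unfolding batch_law_def using batches_nonempty[OF assms] by (intro prob_space_uniform_count_measure) auto

lemma sets_batch_law [measurable_cong]: "sets (batch_law K M) = sets (count_space (batches K M))"
  by (simp add: batch_law_def sets_uniform_count_measure)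

lemma space_batch_law: "space (batch_law K M) = batches K M"
  by (simp add: batch_law_def space_uniform_count_measure)

lemma nn_integral_batch_law:
  fixes f :: "nat set \<Rightarrow> real"
  assumes "\<And>S. 0 \<le> f S"
  shows "(\<integral>\<^sup>+S. ennreal (f S) \<partial>batch_law K M) = ennreal ((\<Sum>S\<in>batches K M. f S) / card (batches K M))"
proof -
  have "(\<integral>\<^sup>+S. ennreal (f S) \<partial>batch_law K M) = (\<Sum>S\<in>batches K M. ennreal (f S / card (batches K M)))"
    using assms by (simp add: batch_law_def uniform_count_measure_def nn_integral_point_measure_finite
        flip: ennreal_mult)
  also have "\<dots> = ennreal (\<Sum>S\<in>batches K M. f S / card (batches K M))"
    using assms by (intro sum_ennreal) auto
  finally show ?thesis
    by (simp add: sum_divide_distrib)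
qed

section \<open>Gaussian noise and measurability\<close>

lemma nn_integral_std_normal: "(\<integral>\<^sup>+t. ennreal (std_normal_density t) \<partial>lborel) = 1"
  using prob_space.emeasure_space_1[OF prob_space_normal_density[of 1 0]]
  by (simp add: emeasure_density)

lemma sets_std_gaussian [measurable_cong]: "sets std_gaussian = sets borel"
  by (simp add: std_gaussian_def)

text \<open>With all factors 1 this gives the total mass; with a single factor
  \<open>\<bar>t\<bar>\<close> it gives the first absolute moment of one coordinate.\<close>

lemma nn_integral_std_gaussian_prod:
  fixes g :: "'a::euclidean_space \<Rightarrow> real \<Rightarrow> ennreal"
  assumes [measurable]: "\<And>b. b \<in> Basis \<Longrightarrow> g b \<in> borel_measurable borel"
  shows "(\<integral>\<^sup>+x. (\<Prod>b\<in>Basis. g b (x \<bullet> b)) \<partial>std_gaussian)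
    = (\<Prod>b\<in>Basis. \<integral>\<^sup>+t. ennreal (std_normal_density t) * g b t \<partial>lborel)"
proof -
  have "(\<integral>\<^sup>+x. (\<Prod>b\<in>Basis. g b (x \<bullet> b)) \<partial>std_gaussian)
      = (\<integral>\<^sup>+x. (\<Prod>b\<in>Basis. ennreal (std_normal_density (x \<bullet> b)) * g b (x \<bullet> b)) \<partial>lborel)"
    unfolding std_gaussian_def
    by (subst nn_integral_density) (auto simp: prod.distrib prod_ennreal)
  also have "\<dots> = (\<Prod>b\<in>Basis. \<integral>\<^sup>+t. ennreal (std_normal_density t) * g b t \<partial>lborel)"
    by (rule nn_integral_lborel_prod) auto
  finally show ?thesis .
qed

lemma prob_space_std_gaussian: "prob_space (std_gaussian :: 'a::euclidean_space measure)"
proof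
  have "emeasure std_gaussian (space (std_gaussian :: 'a measure))
      = (\<integral>\<^sup>+x. (\<Prod>b\<in>(Basis :: 'a set). 1) \<partial>(std_gaussian :: 'a measure))"
    by simp
  also have "\<dots> = 1"
    by (subst nn_integral_std_gaussian_prod) (simp_all add: nn_integral_std_normal)
  finally show "emeasure (std_gaussian :: 'a measure) (space std_gaussian) = 1" .
qed

lemma std_gaussian_moment: "(\<integral>\<^sup>+z. ennreal (norm z) \<partial>(std_gaussian :: 'a::euclidean_space measure)) < \<infinity>"
proof -
  have abs_moment: "(\<integral>\<^sup>+t. ennreal (std_normal_density t) * ennreal \<bar>t\<bar> \<partial>lborel) < \<infinity>"
    using integrable_std_normal_moment_abs[of 1]
    by (simp add: integrable_iff_bounded abs_mult ennreal_mult)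
  have coordinate: "(\<integral>\<^sup>+z. ennreal \<bar>z \<bullet> b\<bar> \<partial>(std_gaussian :: 'a measure)) < \<infinity>" if b: "b \<in> Basis" for b
  proof -
    have "(\<integral>\<^sup>+z. ennreal \<bar>z \<bullet> b\<bar> \<partial>(std_gaussian :: 'a measure))
        = (\<integral>\<^sup>+z. (\<Prod>b'\<in>Basis. if b' = b then ennreal \<bar>z \<bullet> b'\<bar> else 1) \<partial>std_gaussian)"
      using b by (simp add: prod.delta)
    also have "\<dots> = (\<Prod>b'\<in>Basis. \<integral>\<^sup>+t. ennreal (std_normal_density t) * (if b' = b then ennreal \<bar>t\<bar> else 1) \<partial>lborel)"
      by (rule nn_integral_std_gaussian_prod) auto
    also have "\<dots> = (\<Prod>b'\<in>Basis. if b' = b then \<integral>\<^sup>+t. ennreal (std_normal_density t) * ennreal \<bar>t\<bar> \<partial>lborel else 1)"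
      by (intro prod.cong refl) (auto simp: nn_integral_std_normal)
    also have "\<dots> = (\<integral>\<^sup>+t. ennreal (std_normal_density t) * ennreal \<bar>t\<bar> \<partial>lborel)"
      using b by (simp add: prod.delta)
    finally show ?thesis
      using abs_moment by simp
  qed
  have "(\<integral>\<^sup>+z. ennreal (norm z) \<partial>(std_gaussian :: 'a measure))
      \<le> (\<integral>\<^sup>+z. (\<Sum>b\<in>Basis. ennreal \<bar>z \<bullet> b\<bar>) \<partial>(std_gaussian :: 'a measure))"
    by (intro nn_integral_mono) (simp add: norm_le_l1 ennreal_leI sum_ennreal)
  also have "\<dots> = (\<Sum>b\<in>Basis. \<integral>\<^sup>+z. ennreal \<bar>z \<bullet> b\<bar> \<partial>(std_gaussian :: 'a measure))"
    by (rule nn_integral_sum) simp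
  also have "\<dots> < \<infinity>"
    using coordinate by (simp add: less_top[symmetric])
  finally show ?thesis .
qed

lemma space_state_space: "space (state_space K M) = UNIV \<times> batches K M"
  by (simp add: state_space_def space_pair_measure)

text \<open>The second component takes finitely many values, so measurability on each slice is
  enough.\<close>

lemma measurable_on_state_space:
  fixes h :: "'a::euclidean_space \<times> nat set \<Rightarrow> real"
  assumes "\<And>S. S \<in> batches K M \<Longrightarrow> (\<lambda>\<theta>. h (\<theta>, S)) \<in> borel_measurable borel"
  shows "h \<in> borel_measurable (state_space K M)"
proof -
  have "(\<lambda>x. h (fst x, snd x)) \<in> borel_measurable (state_space K M)"
    unfolding state_space_def
  proof (rule measurable_compose_countable'[where f = "\<lambda>S x. h (fst x, S)"])
    show "(\<lambda>x. h (fst x, S)) \<in> borel_measurable (borel \<Otimes>\<^sub>M count_space (batches K M))"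
      if "S \<in> batches K M" for S
      by (rule measurable_compose[OF measurable_fst assms[OF that]])
  qed (auto intro: countable_finite)
  then show ?thesis by simp
qed

lemma Lip_b_measurable:
  assumes h: "h \<in> Lip_b K M L B"
  shows "h \<in> borel_measurable (state_space K M)"
proof (rule measurable_on_state_space)
  fix S assume S: "S \<in> batches K M"
  have lip: "dist (h (x, S)) (h (y, S)) \<le> max L 0 * dist x y" for x y
  proof -
    have "dist (h (x, S)) (h (y, S)) \<le> L * norm (x - y)"
      using h S unfolding Lip_b_def by (force simp: space_state_space state_dist_def dist_real_def)
    also have "\<dots> \<le> max L 0 * dist x y"
      by (auto simp: dist_norm intro: mult_right_mono)
    finally show ?thesis .
  qed
  have "continuous_on UNIV (\<lambda>\<theta>. h (\<theta>, S))"
    by (rule lipschitz_on_continuous_on[of "max L 0"]) (auto intro: lipschitz_onI lip)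
  then show "(\<lambda>\<theta>. h (\<theta>, S)) \<in> borel_measurable borel"
    by (rule borel_measurable_continuous_onI)
qed

lemma state_dist_measurable:
  "(\<lambda>(x :: 'a::euclidean_space \<times> nat set, y). state_dist x y) \<in> borel_measurable (state_space K M \<Otimes>\<^sub>M state_space K M)"
proof -
  have "(\<lambda>z. norm (fst (fst z) - fst (snd z)) + (if snd (fst z) \<noteq> snd (snd z) then 1 else 0 :: real))
      \<in> borel_measurable ((state_space K M :: ('a \<times> nat set) measure) \<Otimes>\<^sub>M state_space K M)"
    unfolding state_space_def
  proof (rule measurable_compose_countable'[where g = "\<lambda>z. snd (fst z)" and I = "batches K M"
        and f = "\<lambda>S z. norm (fst (fst z) - fst (snd z)) + (if S \<noteq> snd (snd z) then 1 else 0 :: real)"])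
    fix S assume "S \<in> batches K M"
    show "(\<lambda>z. norm (fst (fst z) - fst (snd z)) + (if S \<noteq> snd (snd z) then 1 else 0 :: real))
      \<in> borel_measurable (((borel :: 'a measure) \<Otimes>\<^sub>M count_space (batches K M)) \<Otimes>\<^sub>M ((borel :: 'a measure) \<Otimes>\<^sub>M count_space (batches K M)))"
    proof (rule measurable_compose_countable'[where g = "\<lambda>z. snd (snd z)" and I = "batches K M"
        and f = "\<lambda>S' z. norm (fst (fst z) - fst (snd z)) + (if S \<noteq> S' then 1 else 0 :: real)"])
      show "(\<lambda>z. norm (fst (fst z) - fst (snd z)) + (if S \<noteq> S' then 1 else 0 :: real))
        \<in> borel_measurable (((borel :: 'a measure) \<Otimes>\<^sub>M count_space (batches K M)) \<Otimes>\<^sub>M ((borel :: 'a measure) \<Otimes>\<^sub>M count_space (batches K M)))" for S'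
        by measurable
    qed (auto intro: countable_finite)
  qed (auto intro: countable_finite)
  then show ?thesis
    by (simp add: state_dist_def split_beta')
qed

lemma stoch_grad_measurable:
  assumes U: "sgld_condition K U Lt mU"
    and f: "f \<in> N \<rightarrow>\<^sub>M borel" and g: "g \<in> N \<rightarrow>\<^sub>M count_space (batches K M)"
  shows "(\<lambda>\<omega>. stoch_grad K M U (f \<omega>) (g \<omega>)) \<in> N \<rightarrow>\<^sub>M borel"
proof (rule measurable_compose_countable'[OF _ g countable_finite])
  fix S assume S: "S \<in> batches K M"
  have "grad (U i) \<in> borel \<rightarrow>\<^sub>M borel" if "i \<in> {0..K}" for i
    using U that by (intro borel_measurable_continuous_onI) (auto simp: sgld_condition_def)
  from measurable_compose[OF f this] have [measurable]: "(\<lambda>\<omega>. grad (U i) (f \<omega>)) \<in> N \<rightarrow>\<^sub>M borel" if "i \<in> {0..K}" for i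
    using that by blast
  show "(\<lambda>\<omega>. stoch_grad K M U (f \<omega>) S) \<in> N \<rightarrow>\<^sub>M borel"
    unfolding stoch_grad_def using S
    by (intro borel_measurable_add borel_measurable_scaleR borel_measurable_sum borel_measurable_const)
       (auto simp: batches_def)
qed simp

lemma sgld_step_measurable:
  assumes U: "sgld_condition K U Lt mU" and f: "f \<in> N \<rightarrow>\<^sub>M borel"
    and g: "g \<in> N \<rightarrow>\<^sub>M count_space (batches K M)" and z: "z \<in> N \<rightarrow>\<^sub>M borel"
  shows "(\<lambda>\<omega>. sgld_step K M U \<gamma> (f \<omega>) (g \<omega>) (z \<omega>)) \<in> N \<rightarrow>\<^sub>M borel"
  unfolding sgld_step_def using stoch_grad_measurable[OF U f g] f z by measurable

text \<open>The second component of the state is overwritten by the fresh batch of the innovation.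
  Two copies with a common innovation agree in it after one step, which removes the discrete part of
  \<open>state_dist\<close>.\<close>

definition sgld_map :: "nat \<Rightarrow> nat \<Rightarrow> (nat \<Rightarrow> 'a::euclidean_space \<Rightarrow> real) \<Rightarrow> real \<Rightarrow>
    'a \<times> nat set \<Rightarrow> nat set \<times> 'a \<times> nat set \<Rightarrow> 'a \<times> nat set" where
  "sgld_map K M U \<gamma> x s = (sgld_step K M U \<gamma> (fst x) (fst s) (fst (snd s)), snd (snd s))"

lemma sets_innovation_law [measurable_cong]:
  "sets (innovation_law K M) = sets (count_space (batches K M) \<Otimes>\<^sub>M (borel \<Otimes>\<^sub>M count_space (batches K M)))"
  unfolding innovation_law_def by (intro sets_pair_measure_cong sets_batch_law sets_std_gaussian)

lemma sgld_map_measurable: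
  assumes U: "sgld_condition K U Lt mU"
  shows "(\<lambda>(x, s). sgld_map K M U \<gamma> x s) \<in> state_space K M \<Otimes>\<^sub>M innovation_law K M \<rightarrow>\<^sub>M state_space K M"
  unfolding sgld_map_def split_beta' state_space_def
  by (intro measurable_Pair sgld_step_measurable[OF U]) measurable

lemma prob_space_innovation_law:
  assumes M: "M \<in> {1..K}"
  shows "prob_space (innovation_law K M :: (nat set \<times> 'a::euclidean_space \<times> nat set) measure)"
proof -
  interpret bl: prob_space "batch_law K M" by (rule prob_space_batch_law[OF M])
  interpret g: prob_space "std_gaussian :: 'a measure" by (rule prob_space_std_gaussian)
  interpret gb: pair_prob_space "std_gaussian :: 'a measure" "batch_law K M" ..
  interpret bgb: pair_prob_space "batch_law K M" "(std_gaussian :: 'a measure) \<Otimes>\<^sub>M batch_law K M" ..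
  show ?thesis
    unfolding innovation_law_def by unfold_locales
qed

lemma nn_integral_innovation_law:
  assumes M: "M \<in> {1..K}"
    and f: "f \<in> borel_measurable (innovation_law K M :: (nat set \<times> 'a::euclidean_space \<times> nat set) measure)"
  shows "(\<integral>\<^sup>+s. f s \<partial>innovation_law K M)
    = (\<integral>\<^sup>+S. \<integral>\<^sup>+z. \<integral>\<^sup>+T. f (S, z, T) \<partial>batch_law K M \<partial>std_gaussian \<partial>batch_law K M)"
proof -
  interpret bl: prob_space "batch_law K M" by (rule prob_space_batch_law[OF M])
  interpret g: prob_space "std_gaussian :: 'a measure" by (rule prob_space_std_gaussian)
  interpret gb: pair_prob_space "std_gaussian :: 'a measure" "batch_law K M" ..
  have f': "f \<in> borel_measurable (batch_law K M \<Otimes>\<^sub>M (std_gaussian \<Otimes>\<^sub>M batch_law K M))"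
    using f by (simp add: innovation_law_def)
  have "(\<integral>\<^sup>+s. f s \<partial>innovation_law K M) = (\<integral>\<^sup>+S. \<integral>\<^sup>+p. f (S, p) \<partial>(std_gaussian \<Otimes>\<^sub>M batch_law K M) \<partial>batch_law K M)"
    unfolding innovation_law_def by (rule gb.nn_integral_fst[symmetric, OF f'])
  also have "\<dots> = (\<integral>\<^sup>+S. \<integral>\<^sup>+z. \<integral>\<^sup>+T. f (S, z, T) \<partial>batch_law K M \<partial>std_gaussian \<partial>batch_law K M)"
    using measurable_Pair2[OF f'] by (intro nn_integral_cong bl.nn_integral_fst[symmetric]) auto
  finally show ?thesis .
qed

lemma state_dist_nonneg: "0 \<le> state_dist x y"
  by (simp add: state_dist_def)

lemma state_dist_triangle: "state_dist x z \<le> state_dist x y + state_dist y z"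
  using norm_triangle_ineq[of "fst x - fst y" "fst y - fst z"] by (auto simp: state_dist_def)

lemma contraction_rate_bounds:
  fixes U :: "nat \<Rightarrow> 'a::euclidean_space \<Rightarrow> real"
  assumes U: "sgld_condition K U Lt mU" and \<gamma>: "\<gamma> \<in> {0 <..< 1 / (Lt * (real K + 1))}"
  shows "0 < contraction_rate \<gamma> mU" "contraction_rate \<gamma> mU < 1"
proof -
  have m: "0 < mU"
    using U by (simp add: sgld_condition_def)
  have LK: "mU \<le> Lt * (real K + 1)"
    by (rule strong_convexity_le_lipschitz[OF U])
  have "\<gamma> * mU \<le> \<gamma> * (Lt * (real K + 1))"
    using LK \<gamma> by (intro mult_left_mono) auto
  also have "\<dots> < 1"
    using \<gamma> LK m by (simp add: pos_less_divide_eq)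
  finally have "\<gamma> * mU < 1" .
  moreover have "0 < \<gamma> * mU"
    using \<gamma> m by simp
  ultimately show "0 < contraction_rate \<gamma> mU" "contraction_rate \<gamma> mU < 1"
    by (auto simp: contraction_rate_def)
qed

theorem sgld_contracting_maps:
  fixes U :: "nat \<Rightarrow> 'a::euclidean_space \<Rightarrow> real"
  assumes U: "sgld_condition K U Lt mU" and \<gamma>: "\<gamma> \<in> {0 <..< 1 / (Lt * (real K + 1))}" and M: "M \<in> {1..K}"
  shows "contracting_maps (innovation_law K M) (state_space K M) (sgld_map K M U \<gamma>) state_dist (contraction_rate \<gamma> mU)"
proof -
  interpret Q: prob_space "innovation_law K M :: (nat set \<times> 'a \<times> nat set) measure"
    by (rule prob_space_innovation_law[OF M])
  interpret bl: prob_space "batch_law K M" by (rule prob_space_batch_law[OF M])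
  interpret g: prob_space "std_gaussian :: 'a measure" by (rule prob_space_std_gaussian)
  show ?thesis
  proof
    show "(\<lambda>(x, s). sgld_map K M U \<gamma> x s) \<in> state_space K M \<Otimes>\<^sub>M innovation_law K M \<rightarrow>\<^sub>M state_space K M"
      by (rule sgld_map_measurable[OF U])
    show "(\<lambda>(x, y). state_dist x y) \<in> borel_measurable (state_space K M \<Otimes>\<^sub>M state_space K M)"
      by (rule state_dist_measurable)
    show "0 \<le> state_dist x y" "state_dist x y = state_dist y x" "state_dist x z \<le> state_dist x y + state_dist y z" for x y z :: "'a \<times> nat set"
      by (rule state_dist_nonneg, simp add: state_dist_def norm_minus_commute, rule state_dist_triangle)
    show "0 < contraction_rate \<gamma> mU" "contraction_rate \<gamma> mU < 1"
      by (rule contraction_rate_bounds[OF U \<gamma>])+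
    fix x y :: "'a \<times> nat set" assume x: "x \<in> space (state_space K M)" and y: "y \<in> space (state_space K M)"
    \<comment> \<open>The Gaussian terms cancel and the second components coincide, so the distance
      after one step depends on the batch alone; \<open>r\<close> evaluates it with noise 0.\<close>
    define r where "r S = norm (sgld_step K M U \<gamma> (fst x) S 0 - sgld_step K M U \<gamma> (fst y) S 0)" for S
    have d: "state_dist (sgld_map K M U \<gamma> x s) (sgld_map K M U \<gamma> y s) = r (fst s)" for s
      by (simp add: state_dist_def sgld_map_def r_def sgld_step_def)
    have m: "(\<lambda>s. ennreal (r (fst s))) \<in> borel_measurable (innovation_law K M :: (nat set \<times> 'a \<times> nat set) measure)"
      unfolding innovation_law_def
      by (rule measurable_compose[OF measurable_fst]) (simp cong: measurable_cong_sets add: sets_batch_law)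
    have "(\<integral>\<^sup>+s. ennreal (state_dist (sgld_map K M U \<gamma> x s) (sgld_map K M U \<gamma> y s)) \<partial>innovation_law K M)
        = (\<integral>\<^sup>+S. ennreal (r S) \<partial>batch_law K M)"
      unfolding d by (subst nn_integral_innovation_law[OF M m]) (simp add: bl.emeasure_space_1 g.emeasure_space_1)
    also have "\<dots> = ennreal ((\<Sum>S\<in>batches K M. r S) / card (batches K M))"
      by (rule nn_integral_batch_law) (simp add: r_def)
    also have "\<dots> \<le> ennreal (contraction_rate \<gamma> mU * norm (fst x - fst y))"
      unfolding r_def by (intro ennreal_leI sgld_step_contraction[OF U \<gamma> M])
    also have "\<dots> \<le> ennreal (contraction_rate \<gamma> mU * state_dist x y)"
      using contraction_rate_bounds[OF U \<gamma>] by (intro ennreal_leI mult_left_mono) (auto simp: state_dist_def)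
    also have "\<dots> = ennreal (contraction_rate \<gamma> mU) * ennreal (state_dist x y)"
      using contraction_rate_bounds[OF U \<gamma>] by (intro ennreal_mult) (auto simp: state_dist_nonneg)
    finally show "(\<integral>\<^sup>+s. ennreal (state_dist (sgld_map K M U \<gamma> x s) (sgld_map K M U \<gamma> y s)) \<partial>innovation_law K M)
        \<le> ennreal (contraction_rate \<gamma> mU) * ennreal (state_dist x y)" .
  qed
qed

theorem sgld_invariant_maps:
  fixes U :: "nat \<Rightarrow> 'a::euclidean_space \<Rightarrow> real"
  assumes U: "sgld_condition K U Lt mU" and \<gamma>: "\<gamma> \<in> {0 <..< 1 / (Lt * (real K + 1))}" and M: "M \<in> {1..K}"
    and \<pi>: "sgld_invariant K M U \<gamma> \<pi>"
  shows "invariant_maps (innovation_law K M) (state_space K M) (sgld_map K M U \<gamma>) state_dist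
    (contraction_rate \<gamma> mU) (\<pi> \<Otimes>\<^sub>M batch_law K M)"
proof -
  interpret c: contracting_maps "innovation_law K M" "state_space K M" "sgld_map K M U \<gamma>" state_dist "contraction_rate \<gamma> mU"
    by (rule sgld_contracting_maps[OF U \<gamma> M])
  interpret bl: prob_space "batch_law K M" by (rule prob_space_batch_law[OF M])
  interpret g: prob_space "std_gaussian :: 'a measure" by (rule prob_space_std_gaussian)
  interpret p: prob_space \<pi>
    using \<pi> by (simp add: sgld_invariant_def)
  interpret pb: pair_prob_space \<pi> "batch_law K M" ..
  interpret bg: pair_prob_space "batch_law K M" "std_gaussian :: 'a measure" ..
  define \<mu> where "\<mu> = \<pi> \<Otimes>\<^sub>M batch_law K M"
  have sets_\<pi> [measurable_cong]: "sets \<pi> = sets borel"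
    using \<pi> by (simp add: sgld_invariant_def)
  have sets_\<mu> [measurable_cong]: "sets \<mu> = sets (state_space K M)"
    unfolding \<mu>_def state_space_def by (intro sets_pair_measure_cong sets_\<pi> sets_batch_law)
  define st where "st = (\<lambda>(\<theta>, S, z). sgld_step K M U \<gamma> \<theta> S z)"
  have st: "st \<in> \<pi> \<Otimes>\<^sub>M (batch_law K M \<Otimes>\<^sub>M std_gaussian) \<rightarrow>\<^sub>M borel"
    unfolding st_def split_beta' by (intro sgld_step_measurable[OF U]) measurable
  have Fm: "(\<lambda>(x, s). sgld_map K M U \<gamma> x s) \<in> \<mu> \<Otimes>\<^sub>M innovation_law K M \<rightarrow>\<^sub>M state_space K M"
    using c.F_measurable by (simp cong: measurable_cong_sets)
  have inv: "distr (\<pi> \<Otimes>\<^sub>M (batch_law K M \<Otimes>\<^sub>M std_gaussian)) borel st = \<pi>"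
    using \<pi> by (simp add: sgld_invariant_def st_def)
  have "distr (\<mu> \<Otimes>\<^sub>M innovation_law K M) (state_space K M) (\<lambda>(x, s). sgld_map K M U \<gamma> x s) = \<mu>"
  proof (rule measure_eqI)
    fix A assume "A \<in> sets (distr (\<mu> \<Otimes>\<^sub>M innovation_law K M) (state_space K M) (\<lambda>(x, s). sgld_map K M U \<gamma> x s))"
    then have A [measurable]: "A \<in> sets (state_space K M)" by simp
    have A': "A \<in> sets (\<pi> \<Otimes>\<^sub>M batch_law K M)"
      using A by (simp add: sets_\<mu>[unfolded \<mu>_def])
    \<comment> \<open>Integrates out the fresh auxiliary batch first; what remains is a function of
      the new \<theta> alone, to which the invariance of \<open>\<pi>\<close> applies.\<close>
    define H where "H y = (\<integral>\<^sup>+T. indicator A (y, T) \<partial>batch_law K M)" for y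
    have indA: "indicator A \<in> borel_measurable (\<pi> \<Otimes>\<^sub>M batch_law K M)"
      using A' by simp
    have H: "H \<in> borel_measurable \<pi>"
      unfolding H_def by (rule bl.borel_measurable_nn_integral_fst[OF indA])
    have H' : "H \<in> borel_measurable borel"
      using H by (simp cong: measurable_cong_sets)
    have ind: "(\<lambda>s. indicator A (sgld_map K M U \<gamma> x s) :: ennreal) \<in> borel_measurable (innovation_law K M)"
      if x: "x \<in> space (state_space K M)" for x
      using that by measurable
    have stx: "(\<lambda>(S, z). sgld_step K M U \<gamma> \<theta> S z) \<in> batch_law K M \<Otimes>\<^sub>M std_gaussian \<rightarrow>\<^sub>M borel" for \<theta>
      unfolding split_beta' by (intro sgld_step_measurable[OF U]) measurable
    have one: "(\<integral>\<^sup>+s. indicator A (sgld_map K M U \<gamma> x s) \<partial>innovation_law K M)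
        = (\<integral>\<^sup>+p. H (st (fst x, p)) \<partial>(batch_law K M \<Otimes>\<^sub>M std_gaussian))" if x: "x \<in> space (state_space K M)" for x
    proof -
      have "(\<integral>\<^sup>+s. indicator A (sgld_map K M U \<gamma> x s) \<partial>innovation_law K M)
          = (\<integral>\<^sup>+S. \<integral>\<^sup>+z. H (sgld_step K M U \<gamma> (fst x) S z) \<partial>std_gaussian \<partial>batch_law K M)"
        by (subst nn_integral_innovation_law[OF M ind[OF x]]) (simp add: sgld_map_def H_def)
      also have "\<dots> = (\<integral>\<^sup>+p. H (case p of (S, z) \<Rightarrow> sgld_step K M U \<gamma> (fst x) S z) \<partial>(batch_law K M \<Otimes>\<^sub>M std_gaussian))"
        using g.nn_integral_fst[OF measurable_compose[OF stx H']] by simp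
      finally show ?thesis
        by (simp add: st_def split_beta')
    qed
    have "emeasure (distr (\<mu> \<Otimes>\<^sub>M innovation_law K M) (state_space K M) (\<lambda>(x, s). sgld_map K M U \<gamma> x s)) A
        = (\<integral>\<^sup>+y. indicator A y \<partial>distr (\<mu> \<Otimes>\<^sub>M innovation_law K M) (state_space K M) (\<lambda>(x, s). sgld_map K M U \<gamma> x s))"
      by simp
    also have "\<dots> = (\<integral>\<^sup>+p. indicator A (case p of (x, s) \<Rightarrow> sgld_map K M U \<gamma> x s) \<partial>(\<mu> \<Otimes>\<^sub>M innovation_law K M))"
      by (rule nn_integral_distr[OF Fm]) simp
    also have "\<dots> = (\<integral>\<^sup>+x. \<integral>\<^sup>+s. indicator A (sgld_map K M U \<gamma> x s) \<partial>innovation_law K M \<partial>\<mu>)"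
      using c.Q.nn_integral_fst[OF measurable_compose[OF Fm, of "indicator A" borel]] by simp
    also have "\<dots> = (\<integral>\<^sup>+x. \<integral>\<^sup>+p. H (st (fst x, p)) \<partial>(batch_law K M \<Otimes>\<^sub>M std_gaussian) \<partial>\<mu>)"
      by (intro nn_integral_cong one) (simp add: sets_eq_imp_space_eq[OF sets_\<mu>])
    also have "\<dots> = (\<integral>\<^sup>+\<theta>. \<integral>\<^sup>+p. H (st (\<theta>, p)) \<partial>(batch_law K M \<Otimes>\<^sub>M std_gaussian) \<partial>\<pi>)"
    proof -
      have "(\<lambda>\<theta>. \<integral>\<^sup>+p. H (st (\<theta>, p)) \<partial>(batch_law K M \<Otimes>\<^sub>M std_gaussian)) \<in> borel_measurable \<pi>"
        by (rule bg.borel_measurable_nn_integral_fst[OF measurable_compose[OF st H']])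
      then have "(\<lambda>x. \<integral>\<^sup>+p. H (st (fst x, p)) \<partial>(batch_law K M \<Otimes>\<^sub>M std_gaussian)) \<in> borel_measurable (\<pi> \<Otimes>\<^sub>M batch_law K M)"
        by (rule measurable_compose[OF measurable_fst])
      from bl.nn_integral_fst[OF this] show ?thesis
        unfolding \<mu>_def by (simp add: bl.emeasure_space_1)
    qed
    also have "\<dots> = (\<integral>\<^sup>+q. H (st q) \<partial>(\<pi> \<Otimes>\<^sub>M (batch_law K M \<Otimes>\<^sub>M std_gaussian)))"
      by (rule bg.nn_integral_fst[OF measurable_compose[OF st H']])
    also have "\<dots> = (\<integral>\<^sup>+y. H y \<partial>distr (\<pi> \<Otimes>\<^sub>M (batch_law K M \<Otimes>\<^sub>M std_gaussian)) borel st)"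
      using H' by (intro nn_integral_distr[symmetric, OF st]) simp
    also have "\<dots> = (\<integral>\<^sup>+y. H y \<partial>\<pi>)"
      by (simp only: inv)
    also have "\<dots> = emeasure \<mu> A"
      unfolding H_def \<mu>_def by (rule bl.emeasure_pair_measure[OF A', symmetric])
    finally show "emeasure (distr (\<mu> \<Otimes>\<^sub>M innovation_law K M) (state_space K M) (\<lambda>(x, s). sgld_map K M U \<gamma> x s)) A = emeasure \<mu> A" .
  qed (simp add: sets_\<mu>)
  then show ?thesis
    using sets_\<mu> unfolding \<mu>_def by unfold_locales
qed

subsection \<open>Wasserstein distances and moments\<close>

lemma (in pair_prob_space) distr_pair_snd: "distr (M1 \<Otimes>\<^sub>M M2) M2 snd = M2"
proof (rule measure_eqI)
  fix A assume A: "A \<in> sets (distr (M1 \<Otimes>\<^sub>M M2) M2 snd)"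
  then have "emeasure (distr (M1 \<Otimes>\<^sub>M M2) M2 snd) A = emeasure (M1 \<Otimes>\<^sub>M M2) (space M1 \<times> A)"
    by (auto simp: emeasure_distr space_pair_measure dest: sets.sets_into_space intro!: arg_cong2[where f = emeasure])
  with A show "emeasure (distr (M1 \<Otimes>\<^sub>M M2) M2 snd) A = emeasure M2 A"
    by (simp add: M2.emeasure_pair_measure_Times M1.emeasure_space_1)
qed simp

lemma ennreal_le_add_INF:
  fixes c u :: ennreal
  assumes "\<And>i. i \<in> I \<Longrightarrow> c \<le> u + f i"
  shows "c \<le> u + (INF i\<in>I. f i)"
proof (cases "u = \<infinity>")
  case False
  then have "c - u \<le> (INF i\<in>I. f i)"
    using assms by (intro INF_greatest) (simp add: ennreal_minus_le_iff)
  with False show ?thesis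
    by (simp add: ennreal_minus_le_iff)
qed simp

lemma state_dist_commute: "state_dist x y = state_dist y x"
  by (auto simp: state_dist_def norm_minus_commute)

lemma state_dist_fun_measurable:
  assumes "f \<in> N \<rightarrow>\<^sub>M state_space K M" "g \<in> N \<rightarrow>\<^sub>M state_space K M"
  shows "(\<lambda>\<omega>. ennreal (state_dist (f \<omega>) (g \<omega>))) \<in> borel_measurable N"
  using measurable_compose[OF measurable_Pair[OF assms] state_dist_measurable] by simp

lemma state_dist_from_measurable:
  "x \<in> space (state_space K M) \<Longrightarrow> (\<lambda>y. ennreal (state_dist x y)) \<in> borel_measurable (state_space K M)"
  by (rule state_dist_fun_measurable[OF measurable_const measurable_ident_sets[OF refl]])

lemma state_dist_ennreal_triangle:
  "ennreal (state_dist x z) \<le> ennreal (state_dist x y) + ennreal (state_dist y z)"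
  using state_dist_triangle by (simp add: state_dist_nonneg ennreal_leI flip: ennreal_plus)

lemma coupling_moment:
  assumes \<Gamma>: "\<Gamma> \<in> couplings K M \<nu> \<mu>" and x: "x \<in> space (state_space K M)"
  shows "(\<integral>\<^sup>+y. ennreal (state_dist x y) \<partial>\<mu>)
      \<le> (\<integral>\<^sup>+y. ennreal (state_dist x y) \<partial>\<nu>) + (\<integral>\<^sup>+p. ennreal (state_dist (fst p) (snd p)) \<partial>\<Gamma>)"
    and "(\<integral>\<^sup>+y. ennreal (state_dist x y) \<partial>\<nu>)
      \<le> (\<integral>\<^sup>+y. ennreal (state_dist x y) \<partial>\<mu>) + (\<integral>\<^sup>+p. ennreal (state_dist (fst p) (snd p)) \<partial>\<Gamma>)"
proof -
  have sets [measurable_cong]: "sets \<Gamma> = sets (state_space K M \<Otimes>\<^sub>M state_space K M)"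
    and fst: "distr \<Gamma> (state_space K M) fst = \<nu>" and snd: "distr \<Gamma> (state_space K M) snd = \<mu>"
    using \<Gamma> by (auto simp: couplings_def)
  have m1: "fst \<in> \<Gamma> \<rightarrow>\<^sub>M state_space K M" and m2: "snd \<in> \<Gamma> \<rightarrow>\<^sub>M state_space K M"
    by measurable
  have mx: "(\<lambda>_. x) \<in> N \<rightarrow>\<^sub>M state_space K M" for N
    using x by simp
  have d: "(\<lambda>y. ennreal (state_dist x y)) \<in> borel_measurable (state_space K M)"
    by (rule state_dist_from_measurable[OF x])
  have \<nu>: "(\<integral>\<^sup>+y. ennreal (state_dist x y) \<partial>\<nu>) = (\<integral>\<^sup>+p. ennreal (state_dist x (fst p)) \<partial>\<Gamma>)"
    using d by (simp add: nn_integral_distr[OF m1] flip: fst)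
  have \<mu>: "(\<integral>\<^sup>+y. ennreal (state_dist x y) \<partial>\<mu>) = (\<integral>\<^sup>+p. ennreal (state_dist x (snd p)) \<partial>\<Gamma>)"
    using d by (simp add: nn_integral_distr[OF m2] flip: snd)
  note meas = state_dist_fun_measurable[OF m1 m2] state_dist_fun_measurable[OF mx m1] state_dist_fun_measurable[OF mx m2]
  have "(\<integral>\<^sup>+p. ennreal (state_dist x (snd p)) \<partial>\<Gamma>)
      \<le> (\<integral>\<^sup>+p. ennreal (state_dist x (fst p)) + ennreal (state_dist (fst p) (snd p)) \<partial>\<Gamma>)"
    by (intro nn_integral_mono state_dist_ennreal_triangle)
  also have "\<dots> = (\<integral>\<^sup>+p. ennreal (state_dist x (fst p)) \<partial>\<Gamma>) + (\<integral>\<^sup>+p. ennreal (state_dist (fst p) (snd p)) \<partial>\<Gamma>)"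
    by (intro nn_integral_add meas)
  finally show "(\<integral>\<^sup>+y. ennreal (state_dist x y) \<partial>\<mu>)
      \<le> (\<integral>\<^sup>+y. ennreal (state_dist x y) \<partial>\<nu>) + (\<integral>\<^sup>+p. ennreal (state_dist (fst p) (snd p)) \<partial>\<Gamma>)"
    unfolding \<nu> \<mu> .
  have "(\<integral>\<^sup>+p. ennreal (state_dist x (fst p)) \<partial>\<Gamma>)
      \<le> (\<integral>\<^sup>+p. ennreal (state_dist x (snd p)) + ennreal (state_dist (fst p) (snd p)) \<partial>\<Gamma>)"
    by (intro nn_integral_mono) (metis state_dist_ennreal_triangle state_dist_commute)
  also have "\<dots> = (\<integral>\<^sup>+p. ennreal (state_dist x (snd p)) \<partial>\<Gamma>) + (\<integral>\<^sup>+p. ennreal (state_dist (fst p) (snd p)) \<partial>\<Gamma>)"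
    by (intro nn_integral_add meas)
  finally show "(\<integral>\<^sup>+y. ennreal (state_dist x y) \<partial>\<nu>)
      \<le> (\<integral>\<^sup>+y. ennreal (state_dist x y) \<partial>\<mu>) + (\<integral>\<^sup>+p. ennreal (state_dist (fst p) (snd p)) \<partial>\<Gamma>)"
    unfolding \<nu> \<mu> .
qed

lemma moment_le_W1:
  assumes "x \<in> space (state_space K M)"
  shows "(\<integral>\<^sup>+y. ennreal (state_dist x y) \<partial>\<nu>) \<le> (\<integral>\<^sup>+y. ennreal (state_dist x y) \<partial>\<mu>) + W1 K M \<nu> \<mu>"
  unfolding W1_def by (rule ennreal_le_add_INF, rule coupling_moment(2)[OF _ assms])

text \<open>The point mass has moment 0 about its own atom, so the triangle inequality under any
  coupling leaves only the transport cost.\<close>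

lemma moment_le_W1_return:
  assumes x: "x \<in> space (state_space K M)"
  shows "(\<integral>\<^sup>+y. ennreal (state_dist x y) \<partial>\<mu>) \<le> W1 K M (return (state_space K M) x) \<mu>"
proof -
  have "(\<integral>\<^sup>+y. ennreal (state_dist x y) \<partial>return (state_space K M) x) = 0"
    using x by (subst nn_integral_return[OF x state_dist_from_measurable[OF x]]) (simp add: state_dist_def)
  moreover have "(\<integral>\<^sup>+y. ennreal (state_dist x y) \<partial>\<mu>)
      \<le> (\<integral>\<^sup>+y. ennreal (state_dist x y) \<partial>return (state_space K M) x) + W1 K M (return (state_space K M) x) \<mu>"
    unfolding W1_def by (rule ennreal_le_add_INF, rule coupling_moment(1)[OF _ x])
  ultimately show ?thesis by simp
qed

text \<open>The independent coupling bounds the distance by first moments; this yields the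
  finiteness under which \<open>enn2real\<close> loses nothing.\<close>

lemma W1_le_product:
  fixes \<nu> \<mu> :: "('a::euclidean_space \<times> nat set) measure"
  assumes "prob_space \<nu>" "prob_space \<mu>"
    and sets_\<nu> [measurable_cong]: "sets \<nu> = sets (state_space K M)"
    and sets_\<mu> [measurable_cong]: "sets \<mu> = sets (state_space K M)"
  shows "W1 K M \<nu> \<mu> \<le> (\<integral>\<^sup>+x. \<integral>\<^sup>+y. ennreal (state_dist x y) \<partial>\<mu> \<partial>\<nu>)"
proof -
  interpret \<nu>: prob_space \<nu> by fact
  interpret \<mu>: prob_space \<mu> by fact
  interpret pair_prob_space \<nu> \<mu> ..
  have "distr (\<nu> \<Otimes>\<^sub>M \<mu>) (state_space K M) fst = distr (\<nu> \<Otimes>\<^sub>M \<mu>) \<nu> fst"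
    by (rule distr_cong) (simp_all add: sets_\<nu>)
  moreover have "distr (\<nu> \<Otimes>\<^sub>M \<mu>) (state_space K M) snd = distr (\<nu> \<Otimes>\<^sub>M \<mu>) \<mu> snd"
    by (rule distr_cong) (simp_all add: sets_\<mu>)
  ultimately have "\<nu> \<Otimes>\<^sub>M \<mu> \<in> couplings K M \<nu> \<mu>"
    unfolding couplings_def using \<mu>.distr_pair_fst[of \<nu>] distr_pair_snd
    by (auto intro!: sets_pair_measure_cong sets_\<nu> sets_\<mu>)
  then have "W1 K M \<nu> \<mu> \<le> (\<integral>\<^sup>+p. ennreal (state_dist (fst p) (snd p)) \<partial>(\<nu> \<Otimes>\<^sub>M \<mu>))"
    unfolding W1_def by (rule INF_lower)
  also have "\<dots> = (\<integral>\<^sup>+x. \<integral>\<^sup>+y. ennreal (state_dist x y) \<partial>\<mu> \<partial>\<nu>)"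
  proof -
    have "(\<lambda>p. ennreal (state_dist (fst p) (snd p))) \<in> borel_measurable (\<nu> \<Otimes>\<^sub>M \<mu>)"
      by (rule state_dist_fun_measurable) measurable
    from \<mu>.nn_integral_fst[OF this] show ?thesis by simp
  qed
  finally show ?thesis .
qed

lemma product_moment:
  fixes \<nu> \<mu> :: "('a::euclidean_space \<times> nat set) measure"
  assumes \<nu>: "prob_space \<nu>" and \<mu>: "prob_space \<mu>"
    and sets_\<nu> [measurable_cong]: "sets \<nu> = sets (state_space K M)"
    and sets_\<mu> [measurable_cong]: "sets \<mu> = sets (state_space K M)"
    and x: "x \<in> space (state_space K M)"
  shows "(\<integral>\<^sup>+u. \<integral>\<^sup>+y. ennreal (state_dist u y) \<partial>\<mu> \<partial>\<nu>)
    \<le> (\<integral>\<^sup>+u. ennreal (state_dist x u) \<partial>\<nu>) + (\<integral>\<^sup>+y. ennreal (state_dist x y) \<partial>\<mu>)"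
proof -
  interpret \<nu>: prob_space \<nu> by fact
  interpret \<mu>: prob_space \<mu> by fact
  have d: "(\<lambda>y. ennreal (state_dist x y)) \<in> borel_measurable (state_space K M)"
    by (rule state_dist_from_measurable[OF x])
  have d\<nu>: "(\<lambda>y. ennreal (state_dist x y)) \<in> borel_measurable \<nu>" and d\<mu>: "(\<lambda>y. ennreal (state_dist x y)) \<in> borel_measurable \<mu>"
    using d by (simp_all cong: measurable_cong_sets add: sets_\<nu> sets_\<mu>)
  have "(\<integral>\<^sup>+u. \<integral>\<^sup>+y. ennreal (state_dist u y) \<partial>\<mu> \<partial>\<nu>)
      \<le> (\<integral>\<^sup>+u. \<integral>\<^sup>+y. ennreal (state_dist x u) + ennreal (state_dist x y) \<partial>\<mu> \<partial>\<nu>)"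
  proof (intro nn_integral_mono)
    fix u y :: "'a \<times> nat set"
    show "ennreal (state_dist u y) \<le> ennreal (state_dist x u) + ennreal (state_dist x y)"
      using state_dist_ennreal_triangle[of u y x] by (simp add: state_dist_commute[of u x])
  qed
  also have "\<dots> = (\<integral>\<^sup>+u. ennreal (state_dist x u) + (\<integral>\<^sup>+y. ennreal (state_dist x y) \<partial>\<mu>) \<partial>\<nu>)"
    using d\<mu> by (simp add: nn_integral_add \<mu>.emeasure_space_1)
  also have "\<dots> = (\<integral>\<^sup>+u. ennreal (state_dist x u) \<partial>\<nu>) + (\<integral>\<^sup>+y. ennreal (state_dist x y) \<partial>\<mu>)"
    using d\<nu> by (simp add: nn_integral_add \<nu>.emeasure_space_1)
  finally show ?thesis .
qed

text \<open>Supplies the drift hypothesis of \<open>invariant_moment\<close>. The constant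
  \<open>C\<close> takes 1 for a possible change of batch and bounds the gradient by its sum over
  the finitely many batches.\<close>

lemma sgld_map_moment:
  fixes U :: "nat \<Rightarrow> 'a::euclidean_space \<Rightarrow> real"
  assumes U: "sgld_condition K U Lt mU" and \<gamma>: "0 < \<gamma>" and M: "M \<in> {1..K}"
    and x: "x \<in> space (state_space K M)"
  shows "(\<integral>\<^sup>+s. ennreal (state_dist (sgld_map K M U \<gamma> x s) x) \<partial>innovation_law K M) < \<infinity>"
proof -
  interpret Q: prob_space "innovation_law K M :: (nat set \<times> 'a \<times> nat set) measure"
    by (rule prob_space_innovation_law[OF M])
  interpret bl: prob_space "batch_law K M" by (rule prob_space_batch_law[OF M])
  define C where "C = 1 + \<gamma> * (\<Sum>S\<in>batches K M. norm (stoch_grad K M U (fst x) S))"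
  have C: "0 \<le> C"
    using \<gamma> by (simp add: C_def sum_nonneg)
  have le: "state_dist (sgld_map K M U \<gamma> x s) x \<le> C + sqrt (2 * \<gamma>) * norm (fst (snd s))"
    if "s \<in> space (innovation_law K M)" for s
  proof -
    have S: "fst s \<in> batches K M"
      using that by (auto simp: innovation_law_def space_pair_measure space_batch_law)
    have "norm (stoch_grad K M U (fst x) (fst s)) \<le> (\<Sum>S\<in>batches K M. norm (stoch_grad K M U (fst x) S))"
      using S by (intro member_le_sum) auto
    then have g: "\<gamma> * norm (stoch_grad K M U (fst x) (fst s)) \<le> C - 1"
      using \<gamma> by (simp add: C_def)
    have "state_dist (sgld_map K M U \<gamma> x s) x
        \<le> norm (- (\<gamma> *\<^sub>R stoch_grad K M U (fst x) (fst s)) + sqrt (2 * \<gamma>) *\<^sub>R fst (snd s)) + 1"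
      by (simp add: state_dist_def sgld_map_def sgld_step_def)
    also have "\<dots> \<le> \<gamma> * norm (stoch_grad K M U (fst x) (fst s)) + sqrt (2 * \<gamma>) * norm (fst (snd s)) + 1"
      using norm_triangle_ineq[of "- (\<gamma> *\<^sub>R stoch_grad K M U (fst x) (fst s))" "sqrt (2 * \<gamma>) *\<^sub>R fst (snd s)"] \<gamma>
      by simp
    finally show ?thesis
      using g by linarith
  qed
  have m: "(\<lambda>s. ennreal (norm (fst (snd s)))) \<in> borel_measurable (innovation_law K M :: (nat set \<times> 'a \<times> nat set) measure)"
    by measurable
  have "(\<integral>\<^sup>+s. ennreal (state_dist (sgld_map K M U \<gamma> x s) x) \<partial>innovation_law K M)
      \<le> (\<integral>\<^sup>+s. ennreal C + ennreal (sqrt (2 * \<gamma>)) * ennreal (norm (fst (snd s)))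
        \<partial>(innovation_law K M :: (nat set \<times> 'a \<times> nat set) measure))"
  proof (rule nn_integral_mono)
    fix s :: "nat set \<times> 'a \<times> nat set" assume "s \<in> space (innovation_law K M)"
    from le[OF this] show "ennreal (state_dist (sgld_map K M U \<gamma> x s) x)
        \<le> ennreal C + ennreal (sqrt (2 * \<gamma>)) * ennreal (norm (fst (snd s)))"
      using C \<gamma> by (simp add: ennreal_leI flip: ennreal_mult ennreal_plus)
  qed
  also have "\<dots> = ennreal C + ennreal (sqrt (2 * \<gamma>)) * (\<integral>\<^sup>+s. ennreal (norm (fst (snd s))) \<partial>(innovation_law K M :: (nat set \<times> 'a \<times> nat set) measure))"
    using m by (simp add: nn_integral_add nn_integral_cmult Q.emeasure_space_1)
  also have "(\<integral>\<^sup>+s. ennreal (norm (fst (snd s))) \<partial>(innovation_law K M :: (nat set \<times> 'a \<times> nat set) measure))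
      = (\<integral>\<^sup>+z. ennreal (norm z) \<partial>(std_gaussian :: 'a measure))"
    by (subst nn_integral_innovation_law[OF M m]) (simp add: bl.emeasure_space_1)
  also have "ennreal C + ennreal (sqrt (2 * \<gamma>)) * (\<integral>\<^sup>+z. ennreal (norm z) \<partial>(std_gaussian :: 'a measure)) < \<infinity>"
    using std_gaussian_moment[where 'a = 'a] by (simp add: ennreal_mult_less_top)
  finally show ?thesis .
qed

lemma sgld_started_maps:
  fixes U :: "nat \<Rightarrow> 'a::euclidean_space \<Rightarrow> real"
  assumes U: "sgld_condition K U Lt mU" and \<gamma>: "\<gamma> \<in> {0 <..< 1 / (Lt * (real K + 1))}" and M: "M \<in> {1..K}"
    and \<pi>: "sgld_invariant K M U \<gamma> \<pi>" and \<xi>: "\<xi> \<in> S1 K M" and \<mu>: "\<mu> = \<pi> \<Otimes>\<^sub>M batch_law K M"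
    and a: "a = mean_W1 K M \<mu> + 1" and a': "a' = enn2real (W1 K M \<xi> \<mu>) + a" and c1: "a' + 2 * a \<le> c1"
  obtains x0 where "started_maps (innovation_law K M) (state_space K M) (sgld_map K M U \<gamma>) state_dist
    (contraction_rate \<gamma> mU) \<mu> x0 a \<xi> a' c1"
proof -
  interpret inv: invariant_maps "innovation_law K M" "state_space K M" "sgld_map K M U \<gamma>" state_dist
      "contraction_rate \<gamma> mU" \<mu>
    unfolding \<mu> by (rule sgld_invariant_maps[OF U \<gamma> M \<pi>])
  have \<xi>p: "prob_space \<xi>" and sets_\<xi>: "sets \<xi> = sets (state_space K M)"
    and \<xi>m: "\<And>x. x \<in> space (state_space K M) \<Longrightarrow> (\<integral>\<^sup>+y. ennreal (state_dist x y) \<partial>\<xi>) < \<infinity>"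
    using \<xi> by (auto simp: S1_def)
  have \<mu>p: "prob_space \<mu>"
    by (rule inv.\<mu>.prob_space_axioms)
  have \<gamma>0: "0 < \<gamma>"
    using \<gamma> by simp
  have fin: "(\<integral>\<^sup>+y. ennreal (state_dist x y) \<partial>\<mu>) < \<infinity>" if x: "x \<in> space (state_space K M)" for x
    using inv.invariant_moment[OF x sgld_map_moment[OF U \<gamma>0 M x]] by (simp add: state_dist_commute)
  obtain x1 :: "'a \<times> nat set" where x1: "x1 \<in> space (state_space K M)"
    using inv.\<mu>.not_empty unfolding inv.space_\<mu> by blast
  define w where "w x = W1 K M (return (state_space K M) x) \<mu>" for x
  have w_le: "w x \<le> (\<integral>\<^sup>+y. ennreal (state_dist x y) \<partial>\<mu>)" if x: "x \<in> space (state_space K M)" for x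
  proof -
    have "w x \<le> (\<integral>\<^sup>+u. \<integral>\<^sup>+y. ennreal (state_dist u y) \<partial>\<mu> \<partial>return (state_space K M) x)"
      unfolding w_def using x by (intro W1_le_product prob_space_return \<mu>p) (simp_all add: inv.sets_\<mu>)
    also have "\<dots> \<le> (\<integral>\<^sup>+u. ennreal (state_dist x u) \<partial>return (state_space K M) x) + (\<integral>\<^sup>+y. ennreal (state_dist x y) \<partial>\<mu>)"
      using x by (intro product_moment[where K = K and M = M] prob_space_return \<mu>p) (simp_all add: inv.sets_\<mu>)
    also have "(\<integral>\<^sup>+u. ennreal (state_dist x u) \<partial>return (state_space K M) x) = 0"
      by (subst nn_integral_return[OF x state_dist_from_measurable[OF x]]) (simp add: state_dist_def)
    finally show ?thesis by simp
  qed
  have "(\<integral>\<^sup>+x. w x \<partial>\<mu>) \<le> (\<integral>\<^sup>+x. \<integral>\<^sup>+y. ennreal (state_dist x y) \<partial>\<mu> \<partial>\<mu>)"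
    by (intro nn_integral_mono w_le) (simp add: inv.space_\<mu>)
  also have "\<dots> \<le> (\<integral>\<^sup>+u. ennreal (state_dist x1 u) \<partial>\<mu>) + (\<integral>\<^sup>+y. ennreal (state_dist x1 y) \<partial>\<mu>)"
    by (rule product_moment[OF \<mu>p \<mu>p inv.sets_\<mu> inv.sets_\<mu> x1])
  also have "\<dots> < \<infinity>"
    using fin[OF x1] by simp
  finally have mean: "(\<integral>\<^sup>+x. w x \<partial>\<mu>) = ennreal (mean_W1 K M \<mu>)"
    unfolding mean_W1_def w_def by (simp add: less_top)
  have mean0: "0 \<le> mean_W1 K M \<mu>"
    by (simp add: mean_W1_def)
  \<comment> \<open>Averaging: if the mean distance exceeded \<open>a\<close> at every point, so
    would \<open>w\<close>, and its integral \<open>mean_W1 K M \<mu>\<close> would be at least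
    \<open>mean_W1 K M \<mu> + 1\<close>. Only monotonicity of the integral is used, as
    \<open>w\<close> is an infimum over couplings.\<close>
  have "\<exists>x0\<in>space (state_space K M). (\<integral>\<^sup>+y. ennreal (state_dist x0 y) \<partial>\<mu>) \<le> ennreal a"
  proof (rule ccontr)
    assume "\<not> ?thesis"
    then have "ennreal a \<le> w x" if "x \<in> space (state_space K M)" for x
      using that moment_le_W1_return[OF that, of \<mu>] unfolding w_def by (force intro: order_trans less_imp_le)
    then have "(\<integral>\<^sup>+x. ennreal a \<partial>\<mu>) \<le> (\<integral>\<^sup>+x. w x \<partial>\<mu>)"
      by (intro nn_integral_mono) (simp add: inv.space_\<mu>)
    then have "ennreal a \<le> ennreal (mean_W1 K M \<mu>)"
      by (simp add: mean inv.\<mu>.emeasure_space_1)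
    then show False
      using mean0 by (simp add: a)
  qed
  then obtain x0 where x0: "x0 \<in> space (state_space K M)" and mom: "(\<integral>\<^sup>+y. ennreal (state_dist x0 y) \<partial>\<mu>) \<le> ennreal a"
    by blast
  have "W1 K M \<xi> \<mu> \<le> (\<integral>\<^sup>+u. \<integral>\<^sup>+y. ennreal (state_dist u y) \<partial>\<mu> \<partial>\<xi>)"
    by (intro W1_le_product \<xi>p \<mu>p sets_\<xi> inv.sets_\<mu>)
  also have "\<dots> \<le> (\<integral>\<^sup>+u. ennreal (state_dist x0 u) \<partial>\<xi>) + (\<integral>\<^sup>+y. ennreal (state_dist x0 y) \<partial>\<mu>)"
    by (rule product_moment[OF \<xi>p \<mu>p sets_\<xi> inv.sets_\<mu> x0])
  also have "\<dots> < \<infinity>"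
    using fin[OF x0] \<xi>m[OF x0] by simp
  finally have W: "W1 K M \<xi> \<mu> = ennreal (enn2real (W1 K M \<xi> \<mu>))"
    by (simp add: less_top)
  have "(\<integral>\<^sup>+y. ennreal (state_dist x0 y) \<partial>\<xi>) \<le> (\<integral>\<^sup>+y. ennreal (state_dist x0 y) \<partial>\<mu>) + W1 K M \<xi> \<mu>"
    by (rule moment_le_W1[OF x0])
  also have "\<dots> \<le> ennreal a + ennreal (enn2real (W1 K M \<xi> \<mu>))"
    using mom by (subst W) (rule add_right_mono)
  also have "\<dots> = ennreal a'"
    using mean0 by (simp add: a a' add.commute flip: ennreal_plus)
  finally have mom\<xi>: "(\<integral>\<^sup>+y. ennreal (state_dist x0 y) \<partial>\<xi>) \<le> ennreal a'" .
  have pos: "0 < a" "0 \<le> a'"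
    using mean0 by (auto simp: a a')
  interpret \<xi>: prob_space \<xi> by (rule \<xi>p)
  have "started_maps (innovation_law K M) (state_space K M) (sgld_map K M U \<gamma>) state_dist
    (contraction_rate \<gamma> mU) \<mu> x0 a \<xi> a' c1"
  proof unfold_locales
    show "x0 \<in> space (state_space K M)" by (rule x0)
    show "(\<integral>\<^sup>+y. ennreal (state_dist y x0) \<partial>\<mu>) \<le> ennreal a"
      using mom by (simp add: state_dist_commute)
    show "(\<integral>\<^sup>+y. ennreal (state_dist y x0) \<partial>\<xi>) \<le> ennreal a'"
      using mom\<xi> by (simp add: state_dist_commute)
  qed (use sets_\<xi> pos c1 in auto)
  then show thesis
    by (rule that)
qed

lemma Lip_b_constants_nonneg:
  fixes h :: "'a::euclidean_space \<times> nat set \<Rightarrow> real"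
  assumes h: "h \<in> Lip_b K M L B" and M: "M \<in> {1..K}"
  shows "0 \<le> L" "0 \<le> B"
proof -
  obtain S where S: "S \<in> batches K M"
    using batches_nonempty[OF M] by blast
  obtain e :: 'a where e: "norm e = 1"
    using SOME_Basis norm_Basis by blast
  have "\<bar>h (e, S) - h (0, S)\<bar> \<le> L * state_dist (e, S) (0, S)"
    using h S by (simp add: Lip_b_def space_state_space)
  then show "0 \<le> L"
    using e by (simp add: state_dist_def)
  have "\<bar>h (0, S)\<bar> \<le> B"
    using h S by (simp add: Lip_b_def space_state_space)
  then show "0 \<le> B" by simp
qed

lemma sgld_path_eq_path:
  assumes "contracting_maps Q X (sgld_map K M U \<gamma>) d \<Delta>"
  shows "sgld_path K M U \<gamma> x e k = contracting_maps.path (sgld_map K M U \<gamma>) x e k"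
proof -
  interpret contracting_maps Q X "sgld_map K M U \<gamma>" d \<Delta> by fact
  have "sgld_path K M U \<gamma> x e (Suc k) = sgld_map K M U \<gamma> (sgld_path K M U \<gamma> x e k) (e k)" for k
    by (simp add: sgld_map_def split_beta)
  then show ?thesis
    by (induction k) (simp_all del: sgld_path.simps(2))
qed

subsection \<open>The main result\<close>

text \<open>With Lipschitz constant 0 the bound of \<open>autocov_decay\<close> is 0. This settles
  both the constant member of the class and the degenerate case \<open>L * B = 0\<close>.\<close>

lemma (in stationary_maps) long_run_var_zero:
  assumes "lip_fun g \<beta> 0" "(\<integral>x. g x \<partial>\<mu>) = 0"
  shows "long_run_var g = 0"
proof -
  have "autocov g l = 0" for l
    using autocov_decay[OF assms, of l] by simp
  then have "autocov g = (\<lambda>_. 0)"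
    by (simp add: fun_eq_iff)
  then show ?thesis
    by (simp add: long_run_var_def)
qed

lemma asymp_var_eq_long_run_var:
  fixes U :: "nat \<Rightarrow> 'a::euclidean_space \<Rightarrow> real"
  assumes s: "stationary_maps (innovation_law K M) (state_space K M) (sgld_map K M U \<gamma>) d \<Delta> \<mu> x0 a"
    and g: "stationary_maps.lip_fun (state_space K M) d (\<lambda>x. h x - c) \<beta> L"
    and center: "(\<integral>x. h x - c \<partial>\<mu>) = 0"
  shows "asymp_var K M U \<gamma> \<mu> c h
    = stationary_maps.long_run_var (innovation_law K M) (sgld_map K M U \<gamma>) \<mu> (\<lambda>x. h x - c)"
proof -
  interpret stationary_maps "innovation_law K M" "state_space K M" "sgld_map K M U \<gamma>" d \<Delta> \<mu> x0 a
    by (rule s)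
  have path: "sgld_path K M U \<gamma> x e k = path x e k" for x e k
    by (rule sgld_path_eq_path) unfold_locales
  interpret f: geometric_decay "autocov (\<lambda>x. h x - c)" "\<beta> * L * a" \<Delta>
    by (rule geometric_decay_autocov[OF g center])
  have "asymp_var K M U \<gamma> \<mu> c h = infsum (\<lambda>l::int. autocov (\<lambda>x. h x - c) (nat \<bar>l\<bar>)) UNIV"
    by (simp add: asymp_var_def autocov_def lag_mean_def driving_law_def path split_beta')
  also have "\<dots> = long_run_var (\<lambda>x. h x - c)"
    unfolding long_run_var_def by (rule infsum_even_int[OF f.abs_summable])
  finally show ?thesis .
qed

text \<open>Both \<open>h\<close> and its mean are at most \<open>B\<close>, which gives
  \<open>2 * B\<close>; the additional 1 secures the lower bound on \<open>\<beta>\<close> in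
  \<open>lip_fun\<close>. If \<open>L * B = 0\<close>, then either \<open>L = 0\<close> or
  \<open>h\<close> vanishes on the state space, and Lipschitz constant 0 is admissible.\<close>

lemma Lip_b_centered:
  fixes h :: "'a::euclidean_space \<times> nat set \<Rightarrow> real"
  assumes s: "stationary_maps Q (state_space K M) F state_dist \<Delta> \<mu> x0 a"
    and M: "M \<in> {1..K}" and h: "h \<in> Lip_b K M L B" and c: "c = (\<integral>x. h x \<partial>\<mu>)"
  shows "stationary_maps.lip_fun (state_space K M) state_dist (\<lambda>x. h x - c) (2 * B + 1) L"
    and "(\<integral>x. h x - c \<partial>\<mu>) = 0"
    and "L * B = 0 \<Longrightarrow> stationary_maps.lip_fun (state_space K M) state_dist (\<lambda>x. h x - c) (2 * B + 1) 0"
    and "integrable \<mu> h"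
proof -
  interpret stationary_maps Q "state_space K M" F state_dist \<Delta> \<mu> x0 a
    by (rule s)
  have LB: "0 \<le> L" "0 \<le> B"
    by (rule Lip_b_constants_nonneg[OF h M])+
  have hm: "h \<in> borel_measurable (state_space K M)"
    by (rule Lip_b_measurable[OF h])
  have bound: "\<bar>h x\<bar> \<le> B" if "x \<in> space (state_space K M)" for x
    using h that by (simp add: Lip_b_def)
  have lip: "\<bar>h x - h y\<bar> \<le> L * state_dist x y" if "x \<in> space (state_space K M)" "y \<in> space (state_space K M)" for x y
    using h that by (simp add: Lip_b_def)
  show int: "integrable \<mu> h"
    using bound hm by (intro \<mu>.integrable_const_bound[of _ B]) (auto simp: space_\<mu> cong: measurable_cong_sets)
  have "\<bar>c\<bar> \<le> (\<integral>x. \<bar>h x\<bar> \<partial>\<mu>)"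
    unfolding c by (rule integral_abs_bound)
  also have "\<dots> \<le> (\<integral>x. B \<partial>\<mu>)"
    using int bound by (intro integral_mono) (auto simp: space_\<mu>)
  finally have cB: "\<bar>c\<bar> \<le> B"
    by (simp add: \<mu>.prob_space)
  have hc: "\<bar>h x - c\<bar> \<le> 2 * B + 1" if "x \<in> space (state_space K M)" for x
    using bound[OF that] cB by linarith
  show "lip_fun (\<lambda>x. h x - c) (2 * B + 1) L"
    unfolding lip_fun_def using hm LB hc lip by simp
  show "(\<integral>x. h x - c \<partial>\<mu>) = 0"
    using int by (simp add: c \<mu>.prob_space)
  assume "L * B = 0"
  then have "\<bar>(h x - c) - (h y - c)\<bar> \<le> 0 * state_dist x y"
    if "x \<in> space (state_space K M)" "y \<in> space (state_space K M)" for x y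
    using lip[OF that] bound[OF that(1)] bound[OF that(2)] by auto
  then have zero: "\<forall>x\<in>space (state_space K M). \<forall>y\<in>space (state_space K M).
      \<bar>(h x - c) - (h y - c)\<bar> \<le> 0 * state_dist x y"
    by blast
  show "lip_fun (\<lambda>x. h x - c) (2 * B + 1) 0"
    unfolding lip_fun_def by (intro conjI zero) (use hm LB hc in auto)
qed

text \<open>The estimates are proved on the canonical space. A chain on any \<open>P\<close> is a
  fixed function of its initial state and innovations, whose joint law is
  \<open>driving_law\<close>, so events pull back with the same probability.\<close>

lemma sgld_chain_pullback:
  fixes U :: "nat \<Rightarrow> 'a::euclidean_space \<Rightarrow> real"
  assumes chain: "sgld_chain K M U \<gamma> \<xi> P \<theta> S Z T" and A: "A \<in> sets (driving_law K M \<xi>)"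
  obtains A' where "A' \<in> sets P" "measure P A' = measure (driving_law K M \<xi>) A"
    "\<And>\<omega>. \<omega> \<in> A' \<Longrightarrow> \<exists>(x, e)\<in>A. \<forall>k. (\<theta> k \<omega>, T k \<omega>) = sgld_path K M U \<gamma> x e k"
proof -
  define D where "D = (\<lambda>\<omega>. ((\<theta> 0 \<omega>, T 0 \<omega>), \<lambda>k. (S (Suc k) \<omega>, Z (Suc k) \<omega>, T (Suc k) \<omega>)))"
  have D: "D \<in> P \<rightarrow>\<^sub>M driving_law K M \<xi>" and distr: "distr P (driving_law K M \<xi>) D = driving_law K M \<xi>"
    and step: "\<And>k \<omega>. \<omega> \<in> space P \<Longrightarrow> \<theta> (Suc k) \<omega> = sgld_step K M U \<gamma> (\<theta> k \<omega>) (S (Suc k) \<omega>) (Z (Suc k) \<omega>)"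
    using chain by (auto simp: sgld_chain_def Let_def D_def)
  define A' where "A' = D -` A \<inter> space P"
  have path: "(\<theta> k \<omega>, T k \<omega>) = sgld_path K M U \<gamma> (fst (D \<omega>)) (snd (D \<omega>)) k" if "\<omega> \<in> space P" for k \<omega>
  proof (induction k)
    case (Suc k)
    then have "fst (sgld_path K M U \<gamma> (fst (D \<omega>)) (snd (D \<omega>)) k) = \<theta> k \<omega>"
      by (metis fst_conv)
    then show ?case
      by (simp add: D_def step[OF that])
  qed (simp add: D_def)
  have "measure P A' = measure (distr P (driving_law K M \<xi>) D) A"
    unfolding A'_def by (rule measure_distr[OF D A, symmetric])
  moreover have "A' \<in> sets P"
    unfolding A'_def by (rule measurable_sets[OF D A])
  moreover have "\<exists>(x, e)\<in>A. \<forall>k. (\<theta> k \<omega>, T k \<omega>) = sgld_path K M U \<gamma> x e k" if "\<omega> \<in> A'" for \<omega>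
    using that path unfolding A'_def by (intro bexI[of _ "D \<omega>"]) auto
  ultimately show thesis
    using that distr by simp
qed

text \<open>The quantities \<open>\<integral> W1(\<delta>\<^sub>x, \<mu>) d\<mu>\<close> and \<open>W1(\<xi>, \<mu>)\<close> are recovered from \<open>\<sigma>\<close> and \<open>R\<close>, the latter
  as an upper bound.\<close>

definition sgld_excess_const ::
  "real \<Rightarrow> real \<Rightarrow> real \<Rightarrow> real \<Rightarrow> real \<Rightarrow> real \<Rightarrow> real \<Rightarrow> real \<Rightarrow> real" where
  "sgld_excess_const \<rho> C\<rho> L B mU \<gamma> R \<sigma> =
     (let \<Delta> = contraction_rate \<gamma> mU; a = \<sigma> / (2 * L * B) + 1;
          c1 = (R * (1 - sqrt \<Delta>) / (2 * B))\<^sup>2 / (2 * L * B) + 3 * a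
      in \<bar>excess_const (2 * B + 1) L a c1 \<Delta> \<rho> C\<rho>\<bar>)"

text \<open>Undoing the prefactor of \<open>const_R\<close> leaves a sum of two nonnegative terms,
  one of which is \<open>sqrt (2 * L * B * W)\<close>; dropping the other and squaring isolates
  \<open>W\<close>.\<close>

lemma W1_le_const_R:
  assumes L: "0 < L" and B: "0 < B" and \<Delta>: "\<Delta> < 1"
  shows "enn2real (W1 K M \<xi> \<mu>) \<le> (const_R K M L B \<Delta> \<xi> \<mu> * (1 - sqrt \<Delta>) / (2 * B))\<^sup>2 / (2 * L * B)"
proof -
  define W m where "W = enn2real (W1 K M \<xi> \<mu>)" and "m = mean_W1 K M \<mu>"
  have nn: "0 \<le> W" "0 \<le> m"
    by (auto simp: W_def m_def mean_W1_def)
  have "const_R K M L B \<Delta> \<xi> \<mu> * (1 - sqrt \<Delta>) / (2 * B) = 2 * L * sqrt W * sqrt m + sqrt (2 * L * B * W)"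
    using B \<Delta> by (simp add: const_R_def W_def m_def)
  moreover have "2 * L * B * W \<le> (2 * L * sqrt W * sqrt m + sqrt (2 * L * B * W))\<^sup>2"
  proof -
    have "(sqrt (2 * L * B * W))\<^sup>2 \<le> (2 * L * sqrt W * sqrt m + sqrt (2 * L * B * W))\<^sup>2"
      using L B nn by (intro power_mono) auto
    then show ?thesis
      using L B nn by simp
  qed
  ultimately show ?thesis
    using L B unfolding W_def[symmetric] by (simp add: pos_le_divide_eq mult_ac)
qed

theorem corollary3p8:
  "\<exists>C :: real \<Rightarrow> real \<Rightarrow> real \<Rightarrow> real \<Rightarrow> ('a::euclidean_space \<times> nat set) measure \<Rightarrow>
         real \<Rightarrow> real \<Rightarrow> real \<Rightarrow> real \<Rightarrow> real \<Rightarrow> real.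
   \<forall>(K::nat) (M::nat) (U :: nat \<Rightarrow> 'a \<Rightarrow> real) (Lt::real) (mU::real) (\<gamma>::real)
    (\<xi> :: ('a \<times> nat set) measure) (\<pi> :: 'a measure) (\<mu> :: ('a \<times> nat set) measure)
    (f :: 'a \<Rightarrow> real) (\<G> :: ('a \<times> nat set \<Rightarrow> real) set) (\<H> :: ('a \<times> nat set \<Rightarrow> real) set)
    (L::real) (B::real) (w :: real \<Rightarrow> real) (\<rho>::real) (C\<rho>::real) (\<Delta>::real) (c::real)
    (V :: ('a \<times> nat set \<Rightarrow> real) \<Rightarrow> real) (bound :: nat \<Rightarrow> real).
     M \<in> {1..K} \<longrightarrow>
     sgld_condition K U Lt mU \<longrightarrow>
     \<gamma> \<in> {0 <..< 1 / (Lt * (real K + 1))} \<longrightarrow>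
     \<xi> \<in> S1 K M \<longrightarrow>
     sgld_invariant K M U \<gamma> \<pi> \<longrightarrow>
     \<mu> = \<pi> \<Otimes>\<^sub>M batch_law K M \<longrightarrow>
     (\<forall>g\<in>\<G>. integrable \<mu> g \<and> (\<integral>x. g x \<partial>\<mu>) = 0) \<longrightarrow>
     \<H> = (\<lambda>g x. f (fst x) - g x) ` \<G> \<longrightarrow>
     \<H> \<subseteq> Lip_b K M L B \<longrightarrow>
     L2_totally_bounded \<mu> \<H> \<longrightarrow>
     \<rho> > 0 \<longrightarrow> C\<rho> > 0 \<longrightarrow> parametric_class \<mu> \<H> C\<rho> \<rho> \<longrightarrow>
     lag_window w \<longrightarrow>
     \<Delta> = contraction_rate \<gamma> mU \<longrightarrow>
     c = (\<integral>x. f (fst x) \<partial>\<mu>) \<longrightarrow>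
     V = asymp_var K M U \<gamma> \<mu> c \<longrightarrow>
     bound = (\<lambda>n. C \<rho> C\<rho> L B \<xi> mU \<gamma> (const_D \<mu> \<H>) (const_R K M L B \<Delta> \<xi> \<mu>) (const_sigma K M L B \<mu>)
                  * real n powr (-1/2) * ln (real n) powr (5/2)) \<longrightarrow>
     (\<exists>\<epsilon> :: nat \<Rightarrow> real. (\<forall>n\<ge>2. \<epsilon> n > 0) \<and>
       (\<forall>(P :: 'w measure) \<theta> S Z T. sgld_chain K M U \<gamma> \<xi> P \<theta> S Z T \<longrightarrow>
         (\<forall>n\<ge>2. \<forall>\<H>\<epsilon> hhat. minimal_L2_net \<mu> \<H> (\<epsilon> n) \<H>\<epsilon> \<longrightarrow>
           (\<forall>\<omega>\<in>space P. is_arg_min (spectral_var w (bandwidth \<Delta> n) n (\<lambda>k. (\<theta> k \<omega>, T k \<omega>)))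
                                   (\<lambda>h. h \<in> \<H>\<epsilon>) (hhat \<omega>)) \<longrightarrow>
           (\<exists>A\<in>sets P. measure P A \<ge> 1 - 1 / real n \<and>
             (\<forall>\<omega>\<in>A. V (hhat \<omega>) - (INF h\<in>\<H>. V h) \<le> bound n \<and>
                    ((\<exists>h\<in>\<H>. \<forall>x\<in>space (state_space K M). h x = c) \<longrightarrow> V (hhat \<omega>) \<le> bound n)))))) \<and>
     ((\<exists>h\<in>\<H>. \<forall>x\<in>space (state_space K M). h x = c) \<longrightarrow> (INF h\<in>\<H>. V h) = 0)"
proof (rule exI[of _ "\<lambda>\<rho> C\<rho> L B \<xi> mU \<gamma> D R \<sigma>. sgld_excess_const \<rho> C\<rho> L B mU \<gamma> R \<sigma>"],
    intro allI impI, goal_cases)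
  case (1 K M U Lt mU \<gamma> \<xi> \<pi> \<mu> f \<G> \<H> L B w \<rho> C\<rho> \<Delta> c V bound)
  note M = 1(1) and U = 1(2) and \<gamma> = 1(3) and \<xi> = 1(4) and \<pi> = 1(5) and \<mu> = 1(6) and \<G> = 1(7) and \<H> = 1(8)
    and Lip = 1(9) and \<rho> = 1(11) and C\<rho> = 1(12) and param = 1(13) and w = 1(14) and \<Delta> = 1(15) and c = 1(16)
    and V = 1(17) and bound = 1(18)
  define m where "m = mean_W1 K M \<mu>"
  define a where "a = m + 1"
  define a' where "a' = enn2real (W1 K M \<xi> \<mu>) + a"
  \<comment> \<open>If \<open>L * B = 0\<close>, the formula of \<open>sgld_excess_const\<close>
    divides by zero and may fall below \<open>a' + 2 * a\<close>. The locale then receives the sum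
    itself; that value does not reach the final bound, because all variances vanish.\<close>
  define c1 where "c1 = (if L * B = 0 then a' + 2 * a
    else (const_R K M L B \<Delta> \<xi> \<mu> * (1 - sqrt \<Delta>) / (2 * B))\<^sup>2 / (2 * L * B) + 3 * a)"
  have rate: "0 < \<Delta>" "\<Delta> < 1"
    unfolding \<Delta> by (rule contraction_rate_bounds[OF U \<gamma>])+
  show ?case
  proof (cases "\<H> = {}")
    case True
    \<comment> \<open>No run can occur: \<open>P\<close> has an outcome, whose \<open>hhat\<close>
      would belong to a net contained in the empty class. The claim on the infimum has a false
      premise.\<close>
    have no_min: False if "sgld_chain K M U \<gamma> \<xi> P \<theta> S Z T" "minimal_L2_net \<mu> \<H> \<epsilon> N"
      "\<forall>\<omega>\<in>space P. is_arg_min (v \<omega>) (\<lambda>h. h \<in> N) (hhat \<omega>)"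
      for P :: "'w measure" and \<theta> S Z T \<epsilon> N and hhat :: "'w \<Rightarrow> 'a \<times> nat set \<Rightarrow> real" and v :: "'w \<Rightarrow> ('a \<times> nat set \<Rightarrow> real) \<Rightarrow> real"
    proof -
      have "prob_space P"
        using that(1) by (simp add: sgld_chain_def)
      then obtain \<omega> where "\<omega> \<in> space P"
        using prob_space.not_empty by blast
      then have "hhat \<omega> \<in> N"
        using that(3) by (auto simp: is_arg_min_def)
      then show False
        using that(2) True by (auto simp: minimal_L2_net_def L2_net_def)
    qed
    show ?thesis
      using True by (intro conjI exI[of _ "\<lambda>n. 1 / real n"]) (auto dest: no_min)
  next
    case False
    have LB: "0 \<le> L" "0 \<le> B"
      using False Lip Lip_b_constants_nonneg[OF _ M] by blast+
    have "a' + 2 * a \<le> c1"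
    proof (cases "L * B = 0")
      case False
      with LB have "0 < L" "0 < B" by auto
      from W1_le_const_R[OF this rate(2), of K M \<xi> \<mu>] False show ?thesis
        by (simp add: c1_def a'_def)
    qed (simp add: c1_def)
    then obtain x0 where s: "started_maps (innovation_law K M) (state_space K M) (sgld_map K M U \<gamma>) state_dist
        (contraction_rate \<gamma> mU) \<mu> x0 a \<xi> a' c1"
      using sgld_started_maps[OF U \<gamma> M \<pi> \<xi> \<mu> _ a'_def] by (auto simp: a_def m_def)
    interpret started_maps "innovation_law K M" "state_space K M" "sgld_map K M U \<gamma>" state_dist \<Delta> \<mu> x0 a \<xi> a' c1
      using s unfolding \<Delta> .
    have st: "stationary_maps (innovation_law K M) (state_space K M) (sgld_map K M U \<gamma>) state_dist \<Delta> \<mu> x0 a"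
      by unfold_locales
    have path: "sgld_path K M U \<gamma> x e = path x e" for x e
      by (rule ext, rule sgld_path_eq_path) unfold_locales
    have mean: "c = (\<integral>x. h x \<partial>\<mu>)" if h: "h \<in> \<H>" for h
    proof -
      obtain g where g: "g \<in> \<G>" "h = (\<lambda>x. f (fst x) - g x)"
        using h \<H> by blast
      have ih: "integrable \<mu> h"
        using Lip_b_centered(4)[OF st M _ refl] h Lip by blast
      have ig: "integrable \<mu> g" "(\<integral>x. g x \<partial>\<mu>) = 0"
        using \<G> g by auto
      \<comment> \<open>Integrability of \<open>f\<close> comes from that of its parts:
        \<open>h\<close> is bounded and \<open>g\<close> is integrable with mean 0.\<close>
      have "c = (\<integral>x. h x + g x \<partial>\<mu>)"
        by (simp add: c g(2))
      then show ?thesis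
        using ih ig by simp
    qed
    have lip: "lip_fun (\<lambda>x. h x - c) (2 * B + 1) L"
      and center: "(\<integral>x. h x - c \<partial>\<mu>) = 0"
      and degenerate: "L * B = 0 \<Longrightarrow> lip_fun (\<lambda>x. h x - c) (2 * B + 1) 0" if "h \<in> \<H>" for h
      using Lip_b_centered[OF st M _ mean[OF that]] that Lip by blast+
    have V_eq: "V h = long_run_var (\<lambda>x. h x - c)" if "h \<in> \<H>" for h
      unfolding V by (rule asymp_var_eq_long_run_var[OF st lip[OF that] center[OF that]])
    have V_nonneg: "0 \<le> V h" if "h \<in> \<H>" for h
      unfolding V_eq[OF that] by (rule long_run_var_nonneg[OF lip[OF that] center[OF that]])
    have V_const: "V h = 0" if "h \<in> \<H>" "\<forall>x\<in>space (state_space K M). h x = c" for h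
      unfolding V_eq[OF that(1)]
      using that lip[OF that(1)] by (intro long_run_var_zero[of _ "2 * B + 1"] center) (auto simp: lip_fun_def)
    have INF_zero: "(INF h\<in>\<H>. V h) = 0" if const: "\<exists>h\<in>\<H>. \<forall>x\<in>space (state_space K M). h x = c"
    proof (rule antisym)
      obtain h where h: "h \<in> \<H>" "V h = 0"
        using const V_const by blast
      have "bdd_below (V ` \<H>)"
        using V_nonneg by (auto simp: bdd_below_def)
      then show "(INF h\<in>\<H>. V h) \<le> 0"
        using cINF_lower[of V \<H> h] h by simp
      show "0 \<le> (INF h\<in>\<H>. V h)"
        using False V_nonneg by (intro cINF_greatest)
    qed
    have excess: "\<exists>A\<in>sets P. measure P A \<ge> 1 - 1 / real n \<and> (\<forall>\<omega>\<in>A. \<forall>h\<in>\<H>. V (hhat \<omega>) - V h \<le> bound n)"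
      if chain: "sgld_chain K M U \<gamma> \<xi> P \<theta> S Z T" and n: "2 \<le> n" and net: "minimal_L2_net \<mu> \<H> (1 / real n) N"
        and hhat: "\<forall>\<omega>\<in>space P. is_arg_min (spectral_var w (bandwidth \<Delta> n) n (\<lambda>k. (\<theta> k \<omega>, T k \<omega>))) (\<lambda>h. h \<in> N) (hhat \<omega>)"
      for P :: "'w measure" and \<theta> S Z T n N hhat
    proof -
      interpret law: prob_space P
        using chain by (simp add: sgld_chain_def)
      have N: "finite N" "N \<subseteq> \<H>" "\<And>h. h \<in> \<H> \<Longrightarrow> \<exists>g\<in>N. L2_dist \<mu> h g \<le> 1 / n"
        using net by (auto simp: minimal_L2_net_def L2_net_def)
      have hhat_mem: "hhat \<omega> \<in> \<H>" if "\<omega> \<in> space P" for \<omega>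
        using hhat that N(2) by (auto simp: is_arg_min_def)
      have bound_nonneg: "0 \<le> bound n"
        by (simp add: bound sgld_excess_const_def Let_def)
      show ?thesis
      proof (cases "L * B = 0")
        case True
        have "V h = 0" if "h \<in> \<H>" for h
          unfolding V_eq[OF that] by (rule long_run_var_zero[OF degenerate[OF that True] center[OF that]])
        then show ?thesis
          using bound_nonneg hhat_mem by (intro bexI[of _ "space P"]) (auto simp: law.prob_space)
      next
        case False
        \<comment> \<open>\<open>n \<ge> 2\<close> puts the radius \<open>1 / n\<close> into the
          open unit interval on which \<open>parametric_class\<close> speaks.\<close>
        have "card N \<le> C\<rho> * (1 / real n) powr (- \<rho>)"
          using param net n unfolding parametric_class_def by auto
        also have "(1 / real n) powr (- \<rho>) = n powr \<rho>"
          using n by (simp add: powr_minus powr_divide)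
        finally have card: "card N \<le> C\<rho> * n powr \<rho>" .
        \<comment> \<open>For \<open>L * B \<noteq> 0\<close>, dividing \<open>const_sigma\<close>
          by \<open>2 * L * B\<close> returns \<open>mean_W1\<close> exactly, so the two constants
          differ only by the absolute value, which is there to make \<open>bound\<close>
          nonnegative.\<close>
        have const: "excess_const (2 * B + 1) L a c1 \<Delta> \<rho> C\<rho>
            \<le> sgld_excess_const \<rho> C\<rho> L B mU \<gamma> (const_R K M L B \<Delta> \<xi> \<mu>) (const_sigma K M L B \<mu>)"
          using False by (simp add: sgld_excess_const_def Let_def \<Delta>[symmetric] c1_def a_def m_def const_sigma_def)
        have "1 \<le> 2 * B + 1"
          using LB by simp
        from selection_bound[OF lip center this LB(1) w n refl N(1,2) card N(3) \<rho>]
        obtain A where A: "A \<in> sets (driving_law K M \<xi>)" "1 - 1 / n \<le> measure (driving_law K M \<xi>) A"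
          and excess: "\<And>x e k h. (x, e) \<in> A \<Longrightarrow> is_arg_min (spectral_var w (bandwidth \<Delta> n) n (path x e)) (\<lambda>h. h \<in> N) k \<Longrightarrow> h \<in> \<H> \<Longrightarrow>
            long_run_var (\<lambda>x. k x - c) - long_run_var (\<lambda>x. h x - c)
              \<le> excess_const (2 * B + 1) L a c1 \<Delta> \<rho> C\<rho> * real n powr (-1/2) * ln n powr (5/2)"
          unfolding driving_law_def by blast
        \<comment> \<open>The event stems from \<open>A\<close>, which covers every minimiser at
          once, so no measurability of \<open>hhat\<close> is involved.\<close>
        obtain A' where A': "A' \<in> sets P" "measure P A' = measure (driving_law K M \<xi>) A"
          "\<And>\<omega>. \<omega> \<in> A' \<Longrightarrow> \<exists>(x, e)\<in>A. \<forall>k. (\<theta> k \<omega>, T k \<omega>) = sgld_path K M U \<gamma> x e k"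
          using sgld_chain_pullback[OF chain A(1)] by blast
        have "V (hhat \<omega>) - V h \<le> bound n" if \<omega>: "\<omega> \<in> A'" and h: "h \<in> \<H>" for \<omega> h
        proof -
          obtain x e where xe: "(x, e) \<in> A" "\<And>k. (\<theta> k \<omega>, T k \<omega>) = path x e k"
            using A'(3)[OF \<omega>] unfolding path by blast
          have eq: "(\<lambda>k. (\<theta> k \<omega>, T k \<omega>)) = path x e"
            using xe(2) by (simp add: fun_eq_iff)
          have sp: "\<omega> \<in> space P"
            using \<omega> A'(1) sets.sets_into_space by blast
          have "is_arg_min (spectral_var w (bandwidth \<Delta> n) n (path x e)) (\<lambda>h. h \<in> N) (hhat \<omega>)"
            using bspec[OF hhat sp] unfolding eq .
          from excess[OF xe(1) this h]
          have "V (hhat \<omega>) - V h \<le> excess_const (2 * B + 1) L a c1 \<Delta> \<rho> C\<rho> * real n powr (-1/2) * ln n powr (5/2)"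
            unfolding V_eq[OF h] V_eq[OF hhat_mem[OF sp]] .
          also have "\<dots> \<le> bound n"
            unfolding bound using const by (intro mult_right_mono) auto
          finally show ?thesis .
        qed
        then show ?thesis
          using A A' by (intro bexI[of _ A']) auto
      qed
    qed
    have final: "\<exists>A\<in>sets P. measure P A \<ge> 1 - 1 / real n \<and>
             (\<forall>\<omega>\<in>A. V (hhat \<omega>) - (INF h\<in>\<H>. V h) \<le> bound n \<and>
                    ((\<exists>h\<in>\<H>. \<forall>x\<in>space (state_space K M). h x = c) \<longrightarrow> V (hhat \<omega>) \<le> bound n))"
      if run: "sgld_chain K M U \<gamma> \<xi> P \<theta> S Z T" "2 \<le> n" "minimal_L2_net \<mu> \<H> (1 / real n) N"
        "\<forall>\<omega>\<in>space P. is_arg_min (spectral_var w (bandwidth \<Delta> n) n (\<lambda>k. (\<theta> k \<omega>, T k \<omega>))) (\<lambda>h. h \<in> N) (hhat \<omega>)"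
      for P :: "'w measure" and \<theta> S Z T n N hhat
    proof -
      obtain A where A: "A \<in> sets P" "measure P A \<ge> 1 - 1 / real n"
        "\<And>\<omega> h. \<omega> \<in> A \<Longrightarrow> h \<in> \<H> \<Longrightarrow> V (hhat \<omega>) - V h \<le> bound n"
        using excess[OF run] by blast
      have "V (hhat \<omega>) - (INF h\<in>\<H>. V h) \<le> bound n" if \<omega>: "\<omega> \<in> A" for \<omega>
      proof -
        \<comment> \<open>The event does not depend on \<open>h\<close>, so the infimum can be taken
          outcome by outcome inside it.\<close>
        have "V (hhat \<omega>) - bound n \<le> (INF h\<in>\<H>. V h)"
        proof (rule cINF_greatest[OF \<open>\<H> \<noteq> {}\<close>])
          show "V (hhat \<omega>) - bound n \<le> V h" if "h \<in> \<H>" for h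
            using A(3)[OF \<omega> that] by linarith
        qed
        then show ?thesis by linarith
      qed
      moreover from this have "V (hhat \<omega>) \<le> bound n"
        if "\<omega> \<in> A" "\<exists>h\<in>\<H>. \<forall>x\<in>space (state_space K M). h x = c" for \<omega>
        using INF_zero[OF that(2)] that(1) by (metis diff_zero)
      ultimately show ?thesis
        using A(1,2) by blast
    qed
    show ?thesis
      using final INF_zero by (intro conjI exI[of _ "\<lambda>n. 1 / real n"]) (simp, blast, blast)
  qed
qed

end
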